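(* Let $G_1$ be a graph containing no cycle of length 3 or 4, and define $G_{n+1}=S_{n+3}G_n$ for all $n\geq1$. Then for every $n\ge1$ the map $\psi:A_k(G_n)\to H^{\square}_k(G_n)$ is surjective for all $1\leq k\leq n$.
   Context: All graphs are simple, connected, undirected; a graph map sends equal-or-adjacent vertices to equal-or-adjacent vertices. $I_m$ is the path graph on $\{0,\dots,m\}$, $\times$ the Cartesian product. For $t\ge2$, $S_tG$ is obtained from $G\times I_t$ by contracting $G\times\{0\}$ to one vertex and $G\times\{t\}$ to one vertex. $A_k(G)$: a based map is a graph map $F:\mathbb{Z}^k\to G$ (integer grid graph) equal to a fixed base vertex $v_0$ at all $x$ with $|x_i|\ge r$ for some $i$, some $r\ge 0$; based homotopy classes (homotopies $\mathbb{Z}^k\times I_m\to G$ through based maps) form the group $A_k(G)$ under concatenation in the first coordinate; every class is represented by a graph map $f:I_m^k\to G$ equal to $v_0$ on the vertices having some coordinate $0$ or $m$. Cubical homology: $Q_k=I_1^k$ ($Q_0$ a point), $k$-cubes are graph maps $Q_k\to G$, $D_i^{\pm}\sigma$ inserts $0$/$1$ at coordinate $i$, degenerate cubes have $D_i^-\sigma=D_i^+\sigma$ for some $i$, $C_k(G)$ is free abelian on $k$-cubes modulo degenerate ones, $\partial_k\sigma=\sum_i(-1)^i(D_i^-\sigma-D_i^+\sigma)$, $H^{\square}_k(G)=\ker\partial_k/\operatorname{im}\partial_{k+1}$. $\psi([f])$ is the class of $\phi(f)=\sum_{x\in\{0,\dots,m-1\}^k}f^x$, $f^x(y)=f(x+y)$;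 $\psi$ is a well-defined homomorphism. *)

theory Defs
  imports "HOL-Library.FuncSet" "HOL-Library.Poly_Mapping"
    "HOL-Algebra.Coset" "HOL-Algebra.Free_Abelian_Groups"
begin

section \<open>Graphs\<close>

record 'v ugraph =
  verts :: "'v set"
  adj :: "'v \<Rightarrow> 'v \<Rightarrow> bool"

text \<open>Simple, undirected, connected (in particular nonempty) graphs; they may be infinite.\<close>

definition connected_graph :: "'v ugraph \<Rightarrow> bool" where
  "connected_graph G \<longleftrightarrow>
     (\<forall>u v. adj G u v \<longrightarrow> u \<in> verts G \<and> v \<in> verts G \<and> u \<noteq> v \<and> adj G v u) \<and>
     verts G \<noteq> {} \<and>
     (\<forall>u\<in>verts G. \<forall>v\<in>verts G. (adj G)\<^sup>*\<^sup>* u v)"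

text \<open>A cycle is given by its cyclic list of vertices, which need not be induced.\<close>

definition is_cycle :: "'v ugraph \<Rightarrow> 'v list \<Rightarrow> bool" where
  "is_cycle G c \<longleftrightarrow> 3 \<le> length c \<and> distinct c \<and> set c \<subseteq> verts G \<and>
     (\<forall>i<length c. adj G (c ! i) (c ! (Suc i mod length c)))"

text \<open>Maps are extensional (\<open>undefined\<close> off the vertex set), so that equality of graph maps
  is equality of functions on the vertices.\<close>

definition graph_maps :: "'v ugraph \<Rightarrow> 'w ugraph \<Rightarrow> ('v \<Rightarrow> 'w) set" where
  "graph_maps G H = {f \<in> verts G \<rightarrow>\<^sub>E verts H.
     \<forall>u\<in>verts G. \<forall>v\<in>verts G. u = v \<or> adj G u v \<longrightarrow> f u = f v \<or> adj H (f u) (f v)}"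

definition cart_prod :: "'v ugraph \<Rightarrow> 'w ugraph \<Rightarrow> ('v \<times> 'w) ugraph" where
  "cart_prod G H = \<lparr>verts = verts G \<times> verts H,
     adj = (\<lambda>(u, a) (v, b). (u = v \<and> u \<in> verts G \<and> adj H a b) \<or>
                            (adj G u v \<and> a = b \<and> a \<in> verts H))\<rparr>"

text \<open>The \<open>k\<close>-fold Cartesian power, with vertices written as lists of length \<open>k\<close>.\<close>

definition cart_power :: "'v ugraph \<Rightarrow> nat \<Rightarrow> 'v list ugraph" where
  "cart_power G k = \<lparr>verts = {x. set x \<subseteq> verts G \<and> length x = k},
     adj = (\<lambda>x y. set x \<subseteq> verts G \<and> set y \<subseteq> verts G \<and> length x = k \<and> length y = k \<and>
       (\<exists>i<k. adj G (x ! i) (y ! i) \<and> (\<forall>j<k. j \<noteq> i \<longrightarrow> x ! j = y ! j)))\<rparr>"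

definition path_graph :: "nat \<Rightarrow> int ugraph" where
  "path_graph m = \<lparr>verts = {0..int m},
     adj = (\<lambda>a b. a \<in> {0..int m} \<and> b \<in> {0..int m} \<and> \<bar>a - b\<bar> = 1)\<rparr>"

definition int_graph :: "int ugraph" where
  "int_graph = \<lparr>verts = UNIV, adj = (\<lambda>a b. \<bar>a - b\<bar> = 1)\<rparr>"

abbreviation grid :: "nat \<Rightarrow> int list ugraph" where
  "grid k \<equiv> cart_power int_graph k"

abbreviation box :: "nat \<Rightarrow> nat \<Rightarrow> int list ugraph" where
  "box k m \<equiv> cart_power (path_graph m) k"

section \<open>Suspensions\<close>

text \<open>The graph obtained by identifying vertices along \<open>q\<close> (loops are dropped and
  multiple edges merged).\<close>

definition contract_along :: "('v \<Rightarrow> 'w) \<Rightarrow> 'v ugraph \<Rightarrow> 'w ugraph" where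
  "contract_along q G = \<lparr>verts = q ` verts G,
     adj = (\<lambda>a b. a \<noteq> b \<and> (\<exists>u v. adj G u v \<and> q u = a \<and> q v = b))\<rparr>"

text \<open>This vertex type contains a copy of \<open>'a\<close> and is closed under suspension, so that all
  iterated suspensions of one graph share a single type.\<close>

datatype 'a svert = Orig 'a | South | North | Level "'a svert" int

definition collapse_ends :: "nat \<Rightarrow> 'a svert \<times> int \<Rightarrow> 'a svert" where
  "collapse_ends t = (\<lambda>(v, i). if i = 0 then South else if i = int t then North else Level v i)"

definition suspension :: "nat \<Rightarrow> 'a svert ugraph \<Rightarrow> 'a svert ugraph" where
  "suspension t G = contract_along (collapse_ends t) (cart_prod G (path_graph t))"

section \<open>The groups \<open>A\<^sub>k\<close>\<close>

definition based_within :: "nat \<Rightarrow> 'v \<Rightarrow> int \<Rightarrow> (int list \<Rightarrow> 'v) \<Rightarrow> bool" where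
  "based_within k v0 r F \<longleftrightarrow>
     0 \<le> r \<and> (\<forall>x\<in>verts (grid k). (\<exists>i<k. \<bar>x ! i\<bar> \<ge> r) \<longrightarrow> F x = v0)"

definition based_maps :: "nat \<Rightarrow> 'v ugraph \<Rightarrow> 'v \<Rightarrow> (int list \<Rightarrow> 'v) set" where
  "based_maps k G v0 = {F \<in> graph_maps (grid k) G. \<exists>r. based_within k v0 r F}"

definition based_homotopy ::
    "nat \<Rightarrow> 'v ugraph \<Rightarrow> 'v \<Rightarrow> ((int list \<Rightarrow> 'v) \<times> (int list \<Rightarrow> 'v)) set" where
  "based_homotopy k G v0 = {(F, F'). F \<in> based_maps k G v0 \<and> F' \<in> based_maps k G v0 \<and>
     (\<exists>m. \<exists>H\<in>graph_maps (cart_prod (grid k) (path_graph m)) G.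
        (\<forall>j\<in>verts (path_graph m). (\<lambda>x\<in>verts (grid k). H (x, j)) \<in> based_maps k G v0) \<and>
        (\<lambda>x\<in>verts (grid k). H (x, 0)) = F \<and>
        (\<lambda>x\<in>verts (grid k). H (x, int m)) = F')}"

text \<open>Concatenation in the first coordinate of two maps that are both \<open>v0\<close> outside radius
  \<open>r\<close>: the second map is translated by \<open>2 * r\<close>.\<close>

definition concat_maps ::
    "nat \<Rightarrow> int \<Rightarrow> (int list \<Rightarrow> 'v) \<Rightarrow> (int list \<Rightarrow> 'v) \<Rightarrow> int list \<Rightarrow> 'v" where
  "concat_maps k r F F' =
     (\<lambda>x\<in>verts (grid k). if hd x \<le> r then F x else F' ((hd x - 2 * r) # tl x))"

text \<open>Only meaningful for \<open>k \<ge> 1\<close>. Operations on classes are defined as the unique element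
  of the set of values obtained from all representatives.\<close>

definition A_group :: "nat \<Rightarrow> 'v ugraph \<Rightarrow> 'v \<Rightarrow> (int list \<Rightarrow> 'v) set monoid" where
  "A_group k G v0 = \<lparr>
     carrier = based_maps k G v0 // based_homotopy k G v0,
     monoid.mult = (\<lambda>c d. the_elem {based_homotopy k G v0 `` {concat_maps k r F F'} | r F F'.
        F \<in> c \<and> F' \<in> d \<and> based_within k v0 r F \<and> based_within k v0 r F'}),
     one = based_homotopy k G v0 `` {\<lambda>x\<in>verts (grid k). v0}\<rparr>"

section \<open>Cubical homology\<close>

abbreviation cube_graph :: "nat \<Rightarrow> int list ugraph" where
  "cube_graph k \<equiv> box k 1"

definition cubes :: "nat \<Rightarrow> 'v ugraph \<Rightarrow> (int list \<Rightarrow> 'v) set" where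
  "cubes k G = graph_maps (cube_graph k) G"

text \<open>The face of a \<open>k\<close>-cube obtained by inserting \<open>e\<close> at coordinate \<open>i\<close>, coordinates being
  numbered \<open>1, \<dots>, k\<close>: \<open>e = 0\<close> gives \<open>D\<^sub>i\<^sup>-\<close> and \<open>e = 1\<close> gives \<open>D\<^sub>i\<^sup>+\<close>.\<close>

definition face :: "nat \<Rightarrow> nat \<Rightarrow> int \<Rightarrow> (int list \<Rightarrow> 'v) \<Rightarrow> int list \<Rightarrow> 'v" where
  "face k i e \<sigma> = (\<lambda>y\<in>verts (cube_graph (k - 1)). \<sigma> (take (i - 1) y @ e # drop (i - 1) y))"

definition degenerate_cubes :: "nat \<Rightarrow> 'v ugraph \<Rightarrow> (int list \<Rightarrow> 'v) set" where
  "degenerate_cubes k G = {\<sigma> \<in> cubes k G. \<exists>i\<in>{1..k}. face k i 0 \<sigma> = face k i 1 \<sigma>}"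

abbreviation free_chains :: "nat \<Rightarrow> 'v ugraph \<Rightarrow> ((int list \<Rightarrow> 'v) \<Rightarrow>\<^sub>0 int) monoid" where
  "free_chains k G \<equiv> free_Abelian_group (cubes k G)"

abbreviation degenerate_chains :: "nat \<Rightarrow> 'v ugraph \<Rightarrow> ((int list \<Rightarrow> 'v) \<Rightarrow>\<^sub>0 int) set" where
  "degenerate_chains k G \<equiv> carrier (free_Abelian_group (degenerate_cubes k G))"

definition chain_group :: "nat \<Rightarrow> 'v ugraph \<Rightarrow> ((int list \<Rightarrow> 'v) \<Rightarrow>\<^sub>0 int) set monoid" where
  "chain_group k G = free_chains k G Mod degenerate_chains k G"

definition chain_class ::
    "nat \<Rightarrow> 'v ugraph \<Rightarrow> ((int list \<Rightarrow> 'v) \<Rightarrow>\<^sub>0 int) \<Rightarrow> ((int list \<Rightarrow> 'v) \<Rightarrow>\<^sub>0 int) set" where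
  "chain_class k G c = degenerate_chains k G #>\<^bsub>free_chains k G\<^esub> c"

definition cube_boundary :: "nat \<Rightarrow> (int list \<Rightarrow> 'v) \<Rightarrow> (int list \<Rightarrow> 'v) \<Rightarrow>\<^sub>0 int" where
  "cube_boundary k \<sigma> =
     (\<Sum>i\<in>{1..k}. frag_cmul ((-1) ^ i) (frag_of (face k i 0 \<sigma>) - frag_of (face k i 1 \<sigma>)))"

text \<open>The map induced by \<open>cube_boundary\<close> on chains modulo degenerate ones. For \<open>k = 0\<close> it is
  the zero endomorphism of \<open>C\<^sub>0\<close>, whose kernel is all of \<open>C\<^sub>0\<close>, as it should be.\<close>

definition boundary_map ::
    "nat \<Rightarrow> 'v ugraph \<Rightarrow> ((int list \<Rightarrow> 'v) \<Rightarrow>\<^sub>0 int) set \<Rightarrow> ((int list \<Rightarrow> 'v) \<Rightarrow>\<^sub>0 int) set" where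
  "boundary_map k G X =
     the_elem ((\<lambda>c. chain_class (k - 1) G (frag_extend (cube_boundary k) c)) ` X)"

definition cycle_group :: "nat \<Rightarrow> 'v ugraph \<Rightarrow> ((int list \<Rightarrow> 'v) \<Rightarrow>\<^sub>0 int) set monoid" where
  "cycle_group k G = (chain_group k G)
     \<lparr>carrier := kernel (chain_group k G) (chain_group (k - 1) G) (boundary_map k G)\<rparr>"

definition boundaries :: "nat \<Rightarrow> 'v ugraph \<Rightarrow> ((int list \<Rightarrow> 'v) \<Rightarrow>\<^sub>0 int) set set" where
  "boundaries k G = boundary_map (Suc k) G ` carrier (chain_group (Suc k) G)"

definition cubical_homology ::
    "nat \<Rightarrow> 'v ugraph \<Rightarrow> ((int list \<Rightarrow> 'v) \<Rightarrow>\<^sub>0 int) set set monoid" where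
  "cubical_homology k G = cycle_group k G Mod boundaries k G"

definition cubical_homology_class ::
    "nat \<Rightarrow> 'v ugraph \<Rightarrow> ((int list \<Rightarrow> 'v) \<Rightarrow>\<^sub>0 int) \<Rightarrow> ((int list \<Rightarrow> 'v) \<Rightarrow>\<^sub>0 int) set set" where
  "cubical_homology_class k G c = boundaries k G #>\<^bsub>cycle_group k G\<^esub> chain_class k G c"

section \<open>The Hurewicz map\<close>

definition box_maps :: "nat \<Rightarrow> nat \<Rightarrow> 'v ugraph \<Rightarrow> 'v \<Rightarrow> (int list \<Rightarrow> 'v) set" where
  "box_maps k m G v0 = {f \<in> graph_maps (box k m) G.
     \<forall>x\<in>verts (box k m). (\<exists>i<k. x ! i = 0 \<or> x ! i = int m) \<longrightarrow> f x = v0}"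

definition extend_box :: "nat \<Rightarrow> nat \<Rightarrow> 'v \<Rightarrow> (int list \<Rightarrow> 'v) \<Rightarrow> int list \<Rightarrow> 'v" where
  "extend_box k m v0 f = (\<lambda>x\<in>verts (grid k). if x \<in> verts (box k m) then f x else v0)"

definition subcube :: "nat \<Rightarrow> (int list \<Rightarrow> 'v) \<Rightarrow> int list \<Rightarrow> int list \<Rightarrow> 'v" where
  "subcube k f x = (\<lambda>y\<in>verts (cube_graph k). f (map2 (+) x y))"

definition box_chain :: "nat \<Rightarrow> nat \<Rightarrow> (int list \<Rightarrow> 'v) \<Rightarrow> (int list \<Rightarrow> 'v) \<Rightarrow>\<^sub>0 int" where
  "box_chain k m f =
     (\<Sum>x\<in>{x. set x \<subseteq> {0..int m - 1} \<and> length x = k}. frag_of (subcube k f x))"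

text \<open>\<open>psi\<close> sends a class to the common homology class of \<open>box_chain\<close> over all of its box
  representatives.\<close>

definition psi ::
    "nat \<Rightarrow> 'v ugraph \<Rightarrow> 'v \<Rightarrow> (int list \<Rightarrow> 'v) set \<Rightarrow> ((int list \<Rightarrow> 'v) \<Rightarrow>\<^sub>0 int) set set" where
  "psi k G v0 c = the_elem {cubical_homology_class k G (box_chain k m f) | m f.
     f \<in> box_maps k m G v0 \<and> extend_box k m v0 f \<in> c}"

end

theory Submission
  imports Defs
begin

text \<open>Induction on \<open>n\<close>: every \<open>k\<close>-cycle of \<open>G n\<close> is homologous to the sum of the unit cubes of one
  grid map that is constant outside a bounded region. For \<open>k = 1\<close> this holds in any connected graph,
  since a cycle is a combination of closed walks. For the step, a \<open>(k + 1)\<close>-cube of a suspension of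
  length greater than \<open>k + 1\<close> cannot contain both poles, so a \<open>(k + 1)\<close>-cycle \<open>z\<close> splits as
  \<open>z\<^sub>1 + z\<^sub>2\<close> with \<open>z\<^sub>1\<close> avoiding the north and \<open>z\<^sub>2\<close> the south pole. The nondegenerate part of the
  boundary of \<open>z\<^sub>1\<close> is a \<open>k\<close>-cycle avoiding both poles, which projects to a cycle \<open>v\<close> of \<open>G n\<close>.
  Because each of the two cones is contractible, \<open>z\<close> is homologous to the suspension of \<open>v\<close>. The
  suspension of a grid map representing \<open>v\<close> is closed up to a based grid map by running back along
  the meridian of the base vertex; the cubes added lie in that meridian, which is contractible.\<close>

text \<open>The obstacle is that degenerate cubes are divided out, so a cycle of the quotient
  complex has a boundary that is only degenerate, not zero. All computations therefore take place in
  the free groups: identities such as that for the boundary of a prism hold there exactly, every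
  error term is tracked as a chain of degenerate cubes, and cosets enter only at the end. The length
  n + 3 comes from the bound on cubes: the height in a suspension changes by at most one along an
  edge, so a cube of dimension k + 1 spans at most k + 1 levels, and k + 1 <= n + 1 < n + 3.
  Suspending a grid map makes the south pole the base vertex, while the theorem concerns every base
  vertex; so the induction speaks about all of them, and connectedness moves one to another. Grid
  maps on all of Z^k, centred at the origin, replace maps on a box because suspension and homotopy
  enlarge the support; only the description of \<open>psi\<close> returns to boxes, by a translation
  of one coordinate at a time.\<close>

declare One_nat_def [simp del]

section \<open>Combinatorics of the cube and grid graphs\<close>

section \<open>Cubes\<close>

abbreviation cube_verts :: "nat \<Rightarrow> int list set" where
  "cube_verts k \<equiv> verts (cube_graph k)"

definition near :: "'v ugraph \<Rightarrow> 'v \<Rightarrow> 'v \<Rightarrow> bool" where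
  "near G u v \<longleftrightarrow> u = v \<or> adj G u v"

lemma near_refl [simp]: "near G u u"
  by (simp add: near_def)

text \<open>Adjacency of integer lattice points, by recursion on the list and without mention of a
  dimension. Boxes, cubes and the whole grid then share one relation, and arguments about a single
  changing coordinate become inductions.\<close>

inductive nbr :: "int list \<Rightarrow> int list \<Rightarrow> bool" where
  here: "\<bar>a - b\<bar> = 1 \<Longrightarrow> nbr (a # x) (b # x)"
| there: "nbr x y \<Longrightarrow> nbr (a # x) (a # y)"

inductive_cases nbr_NilE: "nbr [] y"
inductive_cases nbr_ConsE: "nbr (a # x) y"

lemma nbr_Nil [simp]: "\<not> nbr [] y"
  by (auto elim: nbr_NilE)

lemma nbr_Cons: "nbr (a # x) (b # y) \<longleftrightarrow> (\<bar>a - b\<bar> = 1 \<and> x = y) \<or> (a = b \<and> nbr x y)"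
  by (auto elim: nbr_ConsE intro: nbr.intros)

lemma nbr_length: "nbr x y \<Longrightarrow> length x = length y"
  by (induction rule: nbr.induct) auto

lemma nbr_sym: "nbr x y \<Longrightarrow> nbr y x"
  by (induction rule: nbr.induct) (auto intro: nbr.intros simp: abs_minus_commute)

lemma nbr_irrefl: "\<not> nbr x x"
proof -
  have "nbr x y \<Longrightarrow> x \<noteq> y" for y by (induction rule: nbr.induct) auto
  then show ?thesis by blast
qed

lemma nbr_close: "nbr x y \<Longrightarrow> a \<in> set x \<Longrightarrow> \<exists>b\<in>set y. \<bar>a - b\<bar> \<le> 1"
  by (induction rule: nbr.induct) force+

lemma nbr_iff:
  "nbr x y \<longleftrightarrow> length x = length y \<and>
     (\<exists>i<length x. \<bar>x ! i - y ! i\<bar> = 1 \<and> (\<forall>j<length x. j \<noteq> i \<longrightarrow> x ! j = y ! j))"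
    (is "_ \<longleftrightarrow> ?R x y")
proof
  show "nbr x y \<Longrightarrow> ?R x y"
  proof (induction rule: nbr.induct)
    case (here a b x)
    then show ?case by (auto intro!: exI[of _ 0] simp: nth_Cons split: nat.splits)
  next
    case (there x y a)
    then obtain i where "i < length x" "\<bar>x ! i - y ! i\<bar> = 1"
      "\<forall>j<length x. j \<noteq> i \<longrightarrow> x ! j = y ! j" "length x = length y" by blast
    then show ?case by (auto intro!: exI[of _ "Suc i"] simp: nth_Cons split: nat.splits)
  qed
next
  show "?R x y \<Longrightarrow> nbr x y"
  proof (induction x arbitrary: y)
    case (Cons a x)
    then obtain b y' where y: "y = b # y'" and len: "length x = length y'" by (cases y) auto
    from Cons.prems obtain i where i: "i < Suc (length x)"
      "\<bar>(a # x) ! i - y ! i\<bar> = 1" "\<forall>j<Suc (length x). j \<noteq> i \<longrightarrow> (a # x) ! j = y ! j" by auto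
    show ?case
    proof (cases i)
      case 0
      then have "x ! n = y' ! n" if "n < length x" for n
        using i(3)[rule_format, of "Suc n"] y that by simp
      then have "x = y'" using len by (auto intro!: nth_equalityI)
      then show ?thesis using 0 i y by (auto intro: nbr.here)
    next
      case (Suc i')
      then have "a = b" using i(3) y by (metis nat.distinct(1) nth_Cons_0 zero_less_Suc)
      moreover have "\<forall>j<length x. j \<noteq> i' \<longrightarrow> x ! j = y' ! j"
        using i(3) y Suc by fastforce
      then have "nbr x y'"
        using i len Suc y by (intro Cons.IH) (auto intro!: exI[of _ i'])
      ultimately show ?thesis using y by (auto intro: nbr.there)
    qed
  qed auto
qed

lemma verts_box: "verts (box k m) = {x. set x \<subseteq> {0..int m} \<and> length x = k}"
  by (simp add: cart_power_def path_graph_def)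

lemma verts_grid: "verts (grid k) = {x. length x = k}"
  by (simp add: cart_power_def int_graph_def)

text \<open>Path graphs and the integer line are both described by unit distance between their
  vertices, so one computation serves boxes and grids.\<close>

lemma adj_cart_power:
  fixes H :: "int ugraph"
  assumes H: "\<And>a b. adj H a b \<longleftrightarrow> a \<in> verts H \<and> b \<in> verts H \<and> \<bar>a - b\<bar> = 1"
  shows "adj (cart_power H k) x y \<longleftrightarrow>
    x \<in> verts (cart_power H k) \<and> y \<in> verts (cart_power H k) \<and> nbr x y"
proof (cases "set x \<subseteq> verts H \<and> set y \<subseteq> verts H \<and> length x = k \<and> length y = k")
  case True
  then have "x ! i \<in> verts H" "y ! i \<in> verts H" if "i < k" for i
    using that nth_mem[of i x] nth_mem[of i y] by auto
  then have "adj H (x ! i) (y ! i) \<longleftrightarrow> \<bar>x ! i - y ! i\<bar> = 1" if "i < k" for i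
    using that H by blast
  then show ?thesis using True unfolding nbr_iff cart_power_def by (simp cong: conj_cong)
qed (simp add: cart_power_def, blast)

lemma adj_box:
  "adj (box k m) x y \<longleftrightarrow> x \<in> verts (box k m) \<and> y \<in> verts (box k m) \<and> nbr x y"
  by (rule adj_cart_power) (simp add: path_graph_def)

lemma adj_grid: "adj (grid k) x y \<longleftrightarrow> x \<in> verts (grid k) \<and> y \<in> verts (grid k) \<and> nbr x y"
  by (rule adj_cart_power) (simp add: int_graph_def)

lemma graph_maps_box:
  "f \<in> graph_maps (box k m) G \<longleftrightarrow> f \<in> verts (box k m) \<rightarrow>\<^sub>E verts G \<and>
     (\<forall>x\<in>verts (box k m). \<forall>y\<in>verts (box k m). nbr x y \<longrightarrow> near G (f x) (f y))"
  by (auto simp: graph_maps_def adj_box near_def)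

lemma graph_maps_grid:
  "f \<in> graph_maps (grid k) G \<longleftrightarrow> f \<in> verts (grid k) \<rightarrow>\<^sub>E verts G \<and>
     (\<forall>x\<in>verts (grid k). \<forall>y\<in>verts (grid k). nbr x y \<longrightarrow> near G (f x) (f y))"
  by (auto simp: graph_maps_def adj_grid near_def)

lemma cubes_iff:
  "\<sigma> \<in> cubes k G \<longleftrightarrow> \<sigma> \<in> cube_verts k \<rightarrow>\<^sub>E verts G \<and>
     (\<forall>x\<in>cube_verts k. \<forall>y\<in>cube_verts k. nbr x y \<longrightarrow> near G (\<sigma> x) (\<sigma> y))"
  unfolding cubes_def by (rule graph_maps_box)

lemma cubesI:
  assumes "\<sigma> \<in> extensional (cube_verts k)" "\<And>x. x \<in> cube_verts k \<Longrightarrow> \<sigma> x \<in> verts G"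
    "\<And>x y. \<lbrakk>x \<in> cube_verts k; y \<in> cube_verts k; nbr x y\<rbrakk> \<Longrightarrow> near G (\<sigma> x) (\<sigma> y)"
  shows "\<sigma> \<in> cubes k G"
  using assms by (auto simp: cubes_iff PiE_def)

lemma cubesD:
  assumes "\<sigma> \<in> cubes k G"
  shows "\<sigma> \<in> extensional (cube_verts k)" "x \<in> cube_verts k \<Longrightarrow> \<sigma> x \<in> verts G"
    "\<lbrakk>x \<in> cube_verts k; y \<in> cube_verts k; nbr x y\<rbrakk> \<Longrightarrow> near G (\<sigma> x) (\<sigma> y)"
  using assms by (auto simp: cubes_iff PiE_def)

lemma Cons_cube_verts [simp]: "a # x \<in> cube_verts (Suc k) \<longleftrightarrow> a \<in> {0, 1} \<and> x \<in> cube_verts k"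
  by (auto simp: verts_box)

lemma cube_verts_0 [simp]: "cube_verts 0 = {[]}"
  by (auto simp: verts_box)

lemma cube_verts_length: "x \<in> cube_verts k \<Longrightarrow> length x = k"
  by (simp add: verts_box)

lemma cube_verts_SucE:
  assumes "z \<in> cube_verts (Suc k)"
  obtains a x where "z = a # x" "a = 0 \<or> a = 1" "x \<in> cube_verts k"
proof (cases z)
  case (Cons a x)
  then have "a = 0 \<or> a = 1" "x \<in> cube_verts k" using assms by (auto simp: verts_box)
  then show ?thesis using Cons that by blast
qed (use assms in \<open>simp add: verts_box\<close>)

section \<open>Face operators and the cubical identities\<close>

subsection \<open>Faces\<close>

text \<open>Coordinates are numbered from \<open>1\<close>, as in \<^const>\<open>face\<close>.\<close>

definition ins :: "nat \<Rightarrow> int \<Rightarrow> int list \<Rightarrow> int list" where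
  "ins i e y = take (i - 1) y @ e # drop (i - 1) y"

lemma face_ins: "face k i e \<sigma> = (\<lambda>y\<in>cube_verts (k - 1). \<sigma> (ins i e y))"
  by (simp add: face_def ins_def)

lemma length_ins [simp]: "length (ins i e y) = Suc (length y)"
  by (simp add: ins_def)

lemma ins_1 [simp]: "ins 1 e y = e # y"
  by (simp add: ins_def)

lemma ins_Cons [simp]: "i \<ge> 1 \<Longrightarrow> ins (Suc i) e (a # y) = a # ins i e y"
  by (cases i) (auto simp: ins_def)

text \<open>The cubical identity on coordinates. The bound on \<open>i\<close> matters: past the end
  of the list \<open>ins\<close> merely appends, and then the two orders of insertion
  differ.\<close>

lemma ins_swap:
  "\<lbrakk>1 \<le> j; j \<le> i; i \<le> Suc (length y)\<rbrakk> \<Longrightarrow> ins (Suc i) e (ins j e' y) = ins j e' (ins i e y)"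
proof (induction y arbitrary: i j)
  case Nil
  then show ?case by (auto simp: ins_def)
next
  case (Cons a y)
  show ?case
  proof (cases "j = 1")
    case True
    then show ?thesis using Cons.prems by simp
  next
    case False
    then obtain j' i' where [simp]: "j = Suc j'" "i = Suc i'" "j' \<ge> 1" "i' \<ge> j'" "i' \<ge> 1"
      using Cons.prems by (cases j; cases i) auto
    show ?thesis using Cons.IH[of j' i'] Cons.prems by simp
  qed
qed

lemma set_ins: "set (ins i e y) = insert e (set y)"
  by (simp add: ins_def) (metis set_append append_take_drop_id Un_insert_right)

lemma ins_cube_verts:
  "\<lbrakk>1 \<le> k; y \<in> cube_verts (k - 1); e = 0 \<or> e = 1\<rbrakk> \<Longrightarrow> ins i e y \<in> cube_verts k"
  by (auto simp: verts_box set_ins)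

lemma nbr_ins: "nbr x y \<Longrightarrow> nbr (ins i e x) (ins i e y)"
proof (induction arbitrary: i rule: nbr.induct)
  case (here a b x)
  then show ?case
    by (cases "i \<le> 1") (auto simp: ins_def nbr_Cons take_Cons drop_Cons split: nat.splits)
next
  case (there x y a)
  show ?case
  proof (cases "i \<le> 1")
    case True
    then show ?thesis using there by (auto simp: ins_def nbr_Cons)
  next
    case False
    then obtain j where "i = Suc j" "j \<ge> 1" by (cases i) auto
    then show ?thesis using there by (simp add: nbr_Cons)
  qed
qed

lemma face_in_cubes:
  assumes "\<sigma> \<in> cubes k G" "1 \<le> k" "e = 0 \<or> e = 1"
  shows "face k i e \<sigma> \<in> cubes (k - 1) G"
  by (rule cubesI) (auto simp: face_ins assms ins_cube_verts nbr_ins intro!: cubesD[OF assms(1)])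

lemma face_swap:
  assumes "1 \<le> j" "j \<le> i" "Suc i \<le> k" "e = 0 \<or> e = 1" "e' = 0 \<or> e' = 1"
  shows "face (k - 1) j e' (face k (Suc i) e \<sigma>) = face (k - 1) i e (face k j e' \<sigma>)"
proof
  fix y
  show "face (k - 1) j e' (face k (Suc i) e \<sigma>) y = face (k - 1) i e (face k j e' \<sigma>) y"
  proof (cases "y \<in> cube_verts (k - 1 - 1)")
    case True
    then have "ins j e' y \<in> cube_verts (k - 1)" "ins i e y \<in> cube_verts (k - 1)"
      using assms by (auto intro!: ins_cube_verts)
    moreover have "i \<le> Suc (length y)" using True assms cube_verts_length[of y "k - 1 - 1"] by simp
    ultimately show ?thesis using True assms by (simp add: face_ins ins_swap)
  qed (simp add: face_ins)
qed

lemma degenerate_cubesI: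
  "\<lbrakk>\<sigma> \<in> cubes k G; 1 \<le> i; i \<le> k; face k i 0 \<sigma> = face k i 1 \<sigma>\<rbrakk> \<Longrightarrow> \<sigma> \<in> degenerate_cubes k G"
  by (auto simp: degenerate_cubes_def)

lemma degenerate_subset: "degenerate_cubes k G \<subseteq> cubes k G"
  by (auto simp: degenerate_cubes_def)

lemma degenerate_cubes_0 [simp]: "degenerate_cubes 0 G = {}"
  by (auto simp: degenerate_cubes_def)

text \<open>A face taken in another direction is still constant in the old direction
  \<open>i\<close>, which is renumbered \<open>i - 1\<close> if the removed coordinate precedes
  it.\<close>

lemma degenerate_face:
  assumes "\<sigma> \<in> cubes k G" "i \<in> {1..k}" "face k i 0 \<sigma> = face k i 1 \<sigma>"
    and "j \<in> {1..k}" "j \<noteq> i" "e = 0 \<or> e = 1"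
  shows "face k j e \<sigma> \<in> degenerate_cubes (k - 1) G"
proof -
  have f: "face k j e \<sigma> \<in> cubes (k - 1) G" using assms by (intro face_in_cubes) simp_all
  show ?thesis
  proof (cases "j < i")
    case True
    then obtain i' where i: "i = Suc i'" by (cases i) auto
    have "face (k - 1) i' 0 (face k j e \<sigma>) = face (k - 1) i' 1 (face k j e \<sigma>)"
      using face_swap[of j i' k 0 e \<sigma>] face_swap[of j i' k 1 e \<sigma>] assms True i by auto
    then show ?thesis using f assms True i by (intro degenerate_cubesI[of _ _ _ i']) simp_all
  next
    case False
    then obtain j' where j: "j = Suc j'" "i \<le> j'" using assms by (cases j) auto
    have "face (k - 1) i 0 (face k j e \<sigma>) = face (k - 1) i 1 (face k j e \<sigma>)"
      using face_swap[of i j' k e 0 \<sigma>] face_swap[of i j' k e 1 \<sigma>] assms j by auto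
    moreover have "i \<le> k - 1" using j assms by simp
    ultimately show ?thesis using f assms by (intro degenerate_cubesI[of _ _ _ i]) simp_all
  qed
qed

section \<open>Free chains and the boundary operator\<close>

section \<open>Chains\<close>

abbreviation keys where "keys \<equiv> Poly_Mapping.keys"

lemma keys_add_subset: "\<lbrakk>keys a \<subseteq> S; keys b \<subseteq> S\<rbrakk> \<Longrightarrow> keys (a + b) \<subseteq> S"
  using keys_add[of a b] by blast

lemma keys_diff_subset: "\<lbrakk>keys a \<subseteq> S; keys b \<subseteq> S\<rbrakk> \<Longrightarrow> keys (a - b) \<subseteq> S"
  using keys_diff[of a b] by blast

lemma keys_sum_subset: "(\<And>i. i \<in> I \<Longrightarrow> keys (f i) \<subseteq> S) \<Longrightarrow> keys (sum f I) \<subseteq> S"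
  by (induction I rule: infinite_finite_induct) (simp_all add: keys_add_subset)

lemma keys_cmul_subset: "keys a \<subseteq> S \<Longrightarrow> keys (frag_cmul n a) \<subseteq> S"
  using keys_cmul by fast

lemma keys_frag_of_subset [simp]: "keys (frag_of a) \<subseteq> S \<longleftrightarrow> a \<in> S"
  by simp

lemmas keys_subset_intros =
  keys_add_subset keys_diff_subset keys_sum_subset keys_cmul_subset

lemma keys_frag_extend_subset:
  "(\<And>x. x \<in> keys c \<Longrightarrow> keys (f x) \<subseteq> S) \<Longrightarrow> keys (frag_extend f c) \<subseteq> S"
  using keys_frag_extend[of f c] by blast

lemma frag_cmul_diff2: "frag_cmul n (a - b) = frag_cmul n a - frag_cmul n b"
  using frag_cmul_distrib2[of n "a - b" b] by (simp add: algebra_simps)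

lemma frag_extend_sum': "frag_extend f (\<Sum>i\<in>I. g i) = (\<Sum>i\<in>I. frag_extend f (g i))"
  by (induction I rule: infinite_finite_induct) (simp_all add: frag_extend_add)

text \<open>Every chain arises from generators by differences, so identities between homomorphisms,
  such as the prism formula, need checking on single cubes only.\<close>

lemma frag_extend_additive:
  assumes "keys c \<subseteq> S" "\<And>x. x \<in> S \<Longrightarrow> f (frag_of x) = g (frag_of x)"
    and "f 0 = g 0"
    and "\<And>a b. f (a - b) = f a - f b" "\<And>a b. g (a - b) = g a - g b"
  shows "f c = g c"
  using assms(1) by (induction c rule: frag_induction) (simp_all add: assms)

text \<open>The boundary on free chains, before degenerate ones are divided out;
  \<open>boundary_map_class\<close> relates it to \<open>boundary_map\<close>.\<close>

definition bd :: "nat \<Rightarrow> ((int list \<Rightarrow> 'v) \<Rightarrow>\<^sub>0 int) \<Rightarrow> (int list \<Rightarrow> 'v) \<Rightarrow>\<^sub>0 int" where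
  "bd k = frag_extend (cube_boundary k)"

lemma bd_0 [simp]: "bd k 0 = 0"
  and bd_add: "bd k (a + b) = bd k a + bd k b"
  and bd_diff: "bd k (a - b) = bd k a - bd k b"
  and bd_minus: "bd k (- a) = - bd k a"
  and bd_sum: "bd k (\<Sum>i\<in>I. f i) = (\<Sum>i\<in>I. bd k (f i))"
  and bd_cmul: "bd k (frag_cmul n a) = frag_cmul n (bd k a)"
  and bd_of: "bd k (frag_of \<sigma>) = cube_boundary k \<sigma>"
  by (simp_all add: bd_def frag_extend_add frag_extend_diff frag_extend_sum' frag_extend_cmul
      frag_extend_minus)

lemma bd_chain: "\<lbrakk>1 \<le> k; keys c \<subseteq> cubes k G\<rbrakk> \<Longrightarrow> keys (bd k c) \<subseteq> cubes (k - 1) G"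
  unfolding bd_def
  by (rule keys_frag_extend_subset, unfold cube_boundary_def, intro keys_subset_intros)
    (auto intro!: face_in_cubes)

text \<open>If a cube is constant in direction \<open>i\<close>, its two \<open>i\<close>-faces
  coincide and cancel; all its other faces are degenerate.\<close>

lemma bd_degenerate:
  assumes "1 \<le> k" "keys c \<subseteq> degenerate_cubes k G"
  shows "keys (bd k c) \<subseteq> degenerate_cubes (k - 1) G"
  unfolding bd_def
proof (rule keys_frag_extend_subset)
  fix \<sigma> assume "\<sigma> \<in> keys c"
  then have "\<sigma> \<in> degenerate_cubes k G" using assms by auto
  then obtain i where i: "\<sigma> \<in> cubes k G" "i \<in> {1..k}" "face k i 0 \<sigma> = face k i 1 \<sigma>"
    by (auto simp: degenerate_cubes_def)
  show "keys (cube_boundary k \<sigma>) \<subseteq> degenerate_cubes (k - 1) G"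
    unfolding cube_boundary_def
  proof (intro keys_sum_subset keys_cmul_subset)
    fix j assume "j \<in> {1..k}"
    then show "keys (frag_of (face k j 0 \<sigma>) - frag_of (face k j 1 \<sigma>)) \<subseteq> degenerate_cubes (k - 1) G"
      using i degenerate_face[OF i, of j] by (cases "j = i") (simp_all add: keys_diff_subset)
  qed
qed

text \<open>An index pair with \<open>j < i\<close> is matched with \<open>(j, i - 1)\<close> on the
  other side of the diagonal: the entries agree by assumption and the parity of the index sum
  changes.\<close>

lemma alternating_double_sum:
  fixes a :: "nat \<Rightarrow> nat \<Rightarrow> 'b \<Rightarrow>\<^sub>0 int"
  assumes "\<And>i j. \<lbrakk>1 \<le> j; j \<le> i; i \<le> n\<rbrakk> \<Longrightarrow> a (Suc i) j = a j i"
  shows "(\<Sum>i\<in>{1..Suc n}. \<Sum>j\<in>{1..n}. frag_cmul ((-1) ^ (i + j)) (a i j)) = 0"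
proof -
  let ?f = "\<lambda>(i, j). frag_cmul ((-1) ^ (i + j)) (a i j)"
  let ?L = "{(i, j). i \<in> {1..Suc n} \<and> j \<in> {1..n} \<and> j < i}"
  let ?U = "{(i, j). i \<in> {1..Suc n} \<and> j \<in> {1..n} \<and> i \<le> j}"
  have fin: "finite ?L" "finite ?U"
    by (rule finite_subset[of _ "{1..Suc n} \<times> {1..n}"]; auto)+
  have "(\<Sum>i\<in>{1..Suc n}. \<Sum>j\<in>{1..n}. frag_cmul ((-1) ^ (i + j)) (a i j)) = sum ?f (?L \<union> ?U)"
    unfolding sum.cartesian_product by (rule sum.cong) auto
  also have "\<dots> = sum ?f ?L + sum ?f ?U"
    by (rule sum.union_disjoint[OF fin]) auto
  also have "sum ?f ?L = (\<Sum>p\<in>?U. - ?f p)"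
  proof (rule sum.reindex_bij_witness[of _ "\<lambda>(i, j). (Suc j, i)" "\<lambda>(i, j). (j, i - 1)"])
    fix p assume p: "p \<in> ?L"
    obtain i j where [simp]: "p = (i, j)" by (cases p)
    obtain i' where [simp]: "i = Suc i'" using p by (cases i) auto
    show "- ?f ((\<lambda>(i, j). (j, i - 1)) p) = ?f p"
      using p assms[of j i'] by (simp add: add.commute)
  qed auto
  finally show ?thesis by (simp add: sum_negf)
qed

text \<open>Exact in the free group, by \<open>face_swap\<close>. \<open>cycle_split\<close> relies
  on exactness: if a boundary is a sum of two chains, their boundaries are opposite.\<close>

lemma bd_bd:
  fixes c :: "(int list \<Rightarrow> 'v) \<Rightarrow>\<^sub>0 int"
  assumes "1 \<le> k"
  shows "bd k (bd (Suc k) c) = 0"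
proof -
  have "bd k (cube_boundary (Suc k) \<sigma>) = 0" for \<sigma> :: "int list \<Rightarrow> 'v"
  proof -
    let ?F = "\<lambda>i j e e'. frag_of (face k j e' (face (Suc k) i e \<sigma>))"
    define a where "a i j = (?F i j 0 0 - ?F i j 0 1) - (?F i j 1 0 - ?F i j 1 1)" for i j
    have "bd k (cube_boundary (Suc k) \<sigma>)
        = (\<Sum>i\<in>{1..Suc k}. frag_cmul ((-1) ^ i)
             ((\<Sum>j\<in>{1..k}. frag_cmul ((-1) ^ j) (?F i j 0 0 - ?F i j 0 1))
            - (\<Sum>j\<in>{1..k}. frag_cmul ((-1) ^ j) (?F i j 1 0 - ?F i j 1 1))))"
      by (simp add: cube_boundary_def[of "Suc k"] bd_sum bd_cmul bd_diff bd_of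
          cube_boundary_def[of k] del: sum.cl_ivl_Suc)
    also have "\<dots> = (\<Sum>i\<in>{1..Suc k}. \<Sum>j\<in>{1..k}. frag_cmul ((-1) ^ (i + j)) (a i j))"
      by (simp add: a_def frag_cmul_diff2 frag_cmul_sum power_add sum_subtractf
          del: sum.cl_ivl_Suc)
    also have "\<dots> = 0"
    proof (rule alternating_double_sum)
      fix i j assume "1 \<le> j" "j \<le> i" "i \<le> k"
      then show "a (Suc i) j = a j i"
        using face_swap[of j i "Suc k" _ _ \<sigma>] by (simp add: a_def)
    qed
    finally show ?thesis .
  qed
  then have "bd k (bd (Suc k) (frag_of \<sigma>)) = 0" for \<sigma> :: "int list \<Rightarrow> 'v"
    by (simp add: bd_of)
  note * = this
  show ?thesis
    by (rule frag_extend_additive[where S = UNIV and f = "\<lambda>c. bd k (bd (Suc k) c)" and g = "\<lambda>_. 0"])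
      (simp_all add: * bd_diff)
qed

section \<open>Chain maps and chain homotopies induced by graph maps\<close>

subsection \<open>Push-forward and cylinders\<close>

text \<open>Unlike \<open>graph_maps\<close>, this prescribes no value off the vertex set, so that
  maps given by formulas on the whole type, such as \<open>level\<close> or \<open>move\<close>,
  qualify without restriction.\<close>

definition gmap :: "'v ugraph \<Rightarrow> 'w ugraph \<Rightarrow> ('v \<Rightarrow> 'w) \<Rightarrow> bool" where
  "gmap H G f \<longleftrightarrow> (\<forall>u\<in>verts H. f u \<in> verts G) \<and>
     (\<forall>u\<in>verts H. \<forall>v\<in>verts H. adj H u v \<longrightarrow> near G (f u) (f v))"

lemma gmapD:
  assumes "gmap H G f"
  shows "u \<in> verts H \<Longrightarrow> f u \<in> verts G"
    "\<lbrakk>u \<in> verts H; v \<in> verts H; near H u v\<rbrakk> \<Longrightarrow> near G (f u) (f v)"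
  using assms by (auto simp: gmap_def near_def)

definition post :: "nat \<Rightarrow> ('v \<Rightarrow> 'w) \<Rightarrow> (int list \<Rightarrow> 'v) \<Rightarrow> int list \<Rightarrow> 'w" where
  "post k f \<sigma> = (\<lambda>y\<in>cube_verts k. f (\<sigma> y))"

definition push :: "nat \<Rightarrow> ('v \<Rightarrow> 'w) \<Rightarrow> ((int list \<Rightarrow> 'v) \<Rightarrow>\<^sub>0 int) \<Rightarrow> (int list \<Rightarrow> 'w) \<Rightarrow>\<^sub>0 int" where
  "push k f = frag_extend (\<lambda>\<sigma>. frag_of (post k f \<sigma>))"

definition cyl :: "nat \<Rightarrow> (int list \<Rightarrow> 'v) \<Rightarrow> (int list \<Rightarrow> 'v) \<Rightarrow> int list \<Rightarrow> 'v" where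
  "cyl k \<sigma> \<tau> = (\<lambda>z\<in>cube_verts (Suc k). if hd z = 0 then \<sigma> (tl z) else \<tau> (tl z))"

text \<open>The prism operator of a one-step homotopy; time is the first coordinate of the new
  cube.\<close>

definition prism ::
    "nat \<Rightarrow> ('v \<Rightarrow> 'w) \<Rightarrow> ('v \<Rightarrow> 'w) \<Rightarrow> ((int list \<Rightarrow> 'v) \<Rightarrow>\<^sub>0 int) \<Rightarrow> (int list \<Rightarrow> 'w) \<Rightarrow>\<^sub>0 int" where
  "prism k f g = frag_extend (\<lambda>\<sigma>. frag_of (cyl k (post k f \<sigma>) (post k g \<sigma>)))"

lemma push_0 [simp]: "push k f 0 = 0"
  and push_diff: "push k f (a - b) = push k f a - push k f b"
  and push_sum: "push k f (\<Sum>i\<in>I. c i) = (\<Sum>i\<in>I. push k f (c i))"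
  and push_cmul: "push k f (frag_cmul n a) = frag_cmul n (push k f a)"
  and push_of: "push k f (frag_of \<sigma>) = frag_of (post k f \<sigma>)"
  by (simp_all add: push_def frag_extend_add frag_extend_diff frag_extend_sum' frag_extend_cmul)

lemma prism_0 [simp]: "prism k f g 0 = 0"
  and prism_diff: "prism k f g (a - b) = prism k f g a - prism k f g b"
  and prism_sum: "prism k f g (\<Sum>i\<in>I. c i) = (\<Sum>i\<in>I. prism k f g (c i))"
  and prism_cmul: "prism k f g (frag_cmul n a) = frag_cmul n (prism k f g a)"
  and prism_of: "prism k f g (frag_of \<sigma>) = frag_of (cyl k (post k f \<sigma>) (post k g \<sigma>))"
  by (simp_all add: prism_def frag_extend_add frag_extend_diff frag_extend_sum' frag_extend_cmul)

lemma post_in_cubes: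
  assumes "gmap H G f" "\<sigma> \<in> cubes k H"
  shows "post k f \<sigma> \<in> cubes k G"
  by (rule cubesI) (simp_all add: post_def gmapD[OF assms(1)] cubesD[OF assms(2)])

lemma post_extensional [simp]: "post k f \<sigma> \<in> extensional (cube_verts k)"
  by (simp add: post_def)

lemma face_extensional [simp]: "face k i e \<sigma> \<in> extensional (cube_verts (k - 1))"
  by (simp add: face_def)

lemma face_post:
  assumes "1 \<le> k" "e = 0 \<or> e = 1"
  shows "face k i e (post k f \<sigma>) = post (k - 1) f (face k i e \<sigma>)"
  using ins_cube_verts[OF assms(1) _ assms(2)] by (auto simp: face_ins post_def fun_eq_iff)

lemma post_degenerate:
  assumes "gmap H G f" "\<sigma> \<in> degenerate_cubes k H"
  shows "post k f \<sigma> \<in> degenerate_cubes k G"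
proof -
  obtain i where i: "\<sigma> \<in> cubes k H" "1 \<le> i" "i \<le> k" "face k i 0 \<sigma> = face k i 1 \<sigma>"
    using assms by (auto simp: degenerate_cubes_def)
  then show ?thesis using post_in_cubes[OF assms(1)]
    by (intro degenerate_cubesI[of _ _ _ i]) (simp_all add: face_post)
qed

lemma push_chain: "\<lbrakk>gmap H G f; keys c \<subseteq> cubes k H\<rbrakk> \<Longrightarrow> keys (push k f c) \<subseteq> cubes k G"
  unfolding push_def by (rule keys_frag_extend_subset) (auto intro: post_in_cubes)

lemma push_degenerate:
  "\<lbrakk>gmap H G f; keys c \<subseteq> degenerate_cubes k H\<rbrakk> \<Longrightarrow> keys (push k f c) \<subseteq> degenerate_cubes k G"
  unfolding push_def by (rule keys_frag_extend_subset) (auto intro: post_degenerate)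

lemma bd_push:
  assumes "1 \<le> k"
  shows "bd k (push k f c) = push (k - 1) f (bd k c)"
  by (rule frag_extend_additive[where S = UNIV and f = "\<lambda>c. bd k (push k f c)"])
    (simp_all add: bd_diff push_diff bd_of push_of cube_boundary_def push_sum push_cmul
      face_post assms)

lemma push_id:
  assumes "keys c \<subseteq> cubes k G" "\<And>v. v \<in> verts G \<Longrightarrow> f v = v"
  shows "push k f c = c"
proof (rule frag_extend_additive[OF assms(1), where g = "\<lambda>c. c"])
  fix \<sigma> assume "\<sigma> \<in> cubes k G"
  then have "post k f \<sigma> = \<sigma>"
    using cubesD[of \<sigma> k G] assms(2) by (auto simp: post_def fun_eq_iff extensional_def)
  then show "push k f (frag_of \<sigma>) = frag_of \<sigma>" by (simp add: push_of)
qed (simp_all add: push_diff)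

lemma push_push: "push k g (push k f c) = push k (\<lambda>v. g (f v)) c"
  by (rule frag_extend_additive[where S = UNIV and f = "\<lambda>c. push k g (push k f c)"])
    (simp_all add: push_diff push_of post_def cong: restrict_cong)

lemma push_cong:
  assumes "keys c \<subseteq> cubes k G" "\<And>v. v \<in> verts G \<Longrightarrow> f v = g v"
  shows "push k f c = push k g c"
proof (rule frag_extend_additive[OF assms(1)])
  fix \<sigma> assume "\<sigma> \<in> cubes k G"
  then have "post k f \<sigma> = post k g \<sigma>"
    using cubesD[of \<sigma> k G] assms(2) by (auto simp: post_def fun_eq_iff)
  then show "push k f (frag_of \<sigma>) = push k g (frag_of \<sigma>)" by (simp add: push_of)
qed (simp_all add: push_diff)

lemma push_const_degenerate:
  assumes "1 \<le> k" "gmap H G f" "keys c \<subseteq> cubes k H" "\<And>v. v \<in> verts H \<Longrightarrow> f v = w"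
  shows "keys (push k f c) \<subseteq> degenerate_cubes k G"
  unfolding push_def
proof (rule keys_frag_extend_subset)
  fix \<sigma> assume "\<sigma> \<in> keys c"
  then have \<sigma>: "\<sigma> \<in> cubes k H" using assms by auto
  have "face k 1 e (post k f \<sigma>) = (\<lambda>y\<in>cube_verts (k - 1). w)" if "e = 0 \<or> e = 1" for e
    using that ins_cube_verts[of k _ e 1] assms cubesD(2)[OF \<sigma>]
    by (auto simp: face_ins post_def fun_eq_iff)
  then have "post k f \<sigma> \<in> degenerate_cubes k G"
    using assms post_in_cubes[OF assms(2) \<sigma>] by (intro degenerate_cubesI[of _ _ _ 1]) simp_all
  then show "keys (frag_of (post k f \<sigma>)) \<subseteq> degenerate_cubes k G" by simp
qed

lemma face_cyl_1:
  assumes "\<sigma> \<in> extensional (cube_verts k)" "\<tau> \<in> extensional (cube_verts k)"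
  shows "face (Suc k) 1 0 (cyl k \<sigma> \<tau>) = \<sigma>" "face (Suc k) 1 1 (cyl k \<sigma> \<tau>) = \<tau>"
  using assms by (auto simp: face_ins cyl_def fun_eq_iff extensional_def)

lemma face_cyl_Suc:
  assumes "1 \<le> i" "i \<le> k" "e = 0 \<or> e = 1"
  shows "face (Suc k) (Suc i) e (cyl k \<sigma> \<tau>) = cyl (k - 1) (face k i e \<sigma>) (face k i e \<tau>)"
proof
  obtain k' where k: "k = Suc k'" using assms by (cases k) auto
  fix z
  show "face (Suc k) (Suc i) e (cyl k \<sigma> \<tau>) z = cyl (k - 1) (face k i e \<sigma>) (face k i e \<tau>) z"
  proof (cases "z \<in> cube_verts k")
    case True
    then obtain a y where z: "z = a # y" "a = 0 \<or> a = 1" "y \<in> cube_verts k'"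
      unfolding k by (elim cube_verts_SucE)
    have "ins i e y \<in> cube_verts k" using z assms k by (intro ins_cube_verts) simp_all
    then show ?thesis using z assms k by (auto simp: face_ins cyl_def)
  qed (simp add: face_ins cyl_def k)
qed

lemma cyl_in_cubes:
  assumes \<sigma>: "\<sigma> \<in> cubes k G" and \<tau>: "\<tau> \<in> cubes k G"
    and n: "\<And>y. y \<in> cube_verts k \<Longrightarrow> near G (\<sigma> y) (\<tau> y)"
    and n': "\<And>y. y \<in> cube_verts k \<Longrightarrow> near G (\<tau> y) (\<sigma> y)"
  shows "cyl k \<sigma> \<tau> \<in> cubes (Suc k) G"
proof (rule cubesI)
  fix x assume "x \<in> cube_verts (Suc k)"
  then show "cyl k \<sigma> \<tau> x \<in> verts G"
    by (elim cube_verts_SucE) (auto simp: cyl_def cubesD(2)[OF \<sigma>] cubesD(2)[OF \<tau>])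
next
  fix x y assume "x \<in> cube_verts (Suc k)" "y \<in> cube_verts (Suc k)" "nbr x y"
  then show "near G (cyl k \<sigma> \<tau> x) (cyl k \<sigma> \<tau> y)"
    by (elim cube_verts_SucE)
      (auto simp: cyl_def nbr_Cons n n' cubesD(3)[OF \<sigma>] cubesD(3)[OF \<tau>])
qed (simp add: cyl_def)

lemma cyl_degenerate:
  assumes "cyl k \<sigma> \<tau> \<in> cubes (Suc k) G" "1 \<le> i" "i \<le> k"
    "face k i 0 \<sigma> = face k i 1 \<sigma>" "face k i 0 \<tau> = face k i 1 \<tau>"
  shows "cyl k \<sigma> \<tau> \<in> degenerate_cubes (Suc k) G"
  using assms by (intro degenerate_cubesI[of _ _ _ "Suc i"]) (simp_all add: face_cyl_Suc)

text \<open>The first coordinate contributes the two ends, with sign \<open>-1\<close>, hence top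
  minus bottom. Every other direction is one of the bases moved up by one, which reverses its
  sign.\<close>

lemma cube_boundary_cyl:
  assumes "\<sigma> \<in> extensional (cube_verts k)" "\<tau> \<in> extensional (cube_verts k)"
  shows "cube_boundary (Suc k) (cyl k \<sigma> \<tau>) = frag_of \<tau> - frag_of \<sigma>
    - (\<Sum>i\<in>{1..k}. frag_cmul ((-1) ^ i)
        (frag_of (cyl (k - 1) (face k i 0 \<sigma>) (face k i 0 \<tau>))
       - frag_of (cyl (k - 1) (face k i 1 \<sigma>) (face k i 1 \<tau>))))"
proof -
  let ?D = "\<lambda>i. frag_cmul ((-1) ^ i)
    (frag_of (face (Suc k) i 0 (cyl k \<sigma> \<tau>)) - frag_of (face (Suc k) i 1 (cyl k \<sigma> \<tau>)))"
  have "cube_boundary (Suc k) (cyl k \<sigma> \<tau>) = ?D 1 + (\<Sum>i\<in>{1..k}. ?D (Suc i))"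
    unfolding cube_boundary_def
    using sum.atLeast_Suc_atMost[of 1 "Suc k" ?D] sum.shift_bounds_cl_Suc_ivl[of ?D 1 k] by simp
  also have "?D 1 = frag_of \<tau> - frag_of \<sigma>"
    by (simp add: face_cyl_1[OF assms])
  also have "(\<Sum>i\<in>{1..k}. ?D (Suc i)) = - (\<Sum>i\<in>{1..k}. frag_cmul ((-1) ^ i)
        (frag_of (cyl (k - 1) (face k i 0 \<sigma>) (face k i 0 \<tau>))
       - frag_of (cyl (k - 1) (face k i 1 \<sigma>) (face k i 1 \<tau>))))"
    unfolding sum_negf[symmetric]
    by (rule sum.cong[OF refl], simp add: face_cyl_Suc flip: minus_frag_cmul)
  finally show ?thesis by simp
qed

lemma bd_prism:
  fixes f g :: "'v \<Rightarrow> 'w"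
  assumes "1 \<le> k"
  shows "bd (Suc k) (prism k f g c) = push k g c - push k f c - prism (k - 1) f g (bd k c)"
proof (rule frag_extend_additive[where S = UNIV and c = c])
  fix \<sigma> :: "int list \<Rightarrow> 'v"
  show "bd (Suc k) (prism k f g (frag_of \<sigma>)) =
    push k g (frag_of \<sigma>) - push k f (frag_of \<sigma>) - prism (k - 1) f g (bd k (frag_of \<sigma>))"
    using assms
    by (simp add: prism_of bd_of cube_boundary_cyl push_of face_post cube_boundary_def[of k]
        prism_sum prism_cmul prism_diff)
qed (simp_all add: bd_diff prism_diff push_diff)

lemma prism_chain:
  assumes "gmap H G f" "gmap H G g" "keys c \<subseteq> cubes k H"
    "\<And>v. v \<in> verts H \<Longrightarrow> near G (f v) (g v) \<and> near G (g v) (f v)"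
  shows "keys (prism k f g c) \<subseteq> cubes (Suc k) G"
  unfolding prism_def
proof (rule keys_frag_extend_subset)
  fix \<sigma> assume "\<sigma> \<in> keys c"
  then have \<sigma>: "\<sigma> \<in> cubes k H" using assms by auto
  then have "cyl k (post k f \<sigma>) (post k g \<sigma>) \<in> cubes (Suc k) G"
    using assms cubesD(2)[OF \<sigma>] by (intro cyl_in_cubes post_in_cubes) (auto simp: post_def)
  then show "keys (frag_of (cyl k (post k f \<sigma>) (post k g \<sigma>))) \<subseteq> cubes (Suc k) G" by simp
qed

lemma prism_degenerate:
  assumes "gmap H G f" "gmap H G g" "keys c \<subseteq> degenerate_cubes k H"
    "\<And>v. v \<in> verts H \<Longrightarrow> near G (f v) (g v) \<and> near G (g v) (f v)"
  shows "keys (prism k f g c) \<subseteq> degenerate_cubes (Suc k) G"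
  unfolding prism_def
proof (rule keys_frag_extend_subset)
  fix \<sigma> assume "\<sigma> \<in> keys c"
  then have "\<sigma> \<in> degenerate_cubes k H" using assms by auto
  then obtain i where i: "\<sigma> \<in> cubes k H" "1 \<le> i" "i \<le> k" "face k i 0 \<sigma> = face k i 1 \<sigma>"
    by (auto simp: degenerate_cubes_def)
  have "cyl k (post k f \<sigma>) (post k g \<sigma>) \<in> cubes (Suc k) G"
    using prism_chain[of H G f g "frag_of \<sigma>" k] assms i(1) by (simp add: prism_of)
  then have "cyl k (post k f \<sigma>) (post k g \<sigma>) \<in> degenerate_cubes (Suc k) G"
    using i by (intro cyl_degenerate[of _ _ _ _ i]) (simp_all add: face_post)
  then show "keys (frag_of (cyl k (post k f \<sigma>) (post k g \<sigma>))) \<subseteq> degenerate_cubes (Suc k) G" by simp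
qed

section \<open>Homology on representatives, and its homotopy invariance\<close>

subsection \<open>Homologous chains and homotopies\<close>

text \<open>A representative of a cycle of the quotient complex. In dimension one the boundary must
  vanish outright, since there are no degenerate \<open>0\<close>-cubes.\<close>

definition cycle :: "nat \<Rightarrow> 'v ugraph \<Rightarrow> ((int list \<Rightarrow> 'v) \<Rightarrow>\<^sub>0 int) \<Rightarrow> bool" where
  "cycle k G z \<longleftrightarrow> keys z \<subseteq> cubes k G \<and> keys (bd k z) \<subseteq> degenerate_cubes (k - 1) G"

definition homologous ::
    "nat \<Rightarrow> 'v ugraph \<Rightarrow> ((int list \<Rightarrow> 'v) \<Rightarrow>\<^sub>0 int) \<Rightarrow> ((int list \<Rightarrow> 'v) \<Rightarrow>\<^sub>0 int) \<Rightarrow> bool" where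
  "homologous k G c c' \<longleftrightarrow> (\<exists>u. keys u \<subseteq> cubes (Suc k) G \<and>
     keys (c - c' - bd (Suc k) u) \<subseteq> degenerate_cubes k G)"

lemma homologousI:
  "\<lbrakk>keys u \<subseteq> cubes (Suc k) G; keys (c - c' - bd (Suc k) u) \<subseteq> degenerate_cubes k G\<rbrakk>
    \<Longrightarrow> homologous k G c c'"
  by (auto simp: homologous_def)

lemma homologous_degenerate: "keys (c - c') \<subseteq> degenerate_cubes k G \<Longrightarrow> homologous k G c c'"
  by (rule homologousI[of 0]) simp_all

lemma homologous_refl [simp]: "homologous k G c c"
  by (rule homologous_degenerate) simp

lemma homologous_diff:
  assumes "homologous k G a a'" "homologous k G b b'"
  shows "homologous k G (a - b) (a' - b')"
proof -
  obtain u where u: "keys u \<subseteq> cubes (Suc k) G"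
      "keys (a - a' - bd (Suc k) u) \<subseteq> degenerate_cubes k G"
    using assms(1) by (auto simp: homologous_def)
  obtain w where w: "keys w \<subseteq> cubes (Suc k) G"
      "keys (b - b' - bd (Suc k) w) \<subseteq> degenerate_cubes k G"
    using assms(2) by (auto simp: homologous_def)
  have "a - b - (a' - b') - bd (Suc k) (u - w)
      = (a - a' - bd (Suc k) u) - (b - b' - bd (Suc k) w)"
    by (simp add: bd_diff)
  then show ?thesis using u w
    by (intro homologousI[of "u - w"]) (simp_all only: keys_diff_subset)
qed

text \<open>Subtract the hypothesis from the reflexive relation for \<open>a + b\<close>; addition
  and transitivity are also reduced to \<open>homologous_diff\<close>.\<close>

lemma homologous_sym: "homologous k G a b \<Longrightarrow> homologous k G b a"
  using homologous_diff[of k G "a + b" "a + b" a b] by simp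

lemma homologous_add:
  "\<lbrakk>homologous k G a a'; homologous k G b b'\<rbrakk> \<Longrightarrow> homologous k G (a + b) (a' + b')"
  using homologous_diff[of k G a a' "- b" "- b'"] homologous_diff[of k G 0 0 b b'] by simp

lemma homologous_trans [trans]:
  "\<lbrakk>homologous k G a b; homologous k G b c\<rbrakk> \<Longrightarrow> homologous k G a c"
  using homologous_add[of k G a b b c] homologous_diff[of k G "a + b" "b + c" b b] by simp

text \<open>Time runs over an arbitrary interval so that a homotopy can be cut: the passage through
  the levels of a suspension is later split at level 1. Nearness is demanded in both directions
  because \<open>near\<close> is symmetric only when \<open>adj\<close> is.\<close>

definition homotopy :: "'v ugraph \<Rightarrow> 'w ugraph \<Rightarrow> (nat \<Rightarrow> 'v \<Rightarrow> 'w) \<Rightarrow> nat \<Rightarrow> nat \<Rightarrow> bool" where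
  "homotopy H G h a b \<longleftrightarrow> a \<le> b \<and> (\<forall>s\<in>{a..b}. gmap H G (h s)) \<and>
     (\<forall>s\<in>{a..<b}. \<forall>v\<in>verts H. near G (h s v) (h (Suc s) v) \<and> near G (h (Suc s) v) (h s v))"

definition tower :: "nat \<Rightarrow> (nat \<Rightarrow> 'v \<Rightarrow> 'w) \<Rightarrow> nat \<Rightarrow> nat \<Rightarrow>
    ((int list \<Rightarrow> 'v) \<Rightarrow>\<^sub>0 int) \<Rightarrow> (int list \<Rightarrow> 'w) \<Rightarrow>\<^sub>0 int" where
  "tower k h a b c = (\<Sum>s\<in>{a..<b}. prism k (h s) (h (Suc s)) c)"

lemma tower_diff: "tower k h a b (c - d) = tower k h a b c - tower k h a b d"
  by (simp add: tower_def prism_diff sum_subtractf)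

text \<open>The end terms telescope; what is left is the tower over the boundary, which is
  degenerate when \<open>c\<close> is a cycle.\<close>

lemma bd_tower:
  assumes "1 \<le> k" "a \<le> b"
  shows "bd (Suc k) (tower k h a b c) = push k (h b) c - push k (h a) c - tower (k - 1) h a b (bd k c)"
proof -
  have "bd (Suc k) (tower k h a b c)
      = (\<Sum>s\<in>{a..<b}. push k (h (Suc s)) c - push k (h s) c) - tower (k - 1) h a b (bd k c)"
    by (simp add: tower_def bd_sum bd_prism[OF assms(1)] sum_subtractf)
  also have "(\<Sum>s\<in>{a..<b}. push k (h (Suc s)) c - push k (h s) c) = push k (h b) c - push k (h a) c"
    using assms(2) by (rule sum_Suc_diff')
  finally show ?thesis .
qed

lemma tower_chain:
  "\<lbrakk>homotopy H G h a b; keys c \<subseteq> cubes k H\<rbrakk> \<Longrightarrow> keys (tower k h a b c) \<subseteq> cubes (Suc k) G"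
  unfolding tower_def homotopy_def by (intro keys_sum_subset prism_chain[of H]) simp_all

lemma tower_degenerate:
  "\<lbrakk>homotopy H G h a b; keys c \<subseteq> degenerate_cubes k H\<rbrakk>
    \<Longrightarrow> keys (tower k h a b c) \<subseteq> degenerate_cubes (Suc k) G"
  unfolding tower_def homotopy_def by (intro keys_sum_subset prism_degenerate[of H]) simp_all

lemma homotopy_homologous:
  assumes "1 \<le> k" "homotopy H G h a b" "cycle k H z"
  shows "homologous k G (push k (h b) z) (push k (h a) z)"
proof (rule homologousI)
  show "keys (tower k h a b z) \<subseteq> cubes (Suc k) G"
    using assms(3) by (intro tower_chain[OF assms(2)]) (simp add: cycle_def)
  have "keys (tower (k - 1) h a b (bd k z)) \<subseteq> degenerate_cubes (Suc (k - 1)) G"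
    using assms(3) by (intro tower_degenerate[OF assms(2)]) (simp add: cycle_def)
  then show "keys (push k (h b) z - push k (h a) z - bd (Suc k) (tower k h a b z)) \<subseteq> degenerate_cubes k G"
    using assms by (simp add: bd_tower homotopy_def)
qed

text \<open>\<open>H\<close> plays the part of a subgraph whose inclusion contracts to
  \<open>w\<close> within \<open>G\<close>. Homotopy invariance compares \<open>z\<close> with its
  image under a constant map, and that image consists of degenerate cubes.\<close>

lemma contractible_cycle:
  assumes "1 \<le> k" "homotopy H G h a b" "cycle k H z"
    and "\<And>v. v \<in> verts H \<Longrightarrow> h a v = v" "\<And>v. v \<in> verts H \<Longrightarrow> h b v = w"
  shows "homologous k G z 0"
proof -
  have z: "keys z \<subseteq> cubes k H" using assms by (simp add: cycle_def)
  have "homologous k G (push k (h b) z) z"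
    using homotopy_homologous[OF assms(1-3)] push_id[OF z assms(4)] by simp
  moreover have "homologous k G (push k (h b) z) 0"
    using push_const_degenerate[OF assms(1) _ z assms(5)] assms(2)
    by (intro homologous_degenerate) (simp add: homotopy_def)
  ultimately show ?thesis using homologous_sym homologous_trans by blast
qed

definition induced :: "'v ugraph \<Rightarrow> 'v set \<Rightarrow> 'v ugraph" where
  "induced G A = \<lparr>verts = verts G \<inter> A, adj = (\<lambda>u v. u \<in> A \<and> v \<in> A \<and> adj G u v)\<rparr>"

lemma verts_induced [simp]: "verts (induced G A) = verts G \<inter> A"
  and near_induced: "\<lbrakk>u \<in> A; v \<in> A\<rbrakk> \<Longrightarrow> near (induced G A) u v \<longleftrightarrow> near G u v"
  by (auto simp: induced_def near_def)

lemma cubes_induced: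
  "cubes k (induced G A) = {\<sigma> \<in> cubes k G. \<forall>x\<in>cube_verts k. \<sigma> x \<in> A}"
proof (intro Set.set_eqI iffI)
  fix \<sigma> assume \<sigma>: "\<sigma> \<in> cubes k (induced G A)"
  then have "\<sigma> x \<in> A" if "x \<in> cube_verts k" for x using cubesD(2)[OF \<sigma> that] by simp
  then show "\<sigma> \<in> {\<sigma> \<in> cubes k G. \<forall>x\<in>cube_verts k. \<sigma> x \<in> A}"
    using cubesD[OF \<sigma>] by (auto intro!: cubesI simp: near_induced)
next
  fix \<sigma> assume "\<sigma> \<in> {\<sigma> \<in> cubes k G. \<forall>x\<in>cube_verts k. \<sigma> x \<in> A}"
  then show "\<sigma> \<in> cubes k (induced G A)"
    using cubesD[of \<sigma> k G] by (auto intro!: cubesI simp: near_induced)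
qed

lemma degenerate_induced:
  "degenerate_cubes k (induced G A) = {\<sigma> \<in> degenerate_cubes k G. \<forall>x\<in>cube_verts k. \<sigma> x \<in> A}"
  by (auto simp: degenerate_cubes_def cubes_induced)

lemma degenerate_induced':
  "degenerate_cubes k (induced G A) = degenerate_cubes k G \<inter> cubes k (induced G A)"
  using degenerate_subset[of k G] by (auto simp: degenerate_induced cubes_induced)

text \<open>A cube of the subgraph is degenerate there as soon as it is degenerate in
  \<open>G\<close>, so the boundary condition may be checked in \<open>G\<close>.\<close>

lemma cycle_induced:
  assumes "1 \<le> k" "keys z \<subseteq> cubes k (induced G A)"
    "keys (bd k z) \<subseteq> degenerate_cubes (k - 1) G"
  shows "cycle k (induced G A) z"
  unfolding cycle_def degenerate_induced' using assms bd_chain[OF assms(1,2)] by simp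

section \<open>Grid maps with bounded support and the chains they carry\<close>

section \<open>Sums of unit cubes of grid maps\<close>

definition grid_map :: "nat \<Rightarrow> 'v ugraph \<Rightarrow> (int list \<Rightarrow> 'v) \<Rightarrow> bool" where
  "grid_map k G F \<longleftrightarrow> (\<forall>x. length x = k \<longrightarrow> F x \<in> verts G) \<and>
     (\<forall>x y. length x = k \<longrightarrow> nbr x y \<longrightarrow> near G (F x) (F y))"

lemma grid_mapD:
  assumes "grid_map k G F" "length x = k"
  shows "F x \<in> verts G" "nbr x y \<Longrightarrow> near G (F x) (F y)"
  using assms by (auto simp: grid_map_def)

definition const_outside :: "nat \<Rightarrow> 'v \<Rightarrow> int \<Rightarrow> (int list \<Rightarrow> 'v) \<Rightarrow> bool" where
  "const_outside k v r F \<longleftrightarrow> (\<forall>x. length x = k \<longrightarrow> (\<exists>a\<in>set x. r \<le> \<bar>a\<bar>) \<longrightarrow> F x = v)"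

lemma const_outsideD: "\<lbrakk>const_outside k v r F; length x = k; a \<in> set x; r \<le> \<bar>a\<bar>\<rbrakk> \<Longrightarrow> F x = v"
  by (auto simp: const_outside_def)

text \<open>Half-open, since its points are the lowest corners of the unit cubes filling
  \<open>[lo, hi]^k\<close>.\<close>

definition int_box :: "nat \<Rightarrow> int \<Rightarrow> int \<Rightarrow> int list set" where
  "int_box k lo hi = {x. set x \<subseteq> {lo..<hi} \<and> length x = k}"

lemma int_box_length: "x \<in> int_box k lo hi \<Longrightarrow> length x = k"
  by (simp add: int_box_def)

lemma finite_int_box [simp]: "finite (int_box k lo hi)"
  unfolding int_box_def by (rule finite_lists_length_eq) simp

definition box_sum :: "nat \<Rightarrow> int \<Rightarrow> int \<Rightarrow> (int list \<Rightarrow> 'v) \<Rightarrow> (int list \<Rightarrow> 'v) \<Rightarrow>\<^sub>0 int" where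
  "box_sum k lo hi F = (\<Sum>x\<in>int_box k lo hi. frag_of (subcube k F x))"

lemma nbr_shift: "\<lbrakk>nbr y y'; length x = length y\<rbrakk> \<Longrightarrow> nbr (map2 (+) x y) (map2 (+) x y')"
proof (induction arbitrary: x rule: nbr.induct)
  case (here a b y)
  then show ?case by (cases x) (auto intro: nbr.here)
next
  case (there y y' a)
  then show ?case by (cases x) (auto intro: nbr.there)
qed

lemma subcube_in_cubes:
  assumes "grid_map k G F" "length x = k"
  shows "subcube k F x \<in> cubes k G"
proof (rule cubesI)
  fix y z assume y: "y \<in> cube_verts k" "z \<in> cube_verts k" "nbr y z"
  then have "length y = k" by (simp add: cube_verts_length)
  then show "near G (subcube k F x y) (subcube k F x z)"
    using y assms by (simp add: subcube_def) (intro grid_mapD(2)[OF assms(1)] nbr_shift, simp_all)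
qed (use assms in \<open>simp_all add: subcube_def cube_verts_length grid_mapD(1)\<close>)

lemma subcube_extensional [simp]: "subcube k F x \<in> extensional (cube_verts k)"
  by (simp add: subcube_def)

lemma box_sum_chain: "grid_map k G F \<Longrightarrow> keys (box_sum k lo hi F) \<subseteq> cubes k G"
  unfolding box_sum_def
  by (intro keys_sum_subset) (simp add: subcube_in_cubes int_box_length)

lemma const_cube_degenerate:
  assumes "\<sigma> \<in> cubes k G" "1 \<le> k" "\<And>y. y \<in> cube_verts k \<Longrightarrow> \<sigma> y = v"
  shows "\<sigma> \<in> degenerate_cubes k G"
  using assms ins_cube_verts[OF assms(2), of _ _ 1]
  by (intro degenerate_cubesI[of _ _ _ 1]) (simp_all add: face_ins cong: restrict_cong)

lemma map2_add_mem:
  assumes "length x = k" "y \<in> cube_verts k" "a \<in> set x"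
  shows "a \<in> set (map2 (+) x y) \<or> a + 1 \<in> set (map2 (+) x y)"
proof -
  obtain i where i: "i < k" "a = x ! i" using assms by (metis in_set_conv_nth)
  then have "y ! i \<in> set y" using assms by (simp add: cube_verts_length)
  moreover have "set y \<subseteq> {0..int 1}" using assms(2) by (simp add: verts_box)
  ultimately have "y ! i \<in> {0..int 1}" by blast
  then have "y ! i = 0 \<or> y ! i = 1" by auto
  moreover have "map2 (+) x y ! i = a + y ! i" "i < length (map2 (+) x y)"
    using i assms by (simp_all add: cube_verts_length)
  ultimately show ?thesis using nth_mem[of i "map2 (+) x y"] by auto
qed

text \<open>A unit cube that is dropped has a coordinate \<open>a < lo'\<close> or
  \<open>a >= hi'\<close>, so \<open>a\<close> and \<open>a + 1\<close> both lie where
  \<open>F\<close> is constant and the whole cube is degenerate. The two bounds are independent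
  because boxes \<open>[0, m]^k\<close> are compared with centred ones.\<close>

lemma box_sum_shrink:
  assumes "1 \<le> k" "grid_map k G F" "lo \<le> lo'" "hi' \<le> hi"
    and const: "\<And>x a. \<lbrakk>length x = k; a \<in> set x; a \<le> lo' \<or> hi' \<le> a\<rbrakk> \<Longrightarrow> F x = v"
  shows "keys (box_sum k lo hi F - box_sum k lo' hi' F) \<subseteq> degenerate_cubes k G"
proof -
  have sub: "int_box k lo' hi' \<subseteq> int_box k lo hi"
    using assms(3,4) by (auto simp: int_box_def subset_iff)
  have "box_sum k lo hi F - box_sum k lo' hi' F
      = (\<Sum>x\<in>int_box k lo hi - int_box k lo' hi'. frag_of (subcube k F x))"
    unfolding box_sum_def using sum.subset_diff[OF sub, of "\<lambda>x. frag_of (subcube k F x)"] by simp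
  also have "keys \<dots> \<subseteq> degenerate_cubes k G"
  proof (intro keys_sum_subset)
    fix x assume x: "x \<in> int_box k lo hi - int_box k lo' hi'"
    then obtain a where a: "a \<in> set x" "a < lo' \<or> hi' \<le> a" and len: "length x = k"
      by (fastforce simp: int_box_def subset_iff)
    have "F (map2 (+) x y) = v" if "y \<in> cube_verts k" for y
    proof -
      have "length (map2 (+) x y) = k" using len that by (simp add: cube_verts_length)
      then show ?thesis
        using map2_add_mem[OF len that a(1)] a(2)
          const[of "map2 (+) x y" a] const[of "map2 (+) x y" "a + 1"] by linarith
    qed
    then have "subcube k F x \<in> degenerate_cubes k G"
      using assms(1,2) len
      by (intro const_cube_degenerate[where v = v] subcube_in_cubes) (simp_all add: subcube_def)
    then show "keys (frag_of (subcube k F x)) \<subseteq> degenerate_cubes k G" by simp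
  qed
  finally show ?thesis .
qed

section \<open>Cancellation of faces inside a box\<close>

subsection \<open>Opposite sides cancel\<close>

lemma map2_ins:
  "length x = length y \<Longrightarrow> map2 (+) (ins i a x) (ins i e y) = ins i (a + e) (map2 (+) x y)"
  by (simp add: ins_def zip_append take_map drop_map take_zip drop_zip)

lemma face_subcube:
  assumes "1 \<le> k" "length x = k - 1" "e = 0 \<or> e = 1"
  shows "face k i e (subcube k F (ins i a x)) = subcube (k - 1) (\<lambda>y. F (ins i (a + e) y)) x"
  using ins_cube_verts[OF assms(1) _ assms(3)] assms
  by (auto simp: face_ins subcube_def fun_eq_iff cube_verts_length map2_ins)

lemma sum_int_box_ins:
  fixes g :: "int list \<Rightarrow> 'b::comm_monoid_add"
  assumes "1 \<le> i" "i \<le> k"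
  shows "sum g (int_box k lo hi) = (\<Sum>x\<in>int_box (k - 1) lo hi. \<Sum>a\<in>{lo..<hi}. g (ins i a x))"
  unfolding sum.cartesian_product
proof (rule sum.reindex_bij_witness[of _ "\<lambda>(x, a). ins i a x"
      "\<lambda>x. (take (i - 1) x @ drop i x, x ! (i - 1))"])
  fix x assume x: "x \<in> int_box k lo hi"
  then have i: "i - 1 < length x" using assms by (simp add: int_box_def)
  have "drop (i - 1) x = x ! (i - 1) # drop i x" using Cons_nth_drop_Suc[OF i] assms by simp
  then show *: "(case (take (i - 1) x @ drop i x, x ! (i - 1)) of (x, a) \<Rightarrow> ins i a x) = x"
    using i by (simp add: ins_def) (metis append_take_drop_id)
  show "(take (i - 1) x @ drop i x, x ! (i - 1)) \<in> int_box (k - 1) lo hi \<times> {lo..<hi}"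
    using x i assms set_take_subset[of "i - 1" x] set_drop_subset[of i x] nth_mem[OF i]
    by (auto simp: int_box_def subset_iff)
  show "(case (take (i - 1) x @ drop i x, x ! (i - 1)) of (x, a) \<Rightarrow> g (ins i a x)) = g x"
    using * by simp
next
  fix p assume p: "p \<in> int_box (k - 1) lo hi \<times> {lo..<hi}"
  obtain x a where [simp]: "p = (x, a)" by (cases p)
  have x: "length x = k - 1" using p by (simp add: int_box_def)
  then show "(take (i - 1) (case p of (x, a) \<Rightarrow> ins i a x) @ drop i (case p of (x, a) \<Rightarrow> ins i a x),
      (case p of (x, a) \<Rightarrow> ins i a x) ! (i - 1)) = p"
    using assms by (cases i) (simp_all add: ins_def nth_append)
  show "(case p of (x, a) \<Rightarrow> ins i a x) \<in> int_box k lo hi"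
    using p assms by (auto simp: int_box_def set_ins)
qed

lemma telescope_int:
  fixes B :: "int \<Rightarrow> 'b::ab_group_add"
  assumes "lo \<le> hi"
  shows "(\<Sum>a\<in>{lo..<hi}. B a - B (a + 1)) = B lo - B hi"
  using assms
proof (induction rule: int_ge_induct)
  case (step i)
  then have "{lo..<i + 1} = insert i {lo..<i}" by auto
  then show ?case using step by simp
qed simp

text \<open>Along direction \<open>i\<close> the inner faces telescope and the two outer ones agree.
  \<open>B a x\<close> stands for what sits over \<open>x\<close> in the hyperplane where coordinate
  \<open>i\<close> is \<open>a\<close>: a face in \<open>bd_box_sum\<close>, a cylinder over a face
  in \<open>box_sum_homologous\<close>.\<close>

lemma opposite_sides_cancel:
  fixes g :: "int list \<Rightarrow> int \<Rightarrow> 'b::ab_group_add"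
  assumes "1 \<le> i" "i \<le> k" "lo \<le> hi"
    and g: "\<And>x a e. \<lbrakk>length x = k - 1; e = 0 \<or> e = 1\<rbrakk> \<Longrightarrow> g (ins i a x) e = B (a + e) x"
    and B: "\<And>x. length x = k - 1 \<Longrightarrow> B lo x = B hi x"
  shows "(\<Sum>x\<in>int_box k lo hi. g x 0 - g x 1) = 0"
proof -
  have "(\<Sum>a\<in>{lo..<hi}. g (ins i a x) 0 - g (ins i a x) 1) = 0" if "length x = k - 1" for x
    using telescope_int[OF assms(3), of "\<lambda>a. B a x"] B[OF that] g[OF that] by simp
  then show ?thesis
    by (subst sum_int_box_ins[OF assms(1,2)], intro sum.neutral) (simp add: int_box_length)
qed

lemma const_outside_sides:
  assumes "const_outside k v r F" "lo \<le> - r" "r \<le> hi" "1 \<le> k" "length x = k - 1"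
  shows "subcube (k - 1) (\<lambda>y. F (ins i lo y)) x = subcube (k - 1) (\<lambda>y. F (ins i hi y)) x"
proof -
  have "F (ins i lo y) = v" "F (ins i hi y) = v" if "length y = k - 1" for y
    using that assms by (auto intro!: const_outsideD[OF assms(1)] simp: set_ins)
  then show ?thesis using assms(5) by (simp add: subcube_def cube_verts_length cong: restrict_cong)
qed

text \<open>Opposite outer sides carry the same constant cubes, so the boundary vanishes exactly and
  not only up to degenerate cubes.\<close>

lemma bd_box_sum:
  assumes F: "const_outside k v r F" "lo \<le> - r" "r \<le> hi" "lo \<le> hi"
  shows "bd k (box_sum k lo hi F) = 0"
proof -
  have "bd k (box_sum k lo hi F) = (\<Sum>i\<in>{1..k}. frag_cmul ((-1) ^ i)
      (\<Sum>x\<in>int_box k lo hi. frag_of (face k i 0 (subcube k F x)) - frag_of (face k i 1 (subcube k F x))))"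
    unfolding box_sum_def bd_sum bd_of cube_boundary_def
    by (subst sum.swap) (simp add: frag_cmul_sum)
  also have "\<dots> = 0"
  proof (intro sum.neutral ballI)
    fix i assume i: "i \<in> {1..k}"
    have "(\<Sum>x\<in>int_box k lo hi. frag_of (face k i 0 (subcube k F x)) - frag_of (face k i 1 (subcube k F x))) = 0"
    proof (rule opposite_sides_cancel)
      show "frag_of (face k i e (subcube k F (ins i a x)))
          = frag_of (subcube (k - 1) (\<lambda>y. F (ins i (a + e) y)) x)"
        if "length x = k - 1" "e = 0 \<or> e = 1" for x a e
        using face_subcube[of k x e i F a] that i by simp
      show "frag_of (subcube (k - 1) (\<lambda>y. F (ins i lo y)) x) = frag_of (subcube (k - 1) (\<lambda>y. F (ins i hi y)) x)"
        if "length x = k - 1" for x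
        using const_outside_sides[OF F(1-3) _ that, of i] i by simp
    qed (use i F in auto)
    then show "frag_cmul ((-1) ^ i)
      (\<Sum>x\<in>int_box k lo hi. frag_of (face k i 0 (subcube k F x)) - frag_of (face k i 1 (subcube k F x))) = 0"
      by simp
  qed
  finally show ?thesis .
qed

lemma box_sum_cycle:
  assumes "grid_map k G F" "const_outside k v r F" "0 \<le> r"
  shows "cycle k G (box_sum k (- r) r F)"
  using box_sum_chain[OF assms(1)] bd_box_sum[OF assms(2), of "- r" r] assms(3)
  by (simp add: cycle_def)

text \<open>The cylinders between corresponding unit cubes form the connecting chain; their lateral
  faces cancel because both maps are constant on the outer sides. The constants \<open>v\<close> and
  \<open>v'\<close> may differ, so that the lemma serves homotopies and changes of base vertex
  alike.\<close>

lemma box_sum_homologous: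
  assumes F: "grid_map k G F" "const_outside k v r F"
    and F': "grid_map k G F'" "const_outside k v' r F'"
    and near: "\<And>x. length x = k \<Longrightarrow> near G (F x) (F' x) \<and> near G (F' x) (F x)"
    and lohi: "lo \<le> - r" "r \<le> hi" "lo \<le> hi"
  shows "homologous k G (box_sum k lo hi F') (box_sum k lo hi F)"
proof (rule homologousI)
  let ?u = "\<Sum>x\<in>int_box k lo hi. frag_of (cyl k (subcube k F x) (subcube k F' x))"
  let ?c = "\<lambda>i x e. frag_of (cyl (k - 1) (face k i e (subcube k F x)) (face k i e (subcube k F' x)))"
  show "keys ?u \<subseteq> cubes (Suc k) G"
  proof (intro keys_sum_subset)
    fix x assume "x \<in> int_box k lo hi"
    then have x: "length x = k" by (rule int_box_length)
    have "cyl k (subcube k F x) (subcube k F' x) \<in> cubes (Suc k) G"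
      using x near F F'
      by (intro cyl_in_cubes subcube_in_cubes) (simp_all add: subcube_def cube_verts_length)
    then show "keys (frag_of (cyl k (subcube k F x) (subcube k F' x))) \<subseteq> cubes (Suc k) G" by simp
  qed
  have "bd (Suc k) ?u = box_sum k lo hi F' - box_sum k lo hi F
      - (\<Sum>x\<in>int_box k lo hi. \<Sum>i\<in>{1..k}. frag_cmul ((-1) ^ i) (?c i x 0 - ?c i x 1))"
    by (simp add: bd_sum bd_of cube_boundary_cyl box_sum_def sum_subtractf)
  also have "(\<Sum>x\<in>int_box k lo hi. \<Sum>i\<in>{1..k}. frag_cmul ((-1) ^ i) (?c i x 0 - ?c i x 1))
      = (\<Sum>i\<in>{1..k}. frag_cmul ((-1) ^ i) (\<Sum>x\<in>int_box k lo hi. ?c i x 0 - ?c i x 1))"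
    by (subst sum.swap) (simp add: frag_cmul_sum)
  also have "\<dots> = 0"
  proof (intro sum.neutral ballI)
    fix i assume i: "i \<in> {1..k}"
    let ?B = "\<lambda>a x. frag_of (cyl (k - 1) (subcube (k - 1) (\<lambda>y. F (ins i a y)) x)
        (subcube (k - 1) (\<lambda>y. F' (ins i a y)) x))"
    have "(\<Sum>x\<in>int_box k lo hi. ?c i x 0 - ?c i x 1) = 0"
    proof (rule opposite_sides_cancel)
      show "?c i (ins i a x) e = ?B (a + e) x" if "length x = k - 1" "e = 0 \<or> e = 1" for x a e
        using that i by (simp add: face_subcube)
      show "?B lo x = ?B hi x" if "length x = k - 1" for x
        using const_outside_sides[OF F(2) lohi(1,2) _ that, of i]
          const_outside_sides[OF F'(2) lohi(1,2) _ that, of i] i by simp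
    qed (use i lohi in auto)
    then show "frag_cmul ((-1) ^ i) (\<Sum>x\<in>int_box k lo hi. ?c i x 0 - ?c i x 1) = 0" by simp
  qed
  finally show "keys (box_sum k lo hi F' - box_sum k lo hi F - bd (Suc k) ?u) \<subseteq> degenerate_cubes k G"
    by simp
qed

section \<open>Cycles carried by one grid map, for any base vertex\<close>

subsection \<open>Spherical classes and change of base point\<close>

definition spherical :: "nat \<Rightarrow> 'v ugraph \<Rightarrow> 'v \<Rightarrow> ((int list \<Rightarrow> 'v) \<Rightarrow>\<^sub>0 int) \<Rightarrow> bool" where
  "spherical k G v z \<longleftrightarrow> (\<exists>F r. 0 \<le> r \<and> grid_map k G F \<and> const_outside k v r F \<and>
     homologous k G z (box_sum k (- r) r F))"

lemma const_outside_mono: "\<lbrakk>const_outside k v r F; r \<le> r'\<rbrakk> \<Longrightarrow> const_outside k v r' F"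
  unfolding const_outside_def using order_trans[of r r'] by blast

lemma const_outside_shrink:
  assumes "1 \<le> k" "grid_map k G F" "const_outside k v r F" "lo \<le> - r" "r \<le> hi"
  shows "homologous k G (box_sum k lo hi F) (box_sum k (- r) r F)"
  by (rule homologous_degenerate, rule box_sum_shrink[where v = v])
    (use assms in \<open>auto intro: const_outsideD[OF assms(3)]\<close>)

definition wf_graph :: "'v ugraph \<Rightarrow> bool" where
  "wf_graph G \<longleftrightarrow> (\<forall>u v. adj G u v \<longrightarrow> u \<in> verts G \<and> v \<in> verts G \<and> u \<noteq> v \<and> adj G v u)"

lemma near_sym: "wf_graph G \<Longrightarrow> near G u v \<Longrightarrow> near G v u"
  by (auto simp: wf_graph_def near_def)

text \<open>Recolour the region outside \<open>[-r, r]^k\<close> from \<open>v\<close> to its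
  neighbour \<open>v'\<close>. \<open>F\<close> is already \<open>v\<close> on the surface of that
  box, so the only new steps are between \<open>v\<close> and \<open>v'\<close>.\<close>

lemma spherical_adj:
  assumes "wf_graph G" "1 \<le> k" "spherical k G v z" "adj G v v'"
  shows "spherical k G v' z"
proof -
  have v': "v' \<in> verts G" "near G v v'" "near G v' v"
    using assms(1,4) by (auto simp: wf_graph_def near_def)
  obtain F r where F: "0 \<le> r" "grid_map k G F" "const_outside k v r F"
      and z: "homologous k G z (box_sum k (- r) r F)"
    using assms(3) by (auto simp: spherical_def)
  define F' where "F' x = (if \<forall>a\<in>set x. \<bar>a\<bar> \<le> r then F x else v')" for x
  have out: "F x = v" if "length x = k" "\<not> (\<forall>a\<in>set x. \<bar>a\<bar> \<le> r)" for x
    using that by (auto intro: const_outsideD[OF F(3)])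
  have edge: "F x = v" if xy: "length x = k" "nbr x y" "\<forall>a\<in>set x. \<bar>a\<bar> \<le> r" "\<not> (\<forall>a\<in>set y. \<bar>a\<bar> \<le> r)" for x y
  proof -
    obtain i where i: "i < length y" "\<bar>y ! i\<bar> > r" using xy(4) by (metis in_set_conv_nth not_less)
    have "\<bar>x ! i - y ! i\<bar> \<le> 1" and len: "length x = length y"
      using xy(2) i(1) unfolding nbr_iff by (metis abs_zero diff_self order_refl zero_le_one)+
    then have "r \<le> \<bar>x ! i\<bar>" "x ! i \<in> set x" using i by auto
    then show ?thesis using const_outsideD[OF F(3)] xy(1) by blast
  qed
  have F': "grid_map k G F'"
    unfolding grid_map_def
  proof (intro conjI allI impI)
    fix x :: "int list" assume x: "length x = k"
    show "F' x \<in> verts G" using v' grid_mapD(1)[OF F(2) x] by (simp add: F'_def)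
    fix y assume xy: "nbr x y"
    then have y: "length y = k" using x nbr_length by simp
    show "near G (F' x) (F' y)"
      using grid_mapD(2)[OF F(2) x xy] edge[OF x xy] edge[OF y nbr_sym[OF xy]] v'
      by (auto simp: F'_def)
  qed
  \<comment> \<open>Points with coordinates of absolute value exactly \<open>r\<close> may keep the
    value \<open>v\<close>, hence the radius \<open>r + 1\<close>.\<close>
  have c': "const_outside k v' (r + 1) F'"
    by (auto simp: const_outside_def F'_def)
  have "near G (F x) (F' x) \<and> near G (F' x) (F x)" if "length x = k" for x
    using out[OF that] v' by (auto simp: F'_def)
  then have "homologous k G (box_sum k (- (r + 1)) (r + 1) F') (box_sum k (- (r + 1)) (r + 1) F)"
    using F(1) by (intro box_sum_homologous[OF F(2) const_outside_mono[OF F(3)] F' c']) simp_all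
  also have "homologous k G \<dots> (box_sum k (- r) r F)"
    using assms(2) F by (intro const_outside_shrink) simp_all
  finally have "homologous k G z (box_sum k (- (r + 1)) (r + 1) F')"
    using z homologous_sym homologous_trans by blast
  then show ?thesis
    unfolding spherical_def using F(1) F' c' by (intro exI[of _ F'] exI[of _ "r + 1"]) simp
qed

lemma connected_graph_wf: "connected_graph G \<Longrightarrow> wf_graph G"
  by (auto simp: connected_graph_def wf_graph_def)

lemma spherical_base:
  assumes G: "connected_graph G" and "1 \<le> k" "spherical k G v z" "v \<in> verts G" "v' \<in> verts G"
  shows "spherical k G v' z"
proof -
  have "(adj G)\<^sup>*\<^sup>* v v'" using assms by (auto simp: connected_graph_def)
  then show ?thesis
    by (induction rule: rtranclp_induct)
      (use assms in \<open>auto intro: spherical_adj[OF connected_graph_wf[OF G]]\<close>)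
qed

section \<open>One-dimensional cycles as closed walks\<close>

section \<open>Dimension one\<close>

definition edge :: "'v \<Rightarrow> 'v \<Rightarrow> int list \<Rightarrow> 'v" where
  "edge a b = (\<lambda>z\<in>cube_verts 1. if hd z = 0 then a else b)"

definition point :: "'v \<Rightarrow> int list \<Rightarrow> 'v" where
  "point a = (\<lambda>y\<in>cube_verts 0. a)"

lemma cube_verts_1: "cube_verts 1 = {[0], [1]}"
proof -
  have "z \<in> cube_verts (Suc 0) \<longleftrightarrow> z \<in> {[0], [1]}" for z
    by (auto elim!: cube_verts_SucE)
  then show ?thesis by (auto simp flip: One_nat_def)
qed

lemma edge_cyl: "edge a b = cyl 0 (point a) (point b)"
  unfolding edge_def cyl_def point_def One_nat_def[symmetric]
  by (rule restrict_ext) (auto simp: cube_verts_1)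

lemma point_extensional: "point a \<in> extensional (cube_verts 0)"
  by (simp add: point_def)

lemma point_in_cubes: "a \<in> verts G \<Longrightarrow> point a \<in> cubes 0 G"
  by (rule cubesI) (simp_all add: point_def)

lemma face_edge [simp]: "face 1 1 0 (edge a b) = point a" "face 1 1 1 (edge a b) = point b"
  using face_cyl_1[OF point_extensional point_extensional, of a b] by (simp_all add: edge_cyl flip: One_nat_def)

lemma edge_extensional [simp]: "edge a b \<in> extensional (cube_verts 1)"
  by (simp add: edge_def)

lemma edge_in_cubes:
  "\<lbrakk>a \<in> verts G; b \<in> verts G; near G a b; near G b a\<rbrakk> \<Longrightarrow> edge a b \<in> cubes 1 G"
  using cyl_in_cubes[OF point_in_cubes point_in_cubes, of a G b]
  by (simp add: edge_cyl point_def flip: One_nat_def)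

lemma cubes_1E:
  assumes "\<sigma> \<in> cubes 1 G"
  obtains a b where "a \<in> verts G" "b \<in> verts G" "near G a b" "\<sigma> = edge a b"
proof
  have v: "[0] \<in> cube_verts 1" "[1] \<in> cube_verts 1" by (simp_all add: verts_box)
  show "\<sigma> [0] \<in> verts G" "\<sigma> [1] \<in> verts G" "near G (\<sigma> [0]) (\<sigma> [1])"
    using v cubesD[OF assms] by (simp_all add: nbr_Cons)
  show "\<sigma> = edge (\<sigma> [0]) (\<sigma> [1])"
  proof
    fix z
    show "\<sigma> z = edge (\<sigma> [0]) (\<sigma> [1]) z"
    proof (cases "z \<in> cube_verts 1")
      case True
      then show ?thesis by (auto simp: edge_def cube_verts_1)
    next
      case False
      then show ?thesis
        unfolding edge_def restrict_def using extensional_arb[OF cubesD(1)[OF assms]] by metis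
    qed
  qed
qed

lemma bd_edge: "bd 1 (frag_of (edge a b)) = frag_of (point b) - frag_of (point a)"
  by (simp add: bd_of cube_boundary_def)

lemma edge_same_degenerate: "a \<in> verts G \<Longrightarrow> edge a a \<in> degenerate_cubes 1 G"
  by (rule degenerate_cubesI[of _ _ _ 1]) (simp_all add: edge_in_cubes)

text \<open>The square with corners \<open>a\<close>, \<open>b\<close>, \<open>a\<close>,
  \<open>a\<close> is bounded by the edges \<open>a b\<close> and \<open>b a\<close> and by two
  constant edges.\<close>

lemma edge_rev:
  assumes G: "wf_graph G" and "a \<in> verts G" "b \<in> verts G" "near G a b"
  shows "homologous 1 G (frag_of (edge b a)) (- frag_of (edge a b))"
proof (rule homologousI)
  have ba: "near G b a" using near_sym[OF G assms(4)] .
  let ?u = "- frag_of (cyl 1 (edge a b) (edge a a))"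
  have "cyl 1 (edge a b) (edge a a) \<in> cubes (Suc 1) G"
    using assms ba by (intro cyl_in_cubes edge_in_cubes) (simp_all add: edge_def)
  then show "keys ?u \<subseteq> cubes (Suc 1) G" by (simp add: keys_minus)
  have "bd (Suc 1) ?u = - (frag_of (edge a a) - frag_of (edge a b)
      + (frag_of (edge a a) - frag_of (edge b a)))"
    by (simp add: bd_minus bd_of cube_boundary_cyl del: Suc_1 flip: edge_cyl)
  then have "frag_of (edge b a) - - frag_of (edge a b) - bd (Suc 1) ?u
      = frag_of (edge a a) + frag_of (edge a a)"
    by simp
  then show "keys (frag_of (edge b a) - - frag_of (edge a b) - bd (Suc 1) ?u) \<subseteq> degenerate_cubes 1 G"
    using edge_same_degenerate[OF assms(2)] by (simp only:) (intro keys_add_subset, simp_all)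
qed

fun walk_chain :: "'v list \<Rightarrow> (int list \<Rightarrow> 'v) \<Rightarrow>\<^sub>0 int" where
  "walk_chain (a # b # w) = frag_of (edge a b) + walk_chain (b # w)"
| "walk_chain _ = 0"

text \<open>Steps may stay put, which \<open>near\<close> allows: joining two walks at a common end
  repeats that vertex, and the additional edge is degenerate.\<close>

definition walk :: "'v ugraph \<Rightarrow> 'v list \<Rightarrow> 'v \<Rightarrow> 'v \<Rightarrow> bool" where
  "walk G w a b \<longleftrightarrow> w \<noteq> [] \<and> set w \<subseteq> verts G \<and> successively (near G) w \<and> hd w = a \<and> last w = b"

lemma walk_chain_append:
  "\<lbrakk>u \<noteq> []; w \<noteq> []\<rbrakk>
    \<Longrightarrow> walk_chain (u @ w) = walk_chain u + frag_of (edge (last u) (hd w)) + walk_chain w"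
proof (induction u rule: walk_chain.induct)
  case ("2_2" v)
  then show ?case by (cases w) auto
qed auto

lemma walk_append:
  "\<lbrakk>walk G u a b; walk G w c d; near G b c\<rbrakk> \<Longrightarrow> walk G (u @ w) a d"
  by (auto simp: walk_def successively_append_iff)

lemma walk_rev: "\<lbrakk>wf_graph G; walk G w a b\<rbrakk> \<Longrightarrow> walk G (rev w) b a"
  by (auto simp: walk_def hd_rev last_rev intro: near_sym elim!: successively_mono)

lemma walk_ends: "walk G w a b \<Longrightarrow> a \<in> verts G \<and> b \<in> verts G"
  unfolding walk_def by (metis hd_in_set last_in_set subsetD)

lemma walk_chain_rev:
  assumes G: "wf_graph G"
  shows "walk G w a b \<Longrightarrow> homologous 1 G (walk_chain (rev w)) (- walk_chain w)"
proof (induction w arbitrary: a rule: walk_chain.induct)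
  case (1 x y w)
  then have w: "walk G (y # w) y b" and xy: "x \<in> verts G" "y \<in> verts G" "near G x y"
    by (auto simp: walk_def)
  have "walk_chain (rev (x # y # w)) = walk_chain (rev (y # w)) + frag_of (edge y x)"
    using walk_chain_append[of "rev (y # w)" "[x]"] by simp
  also have "homologous 1 G \<dots> (- walk_chain (y # w) + - frag_of (edge x y))"
    by (intro homologous_add 1(1)[OF w] edge_rev G xy)
  finally show ?case by (simp add: algebra_simps)
qed auto

lemma connected_walk:
  assumes G: "connected_graph G" and "a \<in> verts G" "b \<in> verts G"
  shows "\<exists>w. walk G w a b"
proof -
  have "(adj G)\<^sup>*\<^sup>* a b" using assms by (auto simp: connected_graph_def)
  then show ?thesis
  proof (induction rule: rtranclp_induct)
    case base
    then show ?case using assms by (intro exI[of _ "[a]"]) (simp add: walk_def)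
  next
    case (step y z)
    then obtain w where "walk G w a y" by auto
    moreover have "walk G [z] z z" "near G y z"
      using step(2) G by (auto simp: walk_def connected_graph_def near_def)
    ultimately have "walk G (w @ [z]) a z" by (rule walk_append)
    then show ?case ..
  qed
qed

text \<open>Coning the boundary of a chain off to the base vertex along chosen walks \<open>p u\<close> turns every
  chain into a closed walk; a cycle has nothing to be coned off.\<close>

lemma chain_closed_walk:
  fixes G :: "'v ugraph"
  assumes G: "connected_graph G" and v: "v \<in> verts G" and c: "keys c \<subseteq> cubes 1 G"
    and p: "\<And>u. u \<in> verts G \<Longrightarrow> walk G (p u) v u"
  shows "\<exists>w. walk G w v v \<and>
    homologous 1 G (c - frag_extend (\<lambda>\<tau>. walk_chain (p (\<tau> []))) (bd 1 c)) (walk_chain w)"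
    (is "\<exists>w. ?P w c")
  using c
proof (induction c rule: frag_induction)
  case zero
  show ?case using v by (intro exI[of _ "[v]"]) (simp add: walk_def)
next
  case (one \<sigma>)
  have wf: "wf_graph G" using G by (rule connected_graph_wf)
  obtain a b where ab: "a \<in> verts G" "b \<in> verts G" "near G a b" and \<sigma>: "\<sigma> = edge a b"
    using cubes_1E[OF one] .
  have pa: "walk G (p a) v a" and pb: "walk G (p b) v b" using p ab by auto
  have "homologous 1 G (walk_chain (p a) + frag_of (edge a b) + walk_chain (rev (p b)))
      (walk_chain (p a) + frag_of (edge a b) + - walk_chain (p b))"
    by (intro homologous_add homologous_refl walk_chain_rev[OF wf pb])
  moreover have "walk_chain (p a @ rev (p b))
      = walk_chain (p a) + frag_of (edge a b) + walk_chain (rev (p b))"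
    using pa pb walk_chain_append[of "p a" "rev (p b)"] by (simp add: walk_def hd_rev)
  moreover have "frag_of \<sigma> - frag_extend (\<lambda>\<tau>. walk_chain (p (\<tau> []))) (bd 1 (frag_of \<sigma>))
      = walk_chain (p a) + frag_of (edge a b) + - walk_chain (p b)"
    by (simp add: \<sigma> bd_edge frag_extend_diff) (simp add: point_def)
  ultimately have "?P (p a @ rev (p b)) (frag_of \<sigma>)"
    using walk_append[OF pa walk_rev[OF wf pb] ab(3)] homologous_sym by metis
  then show ?case ..
next
  case (diff c d)
  have wf: "wf_graph G" using G by (rule connected_graph_wf)
  obtain w1 w2 where w: "?P w1 c" "?P w2 d" using diff by blast
  then have "walk G (w1 @ rev w2) v v" using wf by (auto intro: walk_append walk_rev)
  moreover have "homologous 1 G (walk_chain (w1 @ rev w2)) (walk_chain w1 - walk_chain w2)"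
  proof -
    have "walk_chain (w1 @ rev w2) = walk_chain w1 + frag_of (edge v v) + walk_chain (rev w2)"
      using w walk_chain_append[of w1 "rev w2"] by (simp add: walk_def hd_rev)
    also have "homologous 1 G \<dots> (walk_chain w1 + 0 + - walk_chain w2)"
      using w edge_same_degenerate[OF v]
      by (intro homologous_add homologous_refl walk_chain_rev[OF wf] homologous_degenerate) auto
    finally show ?thesis by simp
  qed
  then have "homologous 1 G (walk_chain w1 - walk_chain w2) (walk_chain (w1 @ rev w2))"
    by (rule homologous_sym)
  moreover have "homologous 1 G
      (c - d - frag_extend (\<lambda>\<tau>. walk_chain (p (\<tau> []))) (bd 1 (c - d))) (walk_chain w1 - walk_chain w2)"
    using homologous_diff[OF w(1)[THEN conjunct2] w(2)[THEN conjunct2]]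
    by (simp add: bd_diff frag_extend_diff algebra_simps)
  ultimately show ?case using homologous_trans by blast
qed

lemma walk_chain_sum: "walk_chain w = (\<Sum>i<length w - 1. frag_of (edge (w ! i) (w ! Suc i)))"
proof (induction w rule: walk_chain.induct)
  case (1 a b w)
  then show ?case by (simp add: sum.lessThan_Suc_shift del: sum.lessThan_Suc)
qed auto

lemma subcube_1: "subcube 1 F [a] = edge (F [a]) (F [a + 1])"
  unfolding subcube_def edge_def by (rule restrict_ext) (auto simp: cube_verts_1)

lemma box_sum_1: "box_sum 1 0 (int n) F = (\<Sum>i<n. frag_of (edge (F [int i]) (F [int (Suc i)])))"
proof -
  have "int_box 0 0 (int n) = {[]}" by (auto simp: int_box_def)
  then have "box_sum 1 0 (int n) F = (\<Sum>a\<in>{0..<int n}. frag_of (edge (F [a]) (F [a + 1])))"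
    unfolding box_sum_def by (subst sum_int_box_ins[of 1]) (simp_all add: subcube_1)
  also have "\<dots> = (\<Sum>i<n. frag_of (edge (F [int i]) (F [int (Suc i)])))"
    by (rule sum.reindex_bij_witness[of _ int nat]) (auto simp: add.commute)
  finally show ?thesis .
qed

text \<open>Read the walk along \<open>0..n\<close> on the integer line and stay at \<open>v\<close>
  elsewhere. The negative half of the centred interval adds only constant edges.\<close>

lemma closed_walk_spherical:
  assumes G: "wf_graph G" and w: "walk G w v v"
  shows "spherical 1 G v (walk_chain w)"
proof -
  define n where "n = length w - 1"
  have len: "length w = Suc n" using w by (simp add: n_def walk_def)
  have ends: "w ! 0 = v" "w ! n = v"
    using w by (auto simp: walk_def hd_conv_nth last_conv_nth n_def)
  have wv: "w ! i \<in> verts G" if "i \<le> n" for i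
    using w len that by (auto simp: walk_def)
  have wn: "near G (w ! i) (w ! Suc i)" if "i < n" for i
    using w len that by (simp add: walk_def successively_conv_nth)
  define f where "f a = (if 0 \<le> a \<and> a \<le> int n then w ! nat a else v)" for a
  define F where "F x = f (hd x)" for x
  have v: "v \<in> verts G" using walk_ends[OF w] by simp
  have fv: "f a \<in> verts G" for a using wv[of "nat a"] v by (simp add: f_def nat_le_iff)
  have step: "near G (f a) (f (a + 1))" for a
  proof -
    consider "a < 0" | "0 \<le> a" "a < int n" | "int n \<le> a" by linarith
    then show ?thesis
    proof cases
      case 2
      then show ?thesis using wn[of "nat a"] by (simp add: f_def nat_add_distrib)
    next
      case 1
      then have "a + 1 < 0 \<or> a + 1 = 0" by linarith
      with 1 show ?thesis using ends by (auto simp: f_def)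
    next
      case 3
      then have "a = int n \<or> a > int n" by linarith
      then show ?thesis using ends by (auto simp: f_def)
    qed
  qed
  have F: "grid_map 1 G F"
    unfolding grid_map_def
  proof (intro conjI allI impI)
    fix x y :: "int list" assume x: "length x = 1" "nbr x y"
    obtain a where a: "x = [a]" using x by (cases x) (auto simp: One_nat_def)
    then obtain b where b: "y = [b]" using nbr_length[OF x(2)] by (cases y) auto
    then have "b = a + 1 \<or> a = b + 1" using x a by (auto simp: nbr_Cons)
    then show "near G (F x) (F y)" using step near_sym[OF G step] a b by (auto simp: F_def)
  qed (simp add: F_def fv)
  have c: "F x = v" if "length x = 1" "a \<in> set x" "a \<le> 0 \<or> int n \<le> a" for x a
  proof -
    have "x = [a]" using that by (cases x) (auto simp: One_nat_def)
    then show ?thesis using that ends by (auto simp: F_def f_def)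
  qed
  have co: "const_outside 1 v (int n) F"
    unfolding const_outside_def
  proof (intro allI impI)
    fix x :: "int list" assume x: "length x = 1" "\<exists>a\<in>set x. int n \<le> \<bar>a\<bar>"
    then obtain a where a: "a \<in> set x" "int n \<le> \<bar>a\<bar>" by blast
    then have "a \<le> 0 \<or> int n \<le> a" by linarith
    then show "F x = v" by (rule c[OF x(1) a(1)])
  qed
  have "walk_chain w = box_sum 1 0 (int n) F"
    unfolding box_sum_1 walk_chain_sum n_def[symmetric]
    by (simp add: F_def f_def Suc_nat_eq_nat_zadd1[symmetric])
  moreover have "homologous 1 G (box_sum 1 (- int n) (int n) F) (box_sum 1 0 (int n) F)"
    by (rule homologous_degenerate, rule box_sum_shrink[OF _ F _ _ c]) simp_all
  ultimately show ?thesis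
    unfolding spherical_def using F co homologous_sym
    by (intro exI[of _ F] exI[of _ "int n"]) simp
qed

lemma spherical_homologous: "\<lbrakk>homologous k G z z'; spherical k G v z'\<rbrakk> \<Longrightarrow> spherical k G v z"
  unfolding spherical_def using homologous_trans by blast

theorem cycle_spherical_1:
  assumes G: "connected_graph G" and v: "v \<in> verts G" and z: "cycle 1 G z"
  shows "spherical 1 G v z"
proof -
  obtain p where p: "\<And>u. u \<in> verts G \<Longrightarrow> walk G (p u) v u"
    using connected_walk[OF G v] by metis
  \<comment> \<open>There are no degenerate cubes in dimension zero, so this boundary is zero and
    the coning term of \<open>chain_closed_walk\<close> disappears.\<close>
  have b: "bd 1 z = 0" and c: "keys z \<subseteq> cubes 1 G" using z by (simp_all add: cycle_def)
  obtain w where w: "walk G w v v" "homologous 1 G z (walk_chain w)"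
    using chain_closed_walk[OF G v c p] unfolding b frag_extend_0 diff_zero by metis
  show ?thesis
    by (rule spherical_homologous[OF w(2) closed_walk_spherical[OF connected_graph_wf[OF G] w(1)]])
qed

section \<open>Geometry of the suspension: poles, heights and edges\<close>

section \<open>Suspensions\<close>

lemma push_cycle:
  assumes "1 \<le> k" "gmap H G f" "cycle k H z"
  shows "cycle k G (push k f z)"
  using assms push_chain[OF assms(2), of z k] push_degenerate[OF assms(2), of "bd k z" "k - 1"]
  by (simp add: cycle_def bd_push)

lemma tower_split:
  "\<lbrakk>a \<le> b; b \<le> c\<rbrakk> \<Longrightarrow> tower k h a c z = tower k h a b z + tower k h b c z"
  by (simp add: tower_def sum.atLeastLessThan_concat)

lemma homotopy_induced:
  assumes "homotopy H G h a b" "\<And>s v. \<lbrakk>a \<le> s; s \<le> b; v \<in> verts H\<rbrakk> \<Longrightarrow> h s v \<in> A"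
  shows "homotopy H (induced G A) h a b"
  using assms by (auto simp: homotopy_def gmap_def near_induced)

lemma homotopy_restrict: "homotopy H G h a b \<Longrightarrow> a \<le> a' \<Longrightarrow> a' \<le> b' \<Longrightarrow> b' \<le> b \<Longrightarrow> homotopy H G h a' b'"
  by (auto simp: homotopy_def)

text \<open>The bound on \<open>t\<close> leaves a level strictly between the poles.
  \<open>v0\<close> is the base vertex whose meridian closes up suspended grid maps.\<close>

locale suspended =
  fixes G :: "'a svert ugraph" and t :: nat and v0 :: "'a svert"
  assumes wf: "wf_graph G" and v0: "v0 \<in> verts G" and t: "2 \<le> t"
begin

abbreviation SG :: "'a svert ugraph" where "SG \<equiv> suspension t G"

text \<open>The quotient map from the product. Writing vertices as its values treats the poles and
  the inner levels uniformly.\<close>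

definition lift :: "'a svert \<Rightarrow> int \<Rightarrow> 'a svert" where
  "lift u i = collapse_ends t (u, i)"

lemma lift_0 [simp]: "lift u 0 = South"
  and lift_t [simp]: "lift u (int t) = North"
  and lift_mid: "\<lbrakk>i \<noteq> 0; i \<noteq> int t\<rbrakk> \<Longrightarrow> lift u i = Level u i"
  using t by (auto simp: lift_def collapse_ends_def)

lemma verts_SG: "verts SG = {lift u i | u i. u \<in> verts G \<and> 0 \<le> i \<and> i \<le> int t}"
  unfolding suspension_def contract_along_def cart_prod_def path_graph_def lift_def by auto blast

lemma lift_in_verts: "\<lbrakk>u \<in> verts G; 0 \<le> i; i \<le> int t\<rbrakk> \<Longrightarrow> lift u i \<in> verts SG"
  by (auto simp: verts_SG)

lemma adj_SG:
  "adj SG a b \<longleftrightarrow> a \<noteq> b \<and> (\<exists>u v i j. a = lift u i \<and> b = lift v j \<and> u \<in> verts G \<and> v \<in> verts G \<and>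
     0 \<le> i \<and> i \<le> int t \<and> 0 \<le> j \<and> j \<le> int t \<and> (u = v \<and> \<bar>i - j\<bar> = 1 \<or> i = j \<and> adj G u v))"
proof -
  have "adj SG a b \<longleftrightarrow> a \<noteq> b \<and> (\<exists>u i v j. (u = v \<and> u \<in> verts G \<and> i \<in> {0..int t} \<and> j \<in> {0..int t} \<and> \<bar>i - j\<bar> = 1 \<or>
      adj G u v \<and> i = j \<and> i \<in> {0..int t}) \<and> lift u i = a \<and> lift v j = b)"
    by (simp add: suspension_def contract_along_def cart_prod_def path_graph_def lift_def)
  moreover have "adj G u v \<Longrightarrow> u \<in> verts G \<and> v \<in> verts G" for u v
    using wf by (simp add: wf_graph_def)
  ultimately show ?thesis by (auto; blast)
qed

lemma near_vertical:
  "\<lbrakk>u \<in> verts G; 0 \<le> i; i \<le> int t; 0 \<le> j; j \<le> int t; \<bar>i - j\<bar> \<le> 1\<rbrakk> \<Longrightarrow> near SG (lift u i) (lift u j)"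
  unfolding near_def adj_SG by (cases "i = j") force+

lemma near_horizontal:
  assumes "near G u v" "u \<in> verts G" "v \<in> verts G" "0 \<le> i" "i \<le> int t"
  shows "near SG (lift u i) (lift v i)"
  using assms unfolding near_def adj_SG by blast

lemma near_SG_E:
  assumes "near SG a b" "a \<in> verts SG"
  obtains u v i j where "a = lift u i" "b = lift v j" "u \<in> verts G" "v \<in> verts G"
    "0 \<le> i" "i \<le> int t" "0 \<le> j" "j \<le> int t" "u = v \<and> \<bar>i - j\<bar> \<le> 1 \<or> i = j \<and> near G u v"
proof (cases "a = b")
  case True
  obtain u i where "a = lift u i" "u \<in> verts G" "0 \<le> i" "i \<le> int t"
    using assms(2) by (auto simp: verts_SG)
  then show ?thesis using True that[of u i u i] by simp
next
  case False
  then have "adj SG a b" using assms(1) by (simp add: near_def)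
  then obtain u v i j where *: "a = lift u i" "b = lift v j" "u \<in> verts G" "v \<in> verts G"
    "0 \<le> i" "i \<le> int t" "0 \<le> j" "j \<le> int t" "u = v \<and> \<bar>i - j\<bar> = 1 \<or> i = j \<and> adj G u v"
    unfolding adj_SG by blast
  then have "u = v \<and> \<bar>i - j\<bar> \<le> 1 \<or> i = j \<and> near G u v" by (auto simp: near_def)
  with * show ?thesis using that by blast
qed

lemma wf_SG: "wf_graph SG"
  unfolding wf_graph_def
proof (intro allI impI)
  fix a b assume "adj SG a b"
  then obtain u v i j where *: "a \<noteq> b" "a = lift u i" "b = lift v j" "u \<in> verts G" "v \<in> verts G"
    "0 \<le> i" "i \<le> int t" "0 \<le> j" "j \<le> int t" "u = v \<and> \<bar>i - j\<bar> = 1 \<or> i = j \<and> adj G u v"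
    unfolding adj_SG by blast
  have "v = u \<and> \<bar>j - i\<bar> = 1 \<or> j = i \<and> adj G v u"
    using *(10) wf by (auto simp: wf_graph_def)
  then have "adj SG b a" unfolding adj_SG using * by blast
  then show "a \<in> verts SG \<and> b \<in> verts SG \<and> a \<noteq> b \<and> adj SG b a"
    using * lift_in_verts by simp
qed

lemma South_in_SG: "South \<in> verts SG"
  using lift_in_verts[OF v0, of 0] by simp

text \<open>Every vertex descends along its own vertical path to the south pole.\<close>

lemma connected_SG: "connected_graph SG"
proof -
  have down: "(adj SG)\<^sup>*\<^sup>* (lift u (int i)) South" if "u \<in> verts G" "i \<le> t" for u i
    using that(2)
  proof (induction i)
    case (Suc i)
    have "near SG (lift u (int (Suc i))) (lift u (int i))"
      using Suc.prems that by (intro near_vertical) simp_all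
    moreover have "(adj SG)\<^sup>*\<^sup>* (lift u (int i)) South" using Suc by simp
    ultimately show ?case
      unfolding near_def by (metis converse_rtranclp_into_rtranclp)
  qed simp
  have to_South: "(adj SG)\<^sup>*\<^sup>* a South" if a: "a \<in> verts SG" for a
  proof -
    obtain u i where "a = lift u i" "u \<in> verts G" "0 \<le> i" "i \<le> int t"
      using a by (auto simp: verts_SG)
    then show ?thesis using down[of u "nat i"] by simp
  qed
  have "symp (adj SG)" using wf_SG by (auto simp: wf_graph_def symp_def)
  then have "symp (adj SG)\<^sup>*\<^sup>*" by (rule symp_rtranclp)
  then have "(adj SG)\<^sup>*\<^sup>* South a" if "a \<in> verts SG" for a
    using to_South[OF that] by (auto simp: symp_def)
  then have "(adj SG)\<^sup>*\<^sup>* a b" if "a \<in> verts SG" "b \<in> verts SG" for a b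
    using to_South that rtranclp_trans by metis
  then show ?thesis
    using wf_SG South_in_SG unfolding connected_graph_def wf_graph_def by blast
qed

definition lev :: "'a svert \<Rightarrow> int" where
  "lev a = (case a of North \<Rightarrow> int t | Level u i \<Rightarrow> i | _ \<Rightarrow> 0)"

text \<open>The poles have no well-defined \<open>G\<close>-coordinate; they are assigned \<open>v0\<close>.\<close>

definition base :: "'a svert \<Rightarrow> 'a svert" where
  "base a = (case a of Level u i \<Rightarrow> u | _ \<Rightarrow> v0)"

lemma lift_cases:
  assumes "0 \<le> i" "i \<le> int t"
  obtains "i = 0" "lift u i = South" | "i = int t" "lift u i = North"
    | "0 < i" "i < int t" "lift u i = Level u i"
proof -
  consider "i = 0" | "i = int t" | "0 < i" "i < int t" using assms by linarith
  then show ?thesis by cases (use that in \<open>auto simp: lift_mid\<close>)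
qed

lemma lev_lift [simp]: "\<lbrakk>0 \<le> i; i \<le> int t\<rbrakk> \<Longrightarrow> lev (lift u i) = i"
  by (rule lift_cases[of i u]) (simp_all add: lev_def)

lemma lev_range: "a \<in> verts SG \<Longrightarrow> 0 \<le> lev a \<and> lev a \<le> int t"
  by (auto simp: verts_SG)

lemma verts_SG_E:
  assumes "a \<in> verts SG"
  obtains u i where "a = lift u i" "u \<in> verts G" "0 \<le> i" "i \<le> int t"
  using assms by (auto simp: verts_SG)

lemma base_in_verts:
  assumes "a \<in> verts SG"
  shows "base a \<in> verts G"
proof -
  obtain u i where *: "a = lift u i" "u \<in> verts G" "0 \<le> i" "i \<le> int t"
    using assms by (rule verts_SG_E)
  show ?thesis
    by (rule lift_cases[OF *(3,4), of u]) (simp_all add: * base_def v0)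
qed

lemma lift_base_lev:
  assumes "a \<in> verts SG"
  shows "lift (base a) (lev a) = a"
proof -
  obtain u i where *: "a = lift u i" "u \<in> verts G" "0 \<le> i" "i \<le> int t"
    using assms by (rule verts_SG_E)
  show ?thesis
    by (rule lift_cases[OF *(3,4), of u]) (simp_all add: * base_def lev_def lift_mid)
qed

lemma lev_lipschitz: "\<lbrakk>near SG a b; a \<in> verts SG\<rbrakk> \<Longrightarrow> \<bar>lev a - lev b\<bar> \<le> 1"
  by (erule (1) near_SG_E) auto

text \<open>Two vertices of a \<open>k\<close>-cube are joined by at most \<open>k\<close> edges,
  each changing the height by at most one; the induction flips the first coordinate last. For
  \<open>k < t\<close> no cube can meet both poles.\<close>

lemma lev_cube: "\<lbrakk>\<sigma> \<in> cubes k SG; x \<in> cube_verts k; y \<in> cube_verts k\<rbrakk> \<Longrightarrow> \<bar>lev (\<sigma> x) - lev (\<sigma> y)\<bar> \<le> int k"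
proof (induction k arbitrary: \<sigma> x y)
  case (Suc k)
  obtain a x' where x: "x = a # x'" "a = 0 \<or> a = 1" "x' \<in> cube_verts k"
    using Suc.prems(2) by (rule cube_verts_SucE)
  obtain b y' where y: "y = b # y'" "b = 0 \<or> b = 1" "y' \<in> cube_verts k"
    using Suc.prems(3) by (rule cube_verts_SucE)
  have f: "face (Suc k) 1 a \<sigma> \<in> cubes k SG"
    using face_in_cubes[OF Suc.prems(1) _ x(2), of 1] by simp
  have "face (Suc k) 1 a \<sigma> w = \<sigma> (a # w)" if "w \<in> cube_verts k" for w
    using that by (simp add: face_ins)
  then have "\<bar>lev (\<sigma> x) - lev (\<sigma> (a # y'))\<bar> \<le> int k"
    using Suc.IH[OF f x(3) y(3)] x(1,3) y(3) by simp
  moreover have "a = b \<or> nbr (a # y') y" using x y by (auto simp: nbr_Cons)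
  then have "near SG (\<sigma> (a # y')) (\<sigma> y)"
    using cubesD(3)[OF Suc.prems(1)] x y by auto
  then have "\<bar>lev (\<sigma> (a # y')) - lev (\<sigma> y)\<bar> \<le> 1"
    using cubesD(2)[OF Suc.prems(1)] x y by (intro lev_lipschitz) simp_all
  ultimately show ?case by simp
qed simp

section \<open>Vertical deformations; contracting the cones and a meridian\<close>

subsection \<open>Moving vertices vertically\<close>

text \<open>At a pole the \<open>G\<close>-coordinate is lost, so moving a pole would send it to the
  meridian of \<open>v0\<close>, possibly far from the images of its neighbours. Hence the later
  requirement that \<open>\<theta>\<close> fix each pole that is present.\<close>

definition move :: "(int \<Rightarrow> int) \<Rightarrow> 'a svert \<Rightarrow> 'a svert" where
  "move \<theta> a = lift (base a) (\<theta> (lev a))"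

lemma move_lift:
  assumes "0 \<le> i" "i \<le> int t" "lift u i = South \<Longrightarrow> \<theta> 0 = 0" "lift u i = North \<Longrightarrow> \<theta> (int t) = int t"
  shows "move \<theta> (lift u i) = lift u (\<theta> i)"
  using assms(1,2) by (rule lift_cases[of i u]) (use assms(3,4) in \<open>auto simp: move_def lev_def base_def\<close>)

lemma move_near:
  assumes "near SG a b" "a \<in> verts SG" "a \<in> A" "b \<in> A"
    "South \<in> A \<Longrightarrow> \<theta> 0 = 0" "North \<in> A \<Longrightarrow> \<theta> (int t) = int t"
    and \<theta>: "\<And>i. \<lbrakk>0 \<le> i; i \<le> int t\<rbrakk> \<Longrightarrow> 0 \<le> \<theta> i \<and> \<theta> i \<le> int t" "\<And>i j. \<bar>i - j\<bar> \<le> 1 \<Longrightarrow> \<bar>\<theta> i - \<theta> j\<bar> \<le> 1"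
  shows "near SG (move \<theta> a) (move \<theta> b)"
  using assms(1,2)
proof (rule near_SG_E)
  fix u v i j
  assume *: "a = lift u i" "b = lift v j" "u \<in> verts G" "v \<in> verts G"
    "0 \<le> i" "i \<le> int t" "0 \<le> j" "j \<le> int t" "u = v \<and> \<bar>i - j\<bar> \<le> 1 \<or> i = j \<and> near G u v"
  have "move \<theta> a = lift u (\<theta> i)" "move \<theta> b = lift v (\<theta> j)"
    using * assms(3-6) by (auto intro!: move_lift)
  then show ?thesis
    using * \<theta> near_vertical[of u "\<theta> i" "\<theta> j"] near_horizontal[of u v "\<theta> i"] by auto
qed

lemma move_homotopy:
  fixes \<theta> :: "nat \<Rightarrow> int \<Rightarrow> int"
  assumes "\<And>s. South \<in> A \<Longrightarrow> \<theta> s 0 = 0" "\<And>s. North \<in> A \<Longrightarrow> \<theta> s (int t) = int t"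
    and range: "\<And>s i. \<lbrakk>0 \<le> i; i \<le> int t\<rbrakk> \<Longrightarrow> 0 \<le> \<theta> s i \<and> \<theta> s i \<le> int t"
    and lip: "\<And>s i j. \<bar>i - j\<bar> \<le> 1 \<Longrightarrow> \<bar>\<theta> s i - \<theta> s j\<bar> \<le> 1"
    and step: "\<And>s i. \<bar>\<theta> s i - \<theta> (Suc s) i\<bar> \<le> 1"
  shows "homotopy (induced SG A) SG (\<lambda>s. move (\<theta> s)) 0 n"
  unfolding homotopy_def gmap_def
proof (intro conjI ballI impI)
  fix s a assume "a \<in> verts (induced SG A)"
  then show "move (\<theta> s) a \<in> verts SG"
    using range lev_range[of a] by (auto simp: move_def base_in_verts intro!: lift_in_verts)
next
  fix s a b assume "a \<in> verts (induced SG A)" "b \<in> verts (induced SG A)" "adj (induced SG A) a b"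
  then show "near SG (move (\<theta> s) a) (move (\<theta> s) b)"
    using assms(1,2) by (intro move_near[of a b A] range lip) (auto simp: near_def induced_def)
next
  fix s a assume "a \<in> verts (induced SG A)"
  then have a: "a \<in> verts SG" by simp
  show "near SG (move (\<theta> s) a) (move (\<theta> (Suc s)) a)" "near SG (move (\<theta> (Suc s)) a) (move (\<theta> s) a)"
    unfolding move_def using range lev_range[OF a] step[of s "lev a"] abs_minus_commute[of "\<theta> s (lev a)"]
    by (auto intro!: near_vertical base_in_verts a)
qed simp

text \<open>Removing the north pole leaves a cone: lowering heights one unit at a time fixes the
  south pole and has brought everything there after \<open>t\<close> steps.\<close>

lemma lower_cycle:
  assumes "1 \<le> k" "cycle k (induced SG (- {North})) z"
  shows "homologous k SG z 0"
proof (rule contractible_cycle[OF assms(1) _ assms(2)])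
  show "homotopy (induced SG (- {North})) SG (\<lambda>s. move (\<lambda>i. max 0 (i - int s))) 0 t"
    by (rule move_homotopy) auto
  show "move (\<lambda>i. max 0 (i - int 0)) v = v" if "v \<in> verts (induced SG (- {North}))" for v
    using that lev_range[of v] by (simp add: move_def lift_base_lev)
  show "move (\<lambda>i. max 0 (i - int t)) v = South" if "v \<in> verts (induced SG (- {North}))" for v
    using that lev_range[of v] by (simp add: move_def)
qed

lemma upper_cycle:
  assumes "1 \<le> k" "cycle k (induced SG (- {South})) z"
  shows "homologous k SG z 0"
proof (rule contractible_cycle[OF assms(1) _ assms(2)])
  show "homotopy (induced SG (- {South})) SG (\<lambda>s. move (\<lambda>i. min (int t) (i + int s))) 0 t"
    by (rule move_homotopy) auto
  show "move (\<lambda>i. min (int t) (i + int 0)) v = v" if "v \<in> verts (induced SG (- {South}))" for v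
    using that lev_range[of v] by (simp add: move_def lift_base_lev)
  show "move (\<lambda>i. min (int t) (i + int t)) v = North" if "v \<in> verts (induced SG (- {South}))" for v
    using that lev_range[of v] by (simp add: move_def)
qed

definition meridian :: "'a svert set" where
  "meridian = {lift v0 i | i. 0 \<le> i \<and> i \<le> int t}"

text \<open>The meridian contains both poles, so the condition of \<open>move_homotopy\<close> at
  the north pole forbids lowering it that way. But its vertices are determined by height alone, and
  lowering the height while keeping \<open>v0\<close> is a contraction.\<close>

lemma meridian_cycle:
  assumes "1 \<le> k" "cycle k (induced SG meridian) z"
  shows "homologous k SG z 0"
proof (rule contractible_cycle[OF assms(1) _ assms(2)])
  let ?h = "\<lambda>s a. lift v0 (max 0 (lev a - int s))"
  show "homotopy (induced SG meridian) SG ?h 0 t"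
    unfolding homotopy_def gmap_def
  proof (intro conjI ballI impI)
    fix s a assume a: "a \<in> verts (induced SG meridian)"
    then show "?h s a \<in> verts SG"
      using lev_range[of a] by (intro lift_in_verts v0) auto
    show "near SG (?h s a) (?h (Suc s) a)" "near SG (?h (Suc s) a) (?h s a)"
      using lev_range[of a] a by (auto intro!: near_vertical v0)
    fix b assume b: "b \<in> verts (induced SG meridian)" "adj (induced SG meridian) a b"
    then have "near SG a b" by (simp add: near_def induced_def)
    then show "near SG (?h s a) (?h s b)"
      using lev_range[of a] lev_range[of b] lev_lipschitz[of a b] a b by (intro near_vertical v0) auto
  qed simp
  show "?h 0 v = v" if "v \<in> verts (induced SG meridian)" for v
    using that by (auto simp: meridian_def)
  show "?h t v = South" if "v \<in> verts (induced SG meridian)" for v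
    using that lev_range[of v] by simp
qed

text \<open>The inclusions of the levels form a homotopy from the constant south pole to the
  constant north pole. The chain \<open>tower k level 0 t v\<close> is the suspension of
  \<open>v\<close>.\<close>

definition level :: "nat \<Rightarrow> 'a svert \<Rightarrow> 'a svert" where
  "level s u = lift u (int s)"

lemma level_homotopy: "homotopy G SG level 0 t"
  using wf unfolding homotopy_def gmap_def level_def wf_graph_def
  by (auto intro!: lift_in_verts near_vertical near_horizontal simp: near_def[of G])

lemma level_ne_North: "s < t \<Longrightarrow> level s u \<noteq> North"
  by (cases "s = 0") (simp_all add: level_def lift_mid)

lemma level_ne_South: "\<lbrakk>0 < s; s \<le> t\<rbrakk> \<Longrightarrow> level s u \<noteq> South"
  by (cases "s = t") (simp_all add: level_def lift_mid)

text \<open>Away from the poles vertical edges project to single vertices and horizontal ones to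
  edges; the value \<open>v0\<close> assigned at a pole could break this.\<close>

lemma base_gmap: "gmap (induced SG (- {South, North})) G base"
  unfolding gmap_def
proof (intro conjI ballI impI)
  fix a b assume "a \<in> verts (induced SG (- {South, North}))" "b \<in> verts (induced SG (- {South, North}))"
    "adj (induced SG (- {South, North})) a b"
  then have ab: "near SG a b" "a \<in> verts SG" and ne: "a \<notin> {South, North}" "b \<notin> {South, North}"
    by (auto simp: near_def induced_def)
  show "near G (base a) (base b)"
    using ab
  proof (rule near_SG_E)
    fix u v i j
    assume *: "a = lift u i" "b = lift v j" "0 \<le> i" "i \<le> int t" "0 \<le> j" "j \<le> int t"
      "u = v \<and> \<bar>i - j\<bar> \<le> 1 \<or> i = j \<and> near G u v"
    have "i \<noteq> 0" "i \<noteq> int t" "j \<noteq> 0" "j \<noteq> int t" using * ne by auto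
    then have "base a = u" "base b = v" using * by (simp_all add: lift_mid base_def)
    then show ?thesis using * by auto
  qed
qed (auto intro: base_in_verts)

text \<open>Push down only as far as level 1, so that the homotopy avoids both poles. The connecting
  chain then lies in either cone, as \<open>cycle_suspension\<close> requires.\<close>

lemma middle_homologous:
  assumes "1 \<le> k" and w: "cycle k (induced SG (- {South, North})) w"
  shows "homologous k (induced SG (- {South, North})) (push k (level 1) (push k base w)) w"
proof -
  let ?M = "- {South, North :: 'a svert}"
  let ?h = "\<lambda>s. move (\<lambda>i. max 1 (i - int s))"
  have mid: "lev a \<noteq> 0 \<and> lev a \<noteq> int t" if "a \<in> verts (induced SG ?M)" for a
    using that lift_base_lev[of a] by auto
  have "homotopy (induced SG ?M) SG ?h 0 t"
    using t by (intro move_homotopy) auto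
  then have "homotopy (induced SG ?M) (induced SG ?M) ?h 0 t"
  proof (rule homotopy_induced)
    fix s a assume a: "a \<in> verts (induced SG ?M)"
    then have "max 1 (lev a - int s) \<noteq> int t" using mid[OF a] lev_range[of a] t by auto
    moreover have "max 1 (lev a - int s) \<noteq> 0" by simp
    ultimately have "?h s a = Level (base a) (max 1 (lev a - int s))"
      unfolding move_def by (intro lift_mid)
    then show "?h s a \<in> ?M" by simp
  qed
  then have "homologous k (induced SG ?M) (push k (?h t) w) (push k (?h 0) w)"
    by (rule homotopy_homologous[OF assms(1) _ w])
  moreover have wc: "keys w \<subseteq> cubes k (induced SG ?M)" using w by (simp add: cycle_def)
  have "?h 0 a = a" if "a \<in> verts (induced SG ?M)" for a
    using that mid[OF that] lev_range[of a] by (simp add: move_def lift_base_lev max_def)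
  then have "push k (?h 0) w = w" by (rule push_id[OF wc])
  moreover have "push k (?h t) w = push k (\<lambda>a. level 1 (base a)) w"
  proof (rule push_cong[OF wc])
    fix a assume "a \<in> verts (induced SG ?M)"
    then show "?h t a = level 1 (base a)" using lev_range[of a] by (simp add: move_def level_def max_def)
  qed
  ultimately show ?thesis by (simp add: push_push)
qed

section \<open>Splitting a cycle between the two cones\<close>

subsection \<open>Every cycle of the suspension is a suspended cycle\<close>

text \<open>Cutting at level 1 works because \<open>t >= 2\<close>: levels 0 and 1 miss the north
  pole, and levels 1 to \<open>t\<close> miss the south pole.\<close>

lemma level_lower: "homotopy G (induced SG (- {North})) level 0 1"
  using t by (intro homotopy_induced[OF homotopy_restrict[OF level_homotopy]])
    (simp_all add: level_ne_North)

lemma level_upper: "homotopy G (induced SG (- {South})) level 1 t"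
  using t by (intro homotopy_induced[OF homotopy_restrict[OF level_homotopy]])
    (simp_all add: level_ne_South)

lemma level_South [simp]: "level 0 u = South"
  and level_North [simp]: "level t u = North"
  by (simp_all add: level_def)

lemma level_gmap: "s \<le> t \<Longrightarrow> gmap G SG (level s)"
  using level_homotopy by (simp add: homotopy_def)

lemma push_poles_degenerate:
  assumes "1 \<le> k" "keys c \<subseteq> cubes k G"
  shows "keys (push k (level 0) c) \<subseteq> degenerate_cubes k SG"
    "keys (push k (level t) c) \<subseteq> degenerate_cubes k SG"
  by (rule push_const_degenerate[OF assms(1) level_gmap assms(2)]; simp)+

lemma cycle_split:
  assumes "1 \<le> k" "Suc k < t" and z: "cycle (Suc k) SG z"
  obtains z1 z2 w where "z = z1 + z2" "keys z1 \<subseteq> cubes (Suc k) (induced SG (- {North}))"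
    "keys z2 \<subseteq> cubes (Suc k) (induced SG (- {South}))"
    "cycle k (induced SG (- {South, North})) w"
    "keys (bd (Suc k) z1 - w) \<subseteq> degenerate_cubes k SG"
    "keys (bd (Suc k) z2 + w) \<subseteq> degenerate_cubes k SG"
proof -
  let ?L = "induced SG (- {North})" and ?U = "induced SG (- {South})"
  let ?M = "induced SG (- {South, North})"
  have "cubes (Suc k) SG \<subseteq> cubes (Suc k) ?L \<union> cubes (Suc k) ?U"
  proof
    fix \<sigma> assume \<sigma>: "\<sigma> \<in> cubes (Suc k) SG"
    have "\<sigma> x \<noteq> South \<or> \<sigma> y \<noteq> North" if "x \<in> cube_verts (Suc k)" "y \<in> cube_verts (Suc k)" for x y
      using lev_cube[OF \<sigma> that] assms(2) by (auto simp: lev_def)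
    then show "\<sigma> \<in> cubes (Suc k) ?L \<union> cubes (Suc k) ?U"
      using \<sigma> unfolding cubes_induced by blast
  qed
  then have "keys z \<subseteq> cubes (Suc k) ?L \<union> cubes (Suc k) ?U"
    using z unfolding cycle_def by blast
  then obtain z1 z2 where z1: "keys z1 \<subseteq> cubes (Suc k) ?L" and z2: "keys z2 \<subseteq> cubes (Suc k) ?U"
    and zz: "z1 + z2 = z" by (rule frag_split)
  have b1: "keys (bd (Suc k) z1) \<subseteq> cubes k ?L" and b2: "keys (bd (Suc k) z2) \<subseteq> cubes k ?U"
    using bd_chain[OF _ z1] bd_chain[OF _ z2] by simp_all
  have sum: "keys (bd (Suc k) z1 + bd (Suc k) z2) \<subseteq> degenerate_cubes k SG"
    using z by (simp add: cycle_def flip: bd_add zz)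
  \<comment> \<open>A nondegenerate cube in this boundary must be cancelled by the boundary of
    \<open>z2\<close>, since the sum is degenerate; so it lies in both cones and misses both
    poles.\<close>
  have "keys (bd (Suc k) z1) \<subseteq> degenerate_cubes k SG \<union> cubes k ?M"
  proof
    fix \<sigma> assume \<sigma>: "\<sigma> \<in> keys (bd (Suc k) z1)"
    show "\<sigma> \<in> degenerate_cubes k SG \<union> cubes k ?M"
    proof (cases "\<sigma> \<in> degenerate_cubes k SG")
      case False
      then have "\<sigma> \<notin> keys (bd (Suc k) z1 + bd (Suc k) z2)" using sum by blast
      then have "\<sigma> \<in> keys (bd (Suc k) z2)"
        using \<sigma> by (auto simp: in_keys_iff lookup_add)
      then have "\<sigma> \<in> cubes k ?L \<inter> cubes k ?U" using b1 b2 \<sigma> by blast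
      then show ?thesis unfolding cubes_induced by blast
    qed simp
  qed
  then obtain d w where d: "keys d \<subseteq> degenerate_cubes k SG" and w: "keys w \<subseteq> cubes k ?M"
    and dw: "d + w = bd (Suc k) z1" by (rule frag_split)
  \<comment> \<open>The two parts of a boundary have opposite boundaries, and that of
    \<open>d\<close> is degenerate.\<close>
  have "bd k w = - bd k d"
    using bd_bd[OF assms(1), of z1] unfolding dw[symmetric] bd_add by (simp add: eq_neg_iff_add_eq_0 add.commute)
  then have cw: "cycle k ?M w"
    using bd_degenerate[OF assms(1) d] by (intro cycle_induced assms(1) w) (simp add: keys_minus)
  have "bd (Suc k) z1 - w = d" by (simp flip: dw)
  then have e1: "keys (bd (Suc k) z1 - w) \<subseteq> degenerate_cubes k SG" using d by simp
  have "bd (Suc k) z2 + w = (bd (Suc k) z1 + bd (Suc k) z2) - d" by (simp flip: dw)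
  then have "keys (bd (Suc k) z2 + w) \<subseteq> degenerate_cubes k SG"
    using keys_diff_subset[OF sum d] by (simp only:)
  then show ?thesis by (rule that[OF zz[symmetric] z1 z2 cw e1])
qed

lemma cycle_suspension:
  assumes k: "1 \<le> k" "Suc k < t" and z: "cycle (Suc k) SG z"
  shows "\<exists>v. cycle k G v \<and> homologous (Suc k) SG z (tower k level 0 t v)"
proof -
  let ?L = "induced SG (- {North})" and ?U = "induced SG (- {South})"
  let ?M = "induced SG (- {South, North})"
  obtain z1 z2 w where zz: "z = z1 + z2" and z1: "keys z1 \<subseteq> cubes (Suc k) ?L"
    and z2: "keys z2 \<subseteq> cubes (Suc k) ?U" and w: "cycle k ?M w"
    and b1: "keys (bd (Suc k) z1 - w) \<subseteq> degenerate_cubes k SG"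
    and b2: "keys (bd (Suc k) z2 + w) \<subseteq> degenerate_cubes k SG"
    using cycle_split[OF k z] .
  define v where "v = push k base w"
  have v: "cycle k G v" unfolding v_def by (rule push_cycle[OF k(1) base_gmap w])
  then have vc: "keys v \<subseteq> cubes k G" and vb: "keys (bd k v) \<subseteq> degenerate_cubes (k - 1) G"
    by (simp_all add: cycle_def)
  obtain u where u: "keys u \<subseteq> cubes (Suc k) ?M"
    and bu: "keys (push k (level 1) v - w - bd (Suc k) u) \<subseteq> degenerate_cubes k ?M"
    using middle_homologous[OF k(1) w] unfolding v_def homologous_def by blast
  have bu': "keys (push k (level 1) v - w - bd (Suc k) u) \<subseteq> degenerate_cubes k SG"
    using bu unfolding degenerate_induced by blast
  have tw: "keys (tower (k - 1) level a b (bd k v)) \<subseteq> degenerate_cubes k SG"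
    if "a \<le> b" "b \<le> t" for a b
    using tower_degenerate[OF homotopy_restrict[OF level_homotopy] vb, of a b] that k(1) by simp
  \<comment> \<open>Modulo degenerate chains \<open>z1\<close> has boundary \<open>w\<close>,
    \<open>u\<close> leads from \<open>w\<close> to level 1 of \<open>v\<close>, and the lower part
    of the suspension of \<open>v\<close> has that same level as boundary, its south end being
    degenerate. So \<open>y1\<close> is a cycle in the lower cone; \<open>y2\<close> is its
    counterpart above, and their sum is \<open>z\<close> minus the suspension.\<close>
  define y1 where "y1 = z1 + u - tower k level 0 1 v"
  define y2 where "y2 = z2 - u - tower k level 1 t v"
  have "cycle (Suc k) ?L y1"
  proof (rule cycle_induced)
    have "keys u \<subseteq> cubes (Suc k) ?L" using u unfolding cubes_induced by blast
    then show "keys y1 \<subseteq> cubes (Suc k) ?L"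
      unfolding y1_def by (intro keys_add_subset keys_diff_subset z1 tower_chain[OF level_lower vc])
    have "bd (Suc k) y1 = (bd (Suc k) z1 - w) - (push k (level 1) v - w - bd (Suc k) u)
        + push k (level 0) v + tower (k - 1) level 0 1 (bd k v)"
      using bd_tower[OF k(1), of 0 1 level v] by (simp add: y1_def bd_diff bd_add)
    also have "keys \<dots> \<subseteq> degenerate_cubes k SG"
      using t by (intro keys_add_subset keys_diff_subset b1 bu' push_poles_degenerate k vc tw) simp_all
    finally show "keys (bd (Suc k) y1) \<subseteq> degenerate_cubes (Suc k - 1) SG" by simp
  qed simp
  then have y1: "homologous (Suc k) SG y1 0" by (intro lower_cycle) simp_all
  have "cycle (Suc k) ?U y2"
  proof (rule cycle_induced)
    have "keys u \<subseteq> cubes (Suc k) ?U" using u unfolding cubes_induced by blast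
    then show "keys y2 \<subseteq> cubes (Suc k) ?U"
      unfolding y2_def by (intro keys_diff_subset z2 tower_chain[OF level_upper vc])
    have "bd (Suc k) y2 = (bd (Suc k) z2 + w) + (push k (level 1) v - w - bd (Suc k) u)
        - push k (level t) v + tower (k - 1) level 1 t (bd k v)"
      using bd_tower[OF k(1), of 1 t level v] t by (simp add: y2_def bd_diff bd_add)
    also have "keys \<dots> \<subseteq> degenerate_cubes k SG"
      using t by (intro keys_add_subset keys_diff_subset b2 bu' push_poles_degenerate k vc tw) simp_all
    finally show "keys (bd (Suc k) y2) \<subseteq> degenerate_cubes (Suc k - 1) SG" by simp
  qed simp
  then have y2: "homologous (Suc k) SG y2 0" by (intro upper_cycle) simp_all
  have "z = (y1 + y2) + tower k level 0 t v"
    using t by (simp add: y1_def y2_def zz tower_split[of 0 1 t])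
  moreover have "homologous (Suc k) SG ((y1 + y2) + tower k level 0 t v) ((0 + 0) + tower k level 0 t v)"
    by (intro homologous_add y1 y2 homologous_refl)
  ultimately show ?thesis using v by auto
qed

text \<open>Suspending reverses the sign of a boundary, hence the minus in the witness; the copies
  of \<open>u\<close> at the two poles are degenerate.\<close>

lemma tower_homologous:
  assumes "1 \<le> k" "homologous k G v v'"
  shows "homologous (Suc k) SG (tower k level 0 t v) (tower k level 0 t v')"
proof -
  obtain u where u: "keys u \<subseteq> cubes (Suc k) G"
    and d: "keys (v - v' - bd (Suc k) u) \<subseteq> degenerate_cubes k G"
    using assms(2) by (auto simp: homologous_def)
  show ?thesis
  proof (rule homologousI)
    show "keys (- tower (Suc k) level 0 t u) \<subseteq> cubes (Suc (Suc k)) SG"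
      using tower_chain[OF level_homotopy u] by (simp add: keys_minus)
    have "tower k level 0 t v - tower k level 0 t v' - bd (Suc (Suc k)) (- tower (Suc k) level 0 t u)
        = tower k level 0 t (v - v' - bd (Suc k) u) + push (Suc k) (level t) u - push (Suc k) (level 0) u"
      using bd_tower[of "Suc k" 0 t level u] by (simp add: bd_minus tower_diff)
    also have "keys \<dots> \<subseteq> degenerate_cubes (Suc k) SG"
      using push_poles_degenerate[OF _ u]
      by (intro keys_add_subset keys_diff_subset tower_degenerate[OF level_homotopy d]) simp_all
    finally show "keys (tower k level 0 t v - tower k level 0 t v'
        - bd (Suc (Suc k)) (- tower (Suc k) level 0 t u)) \<subseteq> degenerate_cubes (Suc k) SG" .
  qed
qed

section \<open>Suspension of a grid map, closed up along a meridian\<close>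

subsection \<open>Suspending a grid map\<close>

text \<open>The distance in the \<open>l1\<close> metric from the box \<open>[-r, r]^k\<close>; it
  changes by at most one along an edge of the grid.\<close>

definition excess :: "int \<Rightarrow> int list \<Rightarrow> int" where
  "excess r x = (\<Sum>a\<leftarrow>x. max 0 (\<bar>a\<bar> - r))"

lemma excess_nonneg: "0 \<le> excess r x"
  by (induction x) (auto simp: excess_def)

lemma excess_ge: "a \<in> set x \<Longrightarrow> \<bar>a\<bar> - r \<le> excess r x"
proof (induction x)
  case (Cons b x)
  then show ?case using excess_nonneg[of r x] by (auto simp: excess_def)
qed simp

lemma excess_0: "(\<And>a. a \<in> set x \<Longrightarrow> \<bar>a\<bar> \<le> r) \<Longrightarrow> excess r x = 0"
  by (induction x) (auto simp: excess_def)

lemma excess_nbr: "nbr x y \<Longrightarrow> \<bar>excess r x - excess r y\<bar> \<le> 1"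
  by (induction rule: nbr.induct) (auto simp: excess_def)

text \<open>Along the first coordinate \<open>s\<close>, run up to the north pole through \<open>F x\<close> and back down through
  \<open>v0\<close>; outside the support of \<open>F\<close>, where this traces the meridian of \<open>v0\<close> back and forth, the
  height is gradually capped off, so that the map becomes constantly the south pole.\<close>

definition height :: "int \<Rightarrow> int \<Rightarrow> int list \<Rightarrow> int" where
  "height r s x = max 0 (min (min s (2 * int t - s)) (int t - excess r x))"

definition suspend :: "int \<Rightarrow> (int list \<Rightarrow> 'a svert) \<Rightarrow> int list \<Rightarrow> 'a svert" where
  "suspend r F z = lift (if hd z \<ge> int t then v0 else F (tl z)) (height r (hd z) (tl z))"

lemma height_range: "0 \<le> height r s x" "height r s x \<le> int t"
  using excess_nonneg[of r x] by (auto simp: height_def)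

context
  fixes k :: nat and F :: "int list \<Rightarrow> 'a svert" and r :: int
  assumes F: "grid_map k G F" and out: "const_outside k v0 r F" and r: "0 \<le> r"
begin

lemma suspend_down: "int t \<le> s \<Longrightarrow> suspend r F (s # x) = lift v0 (height r s x)"
  by (simp add: suspend_def)

lemma F_outside: "\<lbrakk>length x = k; F x \<noteq> v0; a \<in> set x\<rbrakk> \<Longrightarrow> \<bar>a\<bar> < r"
  using const_outsideD[OF out, of x a] by force

text \<open>The definition changes to \<open>v0\<close> already at \<open>s = t\<close>. There the
  two prescriptions agree: where \<open>F x\<close> differs from \<open>v0\<close> the excess is
  zero and the height is \<open>t\<close>, so both give the north pole.\<close>

lemma suspend_up:
  assumes "s \<le> int t" "length x = k"
  shows "suspend r F (s # x) = lift (F x) (height r s x)"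
proof (cases "s < int t \<or> F x = v0")
  case False
  then have "excess r x = 0" using F_outside[of x] assms by (intro excess_0) (simp add: less_imp_le)
  then have "height r s x = int t" using False assms by (simp add: height_def)
  then show ?thesis by (simp add: suspend_def)
qed (auto simp: suspend_def)

lemma suspend_inside:
  assumes "0 \<le> s" "s \<le> int t" "length x = k" "\<And>a. a \<in> set x \<Longrightarrow> \<bar>a\<bar> \<le> r"
  shows "suspend r F (s # x) = lift (F x) s"
proof -
  have "height r s x = s" using excess_0[OF assms(4)] assms by (simp add: height_def)
  then show ?thesis using suspend_up[OF assms(2,3)] by simp
qed

lemma suspend_meridian:
  assumes "length x = k" "s \<le> 0 \<or> int t \<le> s \<or> (\<exists>a\<in>set x. r \<le> \<bar>a\<bar>)"
  shows "suspend r F (s # x) \<in> meridian"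
proof -
  have "suspend r F (s # x) = lift v0 (height r s x)"
  proof (cases "int t \<le> s")
    case False
    show ?thesis
    proof (cases "s \<le> 0")
      case True
      then have "height r s x = 0" by (simp add: height_def)
      then show ?thesis by (simp add: suspend_def)
    next
      case s: False
      then have "F x = v0" using assms False by (auto intro: const_outsideD[OF out])
      then show ?thesis by (simp add: suspend_def)
    qed
  qed (rule suspend_down)
  then show ?thesis using height_range unfolding meridian_def by blast
qed

lemma suspend_grid_map: "grid_map (Suc k) SG (suspend r F)"
  unfolding grid_map_def
proof (intro conjI allI impI)
  fix z :: "int list" assume z: "length z = Suc k"
  then show "suspend r F z \<in> verts SG"
    unfolding suspend_def using grid_mapD(1)[OF F, of "tl z"] v0
    by (intro lift_in_verts height_range) simp
  fix z' assume zz: "nbr z z'"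
  obtain s x where zs: "z = s # x" and x: "length x = k" using z by (cases z) auto
  obtain s' x' where zs': "z' = s' # x'" and x': "length x' = k"
    using z nbr_length[OF zz] by (cases z') auto
  show "near SG (suspend r F z) (suspend r F z')"
  proof (cases "x = x'")
    case True
    then have s: "\<bar>s - s'\<bar> = 1" using zz zs zs' by (simp add: nbr_Cons nbr_irrefl)
    have h: "\<bar>height r s x - height r s' x\<bar> \<le> 1" using s unfolding height_def by arith
    \<comment> \<open>As \<open>s\<close> and \<open>s'\<close> differ by one, they lie on the same
      side of \<open>t\<close>, and one of the two formulas covers both.\<close>
    have "s \<le> int t \<and> s' \<le> int t \<or> int t \<le> s \<and> int t \<le> s'" using s by linarith
    then show ?thesis
      using h x True grid_mapD(1)[OF F x] v0 unfolding zs zs'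
      by (auto simp: suspend_up suspend_down intro!: near_vertical height_range)
  next
    case False
    then have n: "nbr x x'" and s: "s = s'" using zz zs zs' by (auto simp: nbr_Cons)
    have h: "\<bar>height r s x - height r s x'\<bar> \<le> 1"
      using excess_nbr[OF n, of r] unfolding height_def by arith
    show ?thesis
    proof (cases "int t \<le> s \<or> F x = F x'")
      case True
      then show ?thesis
        using h x x' s grid_mapD(1)[OF F x] v0 unfolding zs zs'
        by (cases "int t \<le> s") (auto simp: suspend_up suspend_down intro!: near_vertical height_range)
    next
      case ne: False
      \<comment> \<open>Where \<open>F\<close> differs from \<open>v0\<close> all coordinates are
        strictly below \<open>r\<close> in absolute value, so at neighbouring points they are at
        most \<open>r\<close>. The cap on the height starts only beyond \<open>r\<close>; a change
        of the \<open>G\<close>-coordinate thus never coincides with a change of height.\<close>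
      have close: "excess r y = 0" if y: "length y = k" "length y' = k" "nbr y y'" "F y' \<noteq> v0" for y y'
      proof (rule excess_0)
        fix a assume "a \<in> set y"
        then obtain b where "b \<in> set y'" "\<bar>a - b\<bar> \<le> 1" using nbr_close[OF y(3)] by blast
        then show "\<bar>a\<bar> \<le> r" using F_outside[OF y(2,4), of b] by linarith
      qed
      have inside: "excess r y = 0" if "length y = k" "F y \<noteq> v0" for y
        using F_outside[OF that] by (intro excess_0) (simp add: less_imp_le)
      have "excess r x = 0 \<and> excess r x' = 0"
        using ne inside[OF x] inside[OF x'] close[OF x x' n] close[OF x' x nbr_sym[OF n]] by metis
      then have "height r s x = height r s x'" by (simp add: height_def)
      then show ?thesis
        using ne x x' s grid_mapD[OF F x] grid_mapD(1)[OF F x'] n unfolding zs zs'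
        by (simp add: suspend_up) (intro near_horizontal height_range, simp_all)
    qed
  qed
qed

text \<open>The height is zero for \<open>s <= 0\<close>, for \<open>s >= 2t\<close>, and once the
  excess reaches \<open>t\<close>, which happens when some other coordinate has absolute value at
  least \<open>r + t\<close>. The radius \<open>r + 2t\<close> covers all cases.\<close>

lemma suspend_const_outside: "const_outside (Suc k) South (r + 2 * int t) (suspend r F)"
  unfolding const_outside_def
proof (intro allI impI)
  fix z :: "int list" assume z: "length z = Suc k" "\<exists>a\<in>set z. r + 2 * int t \<le> \<bar>a\<bar>"
  obtain s x where zs: "z = s # x" using z by (cases z) auto
  have "r + 2 * int t \<le> \<bar>s\<bar> \<or> (\<exists>a\<in>set x. r + 2 * int t \<le> \<bar>a\<bar>)" using z(2) zs by simp
  then have "height r s x = 0"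
  proof
    assume "\<exists>a\<in>set x. r + 2 * int t \<le> \<bar>a\<bar>"
    then obtain a where "a \<in> set x" "r + 2 * int t \<le> \<bar>a\<bar>" by blast
    then show ?thesis using excess_ge[of a x r] by (simp add: height_def)
  qed (use r in \<open>auto simp: height_def\<close>)
  then show "suspend r F z = South" by (simp add: suspend_def zs)
qed

text \<open>For \<open>s\<close> in \<open>[0, t]\<close> and \<open>x\<close> in
  \<open>[-r, r]^k\<close> the height is just \<open>s\<close>, so on this block
  \<open>suspend\<close> is the plain suspension and the chains agree cube by cube.\<close>

lemma tower_box_sum:
  "tower k level 0 t (box_sum k (- r) r F)
    = (\<Sum>X\<in>(\<lambda>(s, x). s # x) ` ({0..<int t} \<times> int_box k (- r) r). frag_of (subcube (Suc k) (suspend r F) X))"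
proof -
  have cyl: "cyl k (post k (level s) (subcube k F x)) (post k (level (Suc s)) (subcube k F x))
      = subcube (Suc k) (suspend r F) (int s # x)" if s: "s < t" and x: "x \<in> int_box k (- r) r" for s x
  proof
    fix z
    show "cyl k (post k (level s) (subcube k F x)) (post k (level (Suc s)) (subcube k F x)) z
        = subcube (Suc k) (suspend r F) (int s # x) z"
    proof (cases "z \<in> cube_verts (Suc k)")
      case True
      then obtain e y where z: "z = e # y" "e = 0 \<or> e = 1" and y: "y \<in> cube_verts k"
        by (rule cube_verts_SucE)
      have len: "length (map2 (+) x y) = k" using x y by (simp add: int_box_length cube_verts_length)
      have "\<bar>b\<bar> \<le> r" if mem: "b \<in> set (map2 (+) x y)" for b
      proof -
        obtain i where "i < length (map2 (+) x y)" "b = map2 (+) x y ! i"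
          using mem by (metis in_set_conv_nth)
        then have b: "b = x ! i + y ! i" "x ! i \<in> set x" "y ! i \<in> set y" by simp_all
        have "set x \<subseteq> {- r..<r}" "set y \<subseteq> {0..int 1}"
          using x y by (simp_all add: int_box_def verts_box)
        then have "x ! i \<in> {- r..<r}" "y ! i \<in> {0..int 1}" using b(2,3) by (auto dest: subsetD)
        then show ?thesis using b(1) by auto
      qed
      then have "suspend r F ((int s + e) # map2 (+) x y) = lift (F (map2 (+) x y)) (int s + e)"
        using s z len by (intro suspend_inside) auto
      then show ?thesis using z y
        by (auto simp: cyl_def post_def subcube_def level_def add.commute)
    qed (simp add: cyl_def subcube_def)
  qed
  have "tower k level 0 t (box_sum k (- r) r F)
      = (\<Sum>s\<in>{0..<t}. \<Sum>x\<in>int_box k (- r) r. frag_of (subcube (Suc k) (suspend r F) (int s # x)))"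
    unfolding tower_def box_sum_def prism_sum prism_of by (intro sum.cong refl) (simp add: cyl)
  also have "\<dots> = (\<Sum>s\<in>{0..<int t}. \<Sum>x\<in>int_box k (- r) r. frag_of (subcube (Suc k) (suspend r F) (s # x)))"
    by (rule sum.reindex_bij_witness[of _ nat int]) auto
  also have "\<dots> = (\<Sum>X\<in>(\<lambda>(s, x). s # x) ` ({0..<int t} \<times> int_box k (- r) r). frag_of (subcube (Suc k) (suspend r F) X))"
    unfolding sum.cartesian_product
    by (subst sum.reindex) (auto simp: inj_on_def intro!: sum.cong)
  finally show ?thesis .
qed

lemma suspend_homologous:
  assumes "1 \<le> k"
  shows "homologous (Suc k) SG (tower k level 0 t (box_sum k (- r) r F))
    (box_sum (Suc k) (- (r + 2 * int t)) (r + 2 * int t) (suspend r F))"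
proof -
  let ?R = "r + 2 * int t"
  let ?I = "(\<lambda>(s, x). s # x) ` ({0..<int t} \<times> int_box k (- r) r)"
  let ?E = "box_sum (Suc k) (- ?R) ?R (suspend r F) - tower k level 0 t (box_sum k (- r) r F)"
  have I: "?I \<subseteq> int_box (Suc k) (- ?R) ?R" 
  proof clarify
    fix s x assume *: "s \<in> {0..<int t}" "x \<in> int_box k (- r) r"
    have "set x \<subseteq> {- r..<r}" using *(2) by (simp add: int_box_def)
    also have "\<dots> \<subseteq> {- ?R..<?R}" by auto
    finally show "s # x \<in> int_box (Suc k) (- ?R) ?R" using * r by (auto simp: int_box_def)
  qed
  have E: "?E = (\<Sum>X\<in>int_box (Suc k) (- ?R) ?R - ?I. frag_of (subcube (Suc k) (suspend r F) X))"
    unfolding tower_box_sum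
    using sum.subset_diff[OF I, of "\<lambda>X. frag_of (subcube (Suc k) (suspend r F) X)"]
    by (simp add: box_sum_def)
  have "cycle (Suc k) (induced SG meridian) ?E"
  proof (rule cycle_induced)
    show "keys ?E \<subseteq> cubes (Suc k) (induced SG meridian)"
      unfolding E
    proof (intro keys_sum_subset)
      fix X assume X: "X \<in> int_box (Suc k) (- ?R) ?R - ?I"
      then have "length X = Suc k" by (simp add: int_box_def)
      then obtain s x where sx: "X = s # x" and x: "length x = k" by (cases X) auto
      have "\<not> (s \<in> {0..<int t} \<and> x \<in> int_box k (- r) r)" using X sx by auto
      \<comment> \<open>A unit cube with such a lowest corner lies wholly in \<open>s <= 0\<close>
        or in \<open>s >= t\<close>, or each of its corners has a further coordinate of absolute
        value at least \<open>r\<close>.\<close>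
      then have *: "s < 0 \<or> int t \<le> s \<or> (\<exists>a\<in>set x. a < - r \<or> r \<le> a)"
        using x unfolding int_box_def by (simp add: subset_iff) (meson not_le)
      have "subcube (Suc k) (suspend r F) X z \<in> meridian" if "z \<in> cube_verts (Suc k)" for z
        using that
      proof (rule cube_verts_SucE)
        fix e y assume z: "z = e # y" "e = 0 \<or> e = 1" and y: "y \<in> cube_verts k"
        have len: "length (map2 (+) x y) = k" using x y by (simp add: cube_verts_length)
        have "\<exists>b\<in>set (map2 (+) x y). r \<le> \<bar>b\<bar>" if "a \<in> set x" "a < - r \<or> r \<le> a" for a
          using map2_add_mem[OF x y that(1)]
        proof
          assume "a \<in> set (map2 (+) x y)"
          moreover have "r \<le> \<bar>a\<bar>" using that(2) by linarith
          ultimately show ?thesis by (rule bexI[rotated])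
        next
          assume "a + 1 \<in> set (map2 (+) x y)"
          moreover have "r \<le> \<bar>a + 1\<bar>" using that(2) by linarith
          ultimately show ?thesis by (rule bexI[rotated])
        qed
        then have "s + e \<le> 0 \<or> int t \<le> s + e \<or> (\<exists>b\<in>set (map2 (+) x y). r \<le> \<bar>b\<bar>)"
          using * z(2) by fastforce
        then have "suspend r F ((s + e) # map2 (+) x y) \<in> meridian"
          by (rule suspend_meridian[OF len])
        then show ?thesis using z y by (auto simp: subcube_def sx)
      qed
      then show "keys (frag_of (subcube (Suc k) (suspend r F) X)) \<subseteq> cubes (Suc k) (induced SG meridian)"
        using subcube_in_cubes[OF suspend_grid_map \<open>length X = Suc k\<close>] by (simp add: cubes_induced)
    qed
    \<comment> \<open>Both box sums have zero boundary, so only the copies at the two poles remain,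
      and these are degenerate.\<close>
    have "bd (Suc k) (box_sum (Suc k) (- ?R) ?R (suspend r F)) = 0"
      using r by (intro bd_box_sum[OF suspend_const_outside]) simp_all
    moreover have "bd k (box_sum k (- r) r F) = 0"
      using r by (intro bd_box_sum[OF out]) simp_all
    then have "bd (Suc k) (tower k level 0 t (box_sum k (- r) r F))
        = push k (level t) (box_sum k (- r) r F) - push k (level 0) (box_sum k (- r) r F)"
      using bd_tower[OF assms, of 0 t level "box_sum k (- r) r F"] by (simp add: tower_def)
    ultimately have "bd (Suc k) ?E
        = push k (level 0) (box_sum k (- r) r F) - push k (level t) (box_sum k (- r) r F)"
      by (simp add: bd_diff)
    also have "keys \<dots> \<subseteq> degenerate_cubes k SG"
      by (intro keys_diff_subset push_poles_degenerate assms box_sum_chain F)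
    finally show "keys (bd (Suc k) ?E) \<subseteq> degenerate_cubes (Suc k - 1) SG" by simp
  qed simp
  then have "homologous (Suc k) SG ?E 0" by (intro meridian_cycle) simp_all
  from homologous_diff[OF homologous_refl this,
      of "box_sum (Suc k) (- ?R) ?R (suspend r F)"]
  show ?thesis by simp
qed

end

theorem cycle_spherical_Suc:
  assumes k: "1 \<le> k" "Suc k < t" and IH: "\<And>z. cycle k G z \<Longrightarrow> spherical k G v0 z"
    and z: "cycle (Suc k) SG z"
  shows "spherical (Suc k) SG South z"
proof -
  obtain v where v: "cycle k G v" and zv: "homologous (Suc k) SG z (tower k level 0 t v)"
    using cycle_suspension[OF k z] by blast
  obtain F r where F: "0 \<le> r" "grid_map k G F" "const_outside k v0 r F"
    and vF: "homologous k G v (box_sum k (- r) r F)"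
    using IH[OF v] by (auto simp: spherical_def)
  note zv
  also note tower_homologous[OF k(1) vF]
  also note suspend_homologous[OF F(2,3,1) k(1)]
  finally show ?thesis
    unfolding spherical_def
    using F suspend_grid_map[OF F(2,3)] suspend_const_outside[OF F(2,3,1)]
    by (intro exI[of _ "suspend r F"] exI[of _ "r + 2 * int t"]) simp
qed

end

section \<open>Passage to the quotient groups\<close>

section \<open>Homology classes\<close>

lemma chain_class_iff: "x \<in> chain_class k G c \<longleftrightarrow> keys (x - c) \<subseteq> degenerate_cubes k G"
proof -
  have "x \<in> chain_class k G c \<longleftrightarrow> (\<exists>d. keys d \<subseteq> degenerate_cubes k G \<and> x = d + c)"
    unfolding chain_class_def r_coset_def by auto
  also have "\<dots> \<longleftrightarrow> keys (x - c) \<subseteq> degenerate_cubes k G"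
    by (metis add_diff_cancel_right' diff_add_cancel)
  finally show ?thesis .
qed

lemma chain_class_eq_iff:
  "chain_class k G c = chain_class k G c' \<longleftrightarrow> keys (c - c') \<subseteq> degenerate_cubes k G"
proof
  have "c \<in> chain_class k G c" by (simp add: chain_class_iff)
  then show "chain_class k G c = chain_class k G c' \<Longrightarrow> keys (c - c') \<subseteq> degenerate_cubes k G"
    by (simp add: chain_class_iff)
next
  assume d: "keys (c - c') \<subseteq> degenerate_cubes k G"
  have "keys (x - c) \<subseteq> degenerate_cubes k G \<longleftrightarrow> keys (x - c') \<subseteq> degenerate_cubes k G" for x
    using keys_add_subset[OF _ d, of "x - c"] keys_diff_subset[OF _ d, of "x - c'"] by auto
  then show "chain_class k G c = chain_class k G c'"
    by (intro Set.set_eqI) (simp only: chain_class_iff)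
qed

lemma carrier_chain_group: "carrier (chain_group k G) = chain_class k G ` {c. keys c \<subseteq> cubes k G}"
  unfolding chain_group_def carrier_FactGroup chain_class_def by (simp add: free_Abelian_group_def)

lemma chain_class_mult:
  "chain_class k G a <#>\<^bsub>free_chains k G\<^esub> chain_class k G b = chain_class k G (a + b)"
proof (intro Set.set_eqI iffI)
  fix x assume "x \<in> chain_class k G a <#>\<^bsub>free_chains k G\<^esub> chain_class k G b"
  then obtain y z where yz: "y \<in> chain_class k G a" "z \<in> chain_class k G b" "x = y + z"
    unfolding set_mult_def by auto
  then have "x - (a + b) = (y - a) + (z - b)" by simp
  then show "x \<in> chain_class k G (a + b)"
    using yz(1,2) unfolding chain_class_iff by (simp only: keys_add_subset)
next
  fix x assume x: "x \<in> chain_class k G (a + b)"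
  then have "x - b \<in> chain_class k G a" "b \<in> chain_class k G b"
    by (simp_all add: chain_class_iff algebra_simps)
  then show "x \<in> chain_class k G a <#>\<^bsub>free_chains k G\<^esub> chain_class k G b"
    unfolding set_mult_def mult_free_Abelian_group by simp (metis diff_add_cancel)
qed

text \<open>The boundary of a degenerate chain is degenerate, so all representatives give one coset
  and \<open>the_elem\<close> is applied to a singleton.\<close>

lemma boundary_map_class:
  assumes "1 \<le> k"
  shows "boundary_map k G (chain_class k G c) = chain_class (k - 1) G (bd k c)"
proof -
  have "chain_class (k - 1) G (bd k x) = chain_class (k - 1) G (bd k c)" if "x \<in> chain_class k G c" for x
    using bd_degenerate[OF assms, of "x - c"] that by (simp add: chain_class_iff chain_class_eq_iff bd_diff)
  then have "(\<lambda>c. chain_class (k - 1) G (bd k c)) ` chain_class k G c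
      = (\<lambda>_. chain_class (k - 1) G (bd k c)) ` chain_class k G c"
    by (rule image_cong[OF refl])
  also have "\<dots> = {chain_class (k - 1) G (bd k c)}"
    by (rule image_constant[of c]) (simp add: chain_class_iff)
  finally have "(\<lambda>c. chain_class (k - 1) G (bd k c)) ` chain_class k G c = {chain_class (k - 1) G (bd k c)}" .
  then show ?thesis unfolding boundary_map_def bd_def by simp
qed

lemma one_chain_group: "\<one>\<^bsub>chain_group k G\<^esub> = chain_class k G 0"
  by (auto simp: chain_group_def chain_class_iff)

lemma carrier_cycle_group:
  assumes "1 \<le> k"
  shows "carrier (cycle_group k G) = chain_class k G ` {z. cycle k G z}"
proof -
  have "boundary_map k G (chain_class k G c) = \<one>\<^bsub>chain_group (k - 1) G\<^esub>
      \<longleftrightarrow> keys (bd k c) \<subseteq> degenerate_cubes (k - 1) G" for c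
    by (simp add: boundary_map_class[OF assms] one_chain_group chain_class_eq_iff)
  then show ?thesis
    unfolding cycle_group_def kernel_def carrier_chain_group cycle_def by simp blast
qed

text \<open>A homology class is literally a set of cosets. Listing it through
  \<open>homologous\<close> reduces equality of classes to symmetry and transitivity of a relation
  on chains.\<close>

lemma homology_class_eq:
  "cubical_homology_class k G c = chain_class k G ` {y. homologous k G y c}"
proof -
  have "boundaries k G = (\<lambda>u. chain_class k G (bd (Suc k) u)) ` {u. keys u \<subseteq> cubes (Suc k) G}"
    unfolding boundaries_def carrier_chain_group image_image by (simp add: boundary_map_class)
  then have "cubical_homology_class k G c
      = (\<lambda>u. chain_class k G (bd (Suc k) u + c)) ` {u. keys u \<subseteq> cubes (Suc k) G}"
    unfolding cubical_homology_class_def r_coset_def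
    by (auto simp: cycle_group_def chain_group_def chain_class_mult)
  also have "\<dots> = chain_class k G ` {y. homologous k G y c}"
  proof (intro Set.set_eqI iffI)
    fix X assume "X \<in> (\<lambda>u. chain_class k G (bd (Suc k) u + c)) ` {u. keys u \<subseteq> cubes (Suc k) G}"
    then obtain u where "keys u \<subseteq> cubes (Suc k) G" "X = chain_class k G (bd (Suc k) u + c)" by auto
    then show "X \<in> chain_class k G ` {y. homologous k G y c}"
      by (auto intro!: imageI homologousI[of u])
  next
    fix X assume "X \<in> chain_class k G ` {y. homologous k G y c}"
    then obtain y u where X: "X = chain_class k G y" and u: "keys u \<subseteq> cubes (Suc k) G"
      "keys (y - c - bd (Suc k) u) \<subseteq> degenerate_cubes k G"
      unfolding homologous_def by auto
    then have "X = chain_class k G (bd (Suc k) u + c)"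
      by (simp add: chain_class_eq_iff algebra_simps)
    then show "X \<in> (\<lambda>u. chain_class k G (bd (Suc k) u + c)) ` {u. keys u \<subseteq> cubes (Suc k) G}"
      using u by auto
  qed
  finally show ?thesis .
qed

lemma homologous_class_eq:
  assumes "homologous k G a b"
  shows "cubical_homology_class k G a = cubical_homology_class k G b"
proof -
  have "homologous k G y a \<longleftrightarrow> homologous k G y b" for y
    using assms homologous_sym homologous_trans by blast
  then show ?thesis unfolding homology_class_eq by simp
qed

lemma carrier_homology:
  assumes "1 \<le> k"
  shows "carrier (cubical_homology k G) = cubical_homology_class k G ` {z. cycle k G z}"
  unfolding cubical_homology_def carrier_FactGroup carrier_cycle_group[OF assms] image_image
    cubical_homology_class_def ..

section \<open>Box chains and based homotopy\<close>

section \<open>The Hurewicz map on classes\<close>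

lemma based_within_iff: "based_within k v r F \<longleftrightarrow> 0 \<le> r \<and> const_outside k v r F"
proof -
  have "(\<exists>i<k. r \<le> \<bar>x ! i\<bar>) \<longleftrightarrow> (\<exists>a\<in>set x. r \<le> \<bar>a\<bar>)" if "length x = k" for x
    using that by (metis in_set_conv_nth)
  then show ?thesis unfolding based_within_def const_outside_def verts_grid Ball_Collect by blast
qed

lemma based_maps_iff:
  "F \<in> based_maps k G v \<longleftrightarrow> F \<in> extensional (verts (grid k)) \<and> grid_map k G F \<and>
     (\<exists>r\<ge>0. const_outside k v r F)"
proof -
  have "length y = k" if "nbr x y" "length x = k" for x y
    using nbr_length[OF that(1)] that(2) by simp
  then have "F \<in> graph_maps (grid k) G \<longleftrightarrow> F \<in> extensional (verts (grid k)) \<and> grid_map k G F"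
    unfolding graph_maps_grid grid_map_def verts_grid PiE_def Pi_def by blast
  then show ?thesis unfolding based_maps_def based_within_iff by blast
qed

lemma subcube_cong:
  assumes "length x = k" "\<And>y. y \<in> cube_verts k \<Longrightarrow> F (map2 (+) x y) = F' (map2 (+) x y)"
  shows "subcube k F x = subcube k F' x"
  using assms by (simp add: subcube_def cong: restrict_cong)

lemma box_sum_cong:
  assumes "\<And>x. length x = k \<Longrightarrow> F x = F' x"
  shows "box_sum k lo hi F = box_sum k lo hi F'"
  unfolding box_sum_def
  by (intro sum.cong refl arg_cong[of _ _ frag_of] subcube_cong)
    (simp_all add: int_box_length cube_verts_length assms)

lemma box_chain_extend:
  assumes f: "f \<in> box_maps k m G v" and k: "1 \<le> k" and F: "grid_map k G (extend_box k m v f)"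
  shows "const_outside k v (int m) (extend_box k m v f)"
    "homologous k G (box_chain k m f) (box_sum k (- int m) (int m) (extend_box k m v f))"
proof -
  let ?F = "extend_box k m v f"
  \<comment> \<open>A point with such a coordinate lies either outside the box, where the extension
    is \<open>v\<close> by definition, or on its surface, where \<open>f\<close> is
    \<open>v\<close>.\<close>
  have out: "?F x = v" if x: "length x = k" "a \<in> set x" "a \<le> 0 \<or> int m \<le> a" for x a
  proof (cases "x \<in> verts (box k m)")
    case True
    then have "a = 0 \<or> a = int m" using x by (auto simp: verts_box)
    then have "\<exists>i<k. x ! i = 0 \<or> x ! i = int m" using x by (metis in_set_conv_nth)
    then have "f x = v" using f True by (auto simp: box_maps_def)
    then show ?thesis by (simp add: extend_box_def verts_grid x)
  qed (use x in \<open>simp add: extend_box_def verts_grid\<close>)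
  show "const_outside k v (int m) ?F"
    unfolding const_outside_def
  proof (intro allI impI)
    fix x :: "int list" assume x: "length x = k" "\<exists>a\<in>set x. int m \<le> \<bar>a\<bar>"
    then obtain a where a: "a \<in> set x" "int m \<le> \<bar>a\<bar>" by blast
    then have "a \<le> 0 \<or> int m \<le> a" by linarith
    then show "?F x = v" by (rule out[OF x(1) a(1)])
  qed
  have "box_chain k m f = box_sum k 0 (int m) ?F"
    unfolding box_chain_def box_sum_def int_box_def
  proof (intro sum.cong arg_cong[of _ _ frag_of])
    fix x assume "x \<in> {x. set x \<subseteq> {0..<int m} \<and> length x = k}"
    then have x: "set x \<subseteq> {0..<int m}" "length x = k" by auto
    show "subcube k f x = subcube k ?F x"
    proof (rule subcube_cong[OF x(2)])
      fix y assume y: "y \<in> cube_verts k"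
      have "b \<in> {0..int m}" if mem: "b \<in> set (map2 (+) x y)" for b
      proof -
        obtain i where "i < length (map2 (+) x y)" "b = map2 (+) x y ! i"
          using mem by (metis in_set_conv_nth)
        then have b: "b = x ! i + y ! i" "x ! i \<in> set x" "y ! i \<in> set y" by simp_all
        have "set y \<subseteq> {0..int 1}" using y by (simp add: verts_box)
        then have "x ! i \<in> {0..<int m}" "y ! i \<in> {0..int 1}" using b(2,3) x(1) by (auto dest: subsetD)
        then show ?thesis using b(1) by auto
      qed
      then have "map2 (+) x y \<in> verts (box k m)"
        using x(2) y unfolding verts_box by (auto simp: cube_verts_length simp del: set_map)
      then show "f (map2 (+) x y) = ?F (map2 (+) x y)"
        using x(2) y by (simp add: extend_box_def verts_grid cube_verts_length)
    qed
  qed (auto simp: atLeastLessThanPlusOne_atLeastAtMost_int[symmetric])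
  moreover have "homologous k G (box_sum k (- int m) (int m) ?F) (box_sum k 0 (int m) ?F)"
    by (rule homologous_degenerate, rule box_sum_shrink[OF k F _ _ out]) simp_all
  ultimately show "homologous k G (box_chain k m f) (box_sum k (- int m) (int m) ?F)"
    using homologous_sym by simp
qed

lemma box_sum_radius:
  assumes "1 \<le> k" "grid_map k G F" "const_outside k v r F" "const_outside k v r' F"
  shows "homologous k G (box_sum k (- r) r F) (box_sum k (- r') r' F)"
proof -
  have "homologous k G (box_sum k (- max r r') (max r r') F) (box_sum k (- r) r F)"
    "homologous k G (box_sum k (- max r r') (max r r') F) (box_sum k (- r') r' F)"
    using assms by (intro const_outside_shrink; simp)+
  then show ?thesis using homologous_sym homologous_trans by blast
qed

text \<open>Each stage of a homotopy is based with a radius of its own. The induction over the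
  stages therefore carries an existential radius and compares consecutive stages on a box that
  contains both supports.\<close>

lemma based_homotopy_homologous:
  assumes G: "wf_graph G" and k: "1 \<le> k" and FF: "(F, F') \<in> based_homotopy k G v"
    and r: "const_outside k v r F" and r': "const_outside k v r' F'"
  shows "homologous k G (box_sum k (- r) r F) (box_sum k (- r') r' F')"
proof -
  obtain m H where H: "H \<in> graph_maps (cart_prod (grid k) (path_graph m)) G"
    and based: "\<And>j. j \<in> verts (path_graph m) \<Longrightarrow> (\<lambda>x\<in>verts (grid k). H (x, j)) \<in> based_maps k G v"
    and ends: "(\<lambda>x\<in>verts (grid k). H (x, 0)) = F" "(\<lambda>x\<in>verts (grid k). H (x, int m)) = F'"
    using FF unfolding based_homotopy_def by blast
  define h where "h j = (\<lambda>x\<in>verts (grid k). H (x, int j))" for j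
  have hb: "h j \<in> based_maps k G v" if "j \<le> m" for j
    unfolding h_def using that by (intro based) (simp add: path_graph_def)
  have "\<exists>s\<ge>0. const_outside k v s (h j) \<and> homologous k G (box_sum k (- r) r F) (box_sum k (- s) s (h j))"
    if "j \<le> m" for j
    using that
  proof (induction j)
    case 0
    obtain s where "0 \<le> s" "const_outside k v s (h 0)" "grid_map k G (h 0)"
      using hb[of 0] unfolding based_maps_iff by blast
    moreover have "h 0 = F" using ends by (simp add: h_def)
    ultimately show ?case using box_sum_radius[OF k _ r] by blast
  next
    case (Suc j)
    then obtain s where s: "0 \<le> s" "const_outside k v s (h j)"
      "homologous k G (box_sum k (- r) r F) (box_sum k (- s) s (h j))" by auto
    obtain s' where s': "0 \<le> s'" "const_outside k v s' (h (Suc j))" "grid_map k G (h (Suc j))"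
      using hb[OF Suc.prems] unfolding based_maps_iff by blast
    have g: "grid_map k G (h j)" using hb[of j] Suc.prems unfolding based_maps_iff by simp
    have "near G (h j x) (h (Suc j) x)" if x: "length x = k" for x
    proof -
      have "near G (H (x, int j)) (H (x, int (Suc j)))"
        using H Suc.prems x unfolding graph_maps_def near_def cart_prod_def path_graph_def verts_grid
        by simp
      then show ?thesis using x by (simp add: h_def verts_grid)
    qed
    then have n: "near G (h j x) (h (Suc j) x) \<and> near G (h (Suc j) x) (h j x)" if "length x = k" for x
      using that near_sym[OF G] by blast
    let ?R = "max s s'"
    have c: "const_outside k v ?R (h j)" "const_outside k v ?R (h (Suc j))"
      using const_outside_mono[OF s(2), of ?R] const_outside_mono[OF s'(2), of ?R] by simp_all
    have "homologous k G (box_sum k (- ?R) ?R (h (Suc j))) (box_sum k (- ?R) ?R (h j))"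
      using s(1) by (intro box_sum_homologous[OF g c(1) s'(3) c(2) n]) simp_all
    moreover have "homologous k G (box_sum k (- ?R) ?R (h j)) (box_sum k (- s) s (h j))"
      by (rule box_sum_radius[OF k g c(1) s(2)])
    ultimately have "homologous k G (box_sum k (- r) r F) (box_sum k (- ?R) ?R (h (Suc j)))"
      using s(3) homologous_sym homologous_trans by blast
    then show ?case using c(2) s(1) by (intro exI[of _ ?R]) simp
  qed
  then obtain s where s: "const_outside k v s (h m)"
    "homologous k G (box_sum k (- r) r F) (box_sum k (- s) s (h m))" by blast
  have "h m = F'" using ends by (simp add: h_def)
  moreover have "grid_map k G (h m)" using hb[of m] unfolding based_maps_iff by simp
  ultimately show ?thesis
    using s box_sum_radius[OF k _ _ r', of G s] homologous_trans by metis
qed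

section \<open>Box representatives, the value of \<open>psi\<close>, and surjectivity\<close>

subsection \<open>Translating a based map into a box\<close>

text \<open>The coordinates are shifted by \<open>r\<close> one after the other, \<open>j\<close> being the total shift so far.\<close>

fun shift :: "int \<Rightarrow> int \<Rightarrow> int list \<Rightarrow> int list" where
  "shift r j [] = []"
| "shift r j (a # x) = (a - max 0 (min r j)) # shift r (j - r) x"

lemma length_shift [simp]: "length (shift r j x) = length x"
  by (induction r j x rule: shift.induct) auto

lemma shift_nonpos: "\<lbrakk>0 \<le> r; j \<le> 0\<rbrakk> \<Longrightarrow> shift r j x = x"
  by (induction r j x rule: shift.induct) auto

lemma shift_full: "\<lbrakk>0 \<le> r; int (length x) * r \<le> j\<rbrakk> \<Longrightarrow> shift r j x = map (\<lambda>a. a - r) x"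
proof (induction r j x rule: shift.induct)
  case (2 r j a x)
  have "0 \<le> r * int (length x)" using 2 by simp
  moreover have "r + r * int (length x) \<le> j" using 2 by (simp add: algebra_simps)
  ultimately have "r \<le> j" by linarith
  then show ?case using 2 by (simp add: algebra_simps)
qed simp

lemma shift_nbr: "nbr x y \<Longrightarrow> nbr (shift r j x) (shift r j y)"
proof (induction arbitrary: j rule: nbr.induct)
  case (here a b x)
  then show ?case by (simp add: nbr_Cons)
next
  case (there x y a)
  then show ?case by (simp add: nbr_Cons)
qed

text \<open>Translating all coordinates at once would move points diagonally. Here one unit of
  \<open>j\<close> changes at most one coordinate, so consecutive stages form a homotopy.\<close>

lemma shift_step: "0 \<le> r \<Longrightarrow> shift r j x = shift r (j + 1) x \<or> nbr (shift r j x) (shift r (j + 1) x)"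
proof (induction x arbitrary: j)
  case (Cons a x)
  consider "j < 0" | "0 \<le> j" "j < r" | "r \<le> j" by linarith
  then show ?case
  proof cases
    case 1
    then show ?thesis using Cons.prems by (simp add: shift_nonpos)
  next
    case 2
    then have "shift r (j - r) x = x" "shift r (j + 1 - r) x = x"
      using Cons.prems by (simp_all add: shift_nonpos)
    moreover have "max 0 (min r j) = j" "max 0 (min r (j + 1)) = j + 1" using 2 by auto
    ultimately show ?thesis by (simp add: nbr_Cons)
  next
    case 3
    then have "max 0 (min r j) = r" "max 0 (min r (j + 1)) = r" using Cons.prems by auto
    then show ?thesis using Cons.IH[OF Cons.prems, of "j - r"] by (auto simp: nbr_Cons algebra_simps)
  qed
qed simp

lemma shift_far: "\<lbrakk>0 \<le> r; a \<in> set x\<rbrakk> \<Longrightarrow> \<exists>b\<in>set (shift r j x). \<bar>a\<bar> - r \<le> \<bar>b\<bar>"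
proof (induction x arbitrary: j)
  case (Cons c x)
  show ?case
  proof (cases "a = c")
    case True
    have "\<bar>c\<bar> - r \<le> \<bar>c - max 0 (min r j)\<bar>" using Cons.prems by linarith
    then show ?thesis using True by simp
  next
    case False
    then show ?thesis using Cons.IH[of "j - r"] Cons.prems by auto
  qed
qed simp

text \<open>No coordinate moves by more than \<open>r\<close>, so one of absolute value at least
  \<open>2r\<close> still has absolute value at least \<open>r\<close> after the shift.\<close>

lemma const_outside_shift:
  "\<lbrakk>0 \<le> r; const_outside k v r F\<rbrakk> \<Longrightarrow> const_outside k v (2 * r) (\<lambda>x. F (shift r j x))"
  unfolding const_outside_def
proof (intro allI impI)
  fix x assume r: "0 \<le> r" and out: "\<forall>x. length x = k \<longrightarrow> (\<exists>a\<in>set x. r \<le> \<bar>a\<bar>) \<longrightarrow> F x = v"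
    and x: "length x = k" "\<exists>a\<in>set x. 2 * r \<le> \<bar>a\<bar>"
  obtain a where a: "a \<in> set x" "2 * r \<le> \<bar>a\<bar>" using x(2) by blast
  obtain b where b: "b \<in> set (shift r j x)" "\<bar>a\<bar> - r \<le> \<bar>b\<bar>" using shift_far[OF r a(1)] by blast
  then have "r \<le> \<bar>b\<bar>" using a(2) by linarith
  then show "F (shift r j x) = v" using out x(1) b(1) by (metis length_shift)
qed

lemma grid_map_shift: "grid_map k G F \<Longrightarrow> grid_map k G (\<lambda>x. F (shift r j x))"
  unfolding grid_map_def using shift_nbr by simp

lemma grid_map_cong: "(\<And>x. length x = k \<Longrightarrow> F x = F' x) \<Longrightarrow> grid_map k G F \<longleftrightarrow> grid_map k G F'"
  using nbr_length unfolding grid_map_def by (smt (verit, best))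

lemma const_outside_cong:
  "(\<And>x. length x = k \<Longrightarrow> F x = F' x) \<Longrightarrow> const_outside k v r F \<longleftrightarrow> const_outside k v r F'"
  unfolding const_outside_def by auto

lemma restrict_based:
  assumes "grid_map k G F" "const_outside k v r F" "0 \<le> r"
  shows "(\<lambda>x\<in>verts (grid k). F x) \<in> based_maps k G v"
    "const_outside k v r (\<lambda>x\<in>verts (grid k). F x)"
  using assms grid_map_cong[of k F "\<lambda>x\<in>verts (grid k). F x" G]
    const_outside_cong[of k F "\<lambda>x\<in>verts (grid k). F x" v r]
  unfolding based_maps_iff by (auto simp: verts_grid)

lemma box_representative:
  assumes G: "wf_graph G" and F: "F \<in> based_maps k G v" "const_outside k v r F" "0 \<le> r"
    and v: "v \<in> verts G"
  shows "\<exists>m. \<exists>f\<in>box_maps k m G v. (F, extend_box k m v f) \<in> based_homotopy k G v"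
proof -
  \<comment> \<open>\<open>k\<close> coordinates travel \<open>r\<close> units each, one unit per
    stage; the centred box \<open>[-r, r]^k\<close> then arrives at \<open>[0, m]^k\<close>.\<close>
  define N where "N = k * nat r"
  define m where "m = nat (2 * r)"
  let ?T = "\<lambda>x. F (map (\<lambda>a. a - r) x)"
  have gF: "grid_map k G F" and eF: "F \<in> extensional (verts (grid k))"
    using F(1) unfolding based_maps_iff by blast+
  have T: "F (shift r (int N) x) = ?T x" if "length x = k" for x
    using shift_full[of r x "int N"] that F(3) by (simp add: N_def)
  have gT: "grid_map k G ?T"
    using grid_map_shift[OF gF, of r "int N"] grid_map_cong[of k ?T "\<lambda>x. F (shift r (int N) x)" G] T
    by simp
  define f where "f = (\<lambda>x\<in>verts (box k m). ?T x)"
  have T_out: "?T x = v" if "length x = k" "a \<in> set x" "a \<le> 0 \<or> int m \<le> a" for x a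
  proof -
    have "r \<le> \<bar>a - r\<bar>" using that(3) F(3) by (auto simp: m_def)
    then show ?thesis using that by (intro const_outsideD[OF F(2), of _ "a - r"]) auto
  qed
  have f: "f \<in> box_maps k m G v"
    unfolding box_maps_def
  proof (intro CollectI conjI ballI impI)
    show "f \<in> graph_maps (box k m) G"
      unfolding graph_maps_box
    proof (intro conjI ballI impI)
      show "f \<in> verts (box k m) \<rightarrow>\<^sub>E verts G"
        using grid_mapD(1)[OF gT] by (auto simp: f_def verts_box)
      fix x y assume "x \<in> verts (box k m)" "y \<in> verts (box k m)" "nbr x y"
      then show "near G (f x) (f y)"
        using grid_mapD(2)[OF gT, of x y] by (simp add: f_def verts_box)
    qed
    fix x assume x: "x \<in> verts (box k m)" "\<exists>i<k. x ! i = 0 \<or> x ! i = int m"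
    then have len: "length x = k" by (simp add: verts_box)
    obtain i where "i < k" "x ! i = 0 \<or> x ! i = int m" using x(2) by blast
    then have "?T x = v" using len by (intro T_out[of x "x ! i"]) auto
    then show "f x = v" using x(1) by (simp add: f_def)
  qed
  have ext: "extend_box k m v f = (\<lambda>x\<in>verts (grid k). ?T x)"
    unfolding extend_box_def
  proof (rule restrict_ext)
    fix x assume "x \<in> verts (grid k)"
    then have len: "length x = k" by (simp add: verts_grid)
    show "(if x \<in> verts (box k m) then f x else v) = ?T x"
    proof (cases "x \<in> verts (box k m)")
      case False
      then have "\<not> set x \<subseteq> {0..int m}" using len by (simp add: verts_box)
      then obtain a where "a \<in> set x" "a \<notin> {0..int m}" by blast
      then have "?T x = v" using len by (intro T_out[of x a]) auto
      then show ?thesis using False by simp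
    qed (simp add: f_def)
  qed
  define H where "H = (\<lambda>p\<in>verts (cart_prod (grid k) (path_graph N)). F (shift r (snd p) (fst p)))"
  have Hx: "(\<lambda>x\<in>verts (grid k). H (x, j)) = (\<lambda>x\<in>verts (grid k). F (shift r j x))"
    if "j \<in> verts (path_graph N)" for j
    using that by (intro restrict_ext) (simp add: H_def cart_prod_def)
  have ends: "0 \<in> verts (path_graph N)" "int N \<in> verts (path_graph N)"
    by (simp_all add: path_graph_def)
  have H: "H \<in> graph_maps (cart_prod (grid k) (path_graph N)) G"
    unfolding graph_maps_def
  proof (intro CollectI conjI ballI impI)
    show "H \<in> verts (cart_prod (grid k) (path_graph N)) \<rightarrow>\<^sub>E verts G"
      using grid_mapD(1)[OF grid_map_shift[OF gF]]
      by (auto simp: H_def cart_prod_def verts_grid)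
    fix p q assume p: "p \<in> verts (cart_prod (grid k) (path_graph N))"
      and q: "q \<in> verts (cart_prod (grid k) (path_graph N))"
      and pq: "p = q \<or> adj (cart_prod (grid k) (path_graph N)) p q"
    obtain x i where px: "p = (x, i)" by (cases p)
    obtain y j where qy: "q = (y, j)" by (cases q)
    have len: "length x = k" "length y = k" using p q px qy by (auto simp: cart_prod_def verts_grid)
    have "p = q \<or> x = y \<and> \<bar>i - j\<bar> = 1 \<or> i = j \<and> nbr x y"
      using pq by (auto simp: px qy cart_prod_def path_graph_def adj_grid)
    then have "near G (F (shift r i x)) (F (shift r j y))"
    proof (elim disjE)
      assume "p = q"
      then show ?thesis using px qy by simp
    next
      assume "x = y \<and> \<bar>i - j\<bar> = 1"
      then have xy: "x = y" and "j = i + 1 \<or> i = j + 1" by auto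
      moreover have "near G (F (shift r i x)) (F (shift r (i + 1) x))" for i
        using shift_step[OF F(3), of i x] grid_mapD(2)[OF gF, of "shift r i x"] len by auto
      ultimately show ?thesis using near_sym[OF G] by auto
    next
      assume "i = j \<and> nbr x y"
      then show ?thesis using grid_mapD(2)[OF gF] shift_nbr len by simp
    qed
    then show "H p = H q \<or> adj G (H p) (H q)"
      using p q by (simp add: H_def px qy near_def)
  qed
  have based: "(\<lambda>x\<in>verts (grid k). H (x, j)) \<in> based_maps k G v" if "j \<in> verts (path_graph N)" for j
    unfolding Hx[OF that]
    using F by (intro restrict_based(1)[where r = "2 * r"] grid_map_shift gF const_outside_shift) simp_all
  have start: "(\<lambda>x\<in>verts (grid k). H (x, 0)) = F"
    unfolding Hx[OF ends(1)] using eF F(3) by (simp add: shift_nonpos extensional_restrict)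
  have final: "(\<lambda>x\<in>verts (grid k). H (x, int N)) = extend_box k m v f"
    unfolding Hx[OF ends(2)] ext by (rule restrict_ext) (simp add: T verts_grid)
  have "(F, extend_box k m v f) \<in> based_homotopy k G v"
    unfolding based_homotopy_def
    using H F(1) based start final based[OF ends(2), unfolded final] by blast
  then show ?thesis using f by blast
qed

text \<open>The set behind \<open>the_elem\<close> is nonempty because a based map can be translated
  into a box, and its elements agree because homotopic maps have homologous box sums.\<close>

lemma psi_class:
  assumes G: "wf_graph G" and k: "1 \<le> k" and v: "v \<in> verts G"
    and F: "F \<in> based_maps k G v" "const_outside k v r F" "0 \<le> r"
  shows "psi k G v (based_homotopy k G v `` {F}) = cubical_homology_class k G (box_sum k (- r) r F)"
proof -
  let ?S = "{cubical_homology_class k G (box_chain k m f) | m f.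
     f \<in> box_maps k m G v \<and> extend_box k m v f \<in> based_homotopy k G v `` {F}}"
  have eq: "cubical_homology_class k G (box_chain k m f) = cubical_homology_class k G (box_sum k (- r) r F)"
    if f: "f \<in> box_maps k m G v" and "extend_box k m v f \<in> based_homotopy k G v `` {F}" for m f
  proof -
    have h: "(F, extend_box k m v f) \<in> based_homotopy k G v" using that by simp
    then have "extend_box k m v f \<in> based_maps k G v" by (auto simp: based_homotopy_def)
    then have g: "grid_map k G (extend_box k m v f)" by (simp add: based_maps_iff)
    note b = box_chain_extend[OF f k g]
    from b(2) based_homotopy_homologous[OF G k h F(2) b(1)] show ?thesis
      by (metis homologous_class_eq)
  qed
  obtain m f where "f \<in> box_maps k m G v" "(F, extend_box k m v f) \<in> based_homotopy k G v"
    using box_representative[OF G F v] by blast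
  then have "?S = {cubical_homology_class k G (box_sum k (- r) r F)}" using eq by blast
  then show ?thesis unfolding psi_def by simp
qed

lemma psi_surjective:
  assumes G: "wf_graph G" and k: "1 \<le> k" and v: "v \<in> verts G"
    and sph: "\<And>z. cycle k G z \<Longrightarrow> spherical k G v z"
  shows "psi k G v ` carrier (A_group k G v) = carrier (cubical_homology k G)"
  unfolding carrier_homology[OF k]
proof (intro subset_antisym subsetI)
  fix X assume "X \<in> psi k G v ` carrier (A_group k G v)"
  then obtain F where X: "X = psi k G v (based_homotopy k G v `` {F})" and F: "F \<in> based_maps k G v"
    by (auto simp: A_group_def elim: quotientE)
  obtain r where r: "0 \<le> r" "const_outside k v r F" "grid_map k G F"
    using F unfolding based_maps_iff by blast
  have "X = cubical_homology_class k G (box_sum k (- r) r F)"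
    unfolding X by (rule psi_class[OF G k v F r(2,1)])
  moreover have "cycle k G (box_sum k (- r) r F)" by (rule box_sum_cycle[OF r(3,2,1)])
  ultimately show "X \<in> cubical_homology_class k G ` {z. cycle k G z}" by blast
next
  fix X assume "X \<in> cubical_homology_class k G ` {z. cycle k G z}"
  then obtain z where z: "cycle k G z" and X: "X = cubical_homology_class k G z" by blast
  obtain F r where F: "0 \<le> r" "grid_map k G F" "const_outside k v r F"
    and h: "homologous k G z (box_sum k (- r) r F)"
    using sph[OF z] unfolding spherical_def by blast
  let ?F = "\<lambda>x\<in>verts (grid k). F x"
  have "X = cubical_homology_class k G (box_sum k (- r) r F)"
    unfolding X by (rule homologous_class_eq[OF h])
  also have "box_sum k (- r) r F = box_sum k (- r) r ?F"
    by (rule box_sum_cong) (simp add: verts_grid)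
  also have "cubical_homology_class k G \<dots> = psi k G v (based_homotopy k G v `` {?F})"
    using psi_class[OF G k v restrict_based[OF F(2,3,1)] F(1)] by simp
  finally show "X \<in> psi k G v ` carrier (A_group k G v)"
    using restrict_based(1)[OF F(2,3,1)] by (simp add: A_group_def quotientI)
qed

theorem theorem5p10:
  fixes G :: "nat \<Rightarrow> 'a svert ugraph"
  assumes "connected_graph (G 1)"
    and "\<nexists>c. is_cycle (G 1) c \<and> (length c = 3 \<or> length c = 4)"
    and "\<And>n. n \<ge> 1 \<Longrightarrow> G (n + 1) = suspension (n + 3) (G n)"
  shows "\<forall>n\<ge>1. \<forall>k. 1 \<le> k \<and> k \<le> n \<longrightarrow> (\<forall>v0\<in>verts (G n).
    psi k (G n) v0 ` carrier (A_group k (G n) v0) = carrier (cubical_homology k (G n)))"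
proof -
  \<comment> \<open>The claim is made for every base vertex: the suspension step uses one chosen
    \<open>v0\<close> below and delivers only \<open>South\<close> above. Connectedness is carried
    along to move between base vertices.\<close>
  have main: "connected_graph (G n) \<and> (\<forall>k v z. 1 \<le> k \<and> k \<le> n \<and> v \<in> verts (G n) \<and> cycle k (G n) z \<longrightarrow>
      spherical k (G n) v z)" if "1 \<le> n" for n
    using that
  proof (induction n rule: dec_induct)
    case base
    then show ?case using assms(1) cycle_spherical_1 by (metis order_antisym)
  next
    case (step n)
    then have conn: "connected_graph (G n)" by blast
    then obtain v0 where v0: "v0 \<in> verts (G n)" by (auto simp: connected_graph_def)
    interpret suspended "G n" "n + 3" v0
      using connected_graph_wf[OF conn] v0 by unfold_locales simp_all
    have SG: "G (Suc n) = suspension (n + 3) (G n)" using assms(3)[OF step(1)] by (simp only: Suc_eq_plus1)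
    have "spherical k (G (Suc n)) v z"
      if *: "1 \<le> k" "k \<le> Suc n" "v \<in> verts (G (Suc n))" "cycle k (G (Suc n)) z" for k v z
    proof (cases "k = 1")
      case True
      show ?thesis
        unfolding True SG by (rule cycle_spherical_1[OF connected_SG]) (use * True in \<open>simp_all add: SG\<close>)
    next
      case False
      then obtain k' where k': "k = Suc k'" "1 \<le> k'" "k' \<le> n" using * by (cases k) auto
      have sph: "spherical (Suc k') SG South z"
      proof (rule cycle_spherical_Suc)
        show "cycle (Suc k') SG z" using * k' SG by simp
        show "spherical k' (G n) v0 y" if "cycle k' (G n) y" for y
          using step.IH that k'(2,3) v0 by simp
      qed (use k' in simp_all)
      show ?thesis
        unfolding k'(1) SG
        by (rule spherical_base[OF connected_SG _ sph South_in_SG]) (use *(3) in \<open>simp_all add: SG\<close>)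
    qed
    then show ?case using connected_SG by (simp add: SG)
  qed
  show ?thesis
    using main by (intro allI impI ballI psi_surjective connected_graph_wf) blast+
qed

end
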